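(* Let $0<\alpha<1$ and $0<T<\infty$. Let $\mathcal{H}$ be a separable Hilbert space, and let $\mathcal{L},\mathcal{M}$ be self-adjoint operators on $\mathcal{H}$ that are diagonalisable with respect to a common orthonormal basis $\{e_\xi\}_{\xi\in\mathcal{I}}$ of $\mathcal{H}$ ($\mathcal{I}$ a countable set), $\mathcal{L}e_\xi=\lambda_\xi e_\xi$, $\mathcal{M}e_\xi=\mu_\xi e_\xi$, with real eigenvalues satisfying $\lambda_\xi\ge c_L>0$ and $\mu_\xi\ge c_M>0$ for all $\xi\in\mathcal{I}$, where $c_L,c_M$ are constants. Let $\varphi\in\mathcal{H}^1_{\mathcal{L}}\cap\mathcal{H}^1_{\mathcal{M}}$ and $f\in W^1([0,T];\mathcal{H})$. Then there exists a unique solution $u$ of the problem $$\mathcal{D}_t^\alpha[u(t)+\mathcal{L}u(t)]+\mathcal{M}u(t)=f(t)\ \text{ in }\mathcal{H},\quad 0<t<T,\qquad u(0)=\varphi,$$ such that $u\in L^2([0,T];\mathcal{H}^1_{\mathcal{M}})\cap W^\alpha([0,T];\mathcal{H}^1_{\mathcal{L}})$. This solution can be written in the form $$\begin{aligned}u(t)=&\sum_{\xi\in\mathcal{I}}\varphi_\xi E_{\alpha,1}\left(-\frac{\mu_\xi}{1+\lambda_\xi}t^\alpha\right)e_\xi+\sum_{\xi\in\mathcal{I}}\frac{f_\xi(t)}{\mu_\xi}e_\xi-\sum_{\xi\in\mathcal{I}}\frac{f_\xi(0)}{\mu_\xi}E_{\alpha,1}\left(-\frac{\mu_\xi}{1+\lambda_\xi}t^\alpha\right)e_\xi\\&-\sum_{\xi\in\mathcal{I}}\left[\int_0^t\frac{f_\xi'(t-s)}{\mu_\xi}E_{\alpha,1}\left(-\frac{\mu_\xi}{1+\lambda_\xi}s^\alpha\right)ds\right]e_\xi,\end{aligned}$$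 where $\varphi_\xi=(\varphi,e_\xi)_{\mathcal{H}}$ and $f_\xi(t)=(f(t),e_\xi)_{\mathcal{H}}$.
   Context: Mittag-Leffler function: $E_{\alpha,\beta}(z)=\sum_{m=0}^\infty \frac{z^m}{\Gamma(\alpha m+\beta)}$. Fractional calculus on $[0,T]$, for $0<\alpha<1$: the Riemann-Liouville integral is $I^\alpha[g](t)=\frac{1}{\Gamma(\alpha)}\int_0^t(t-s)^{\alpha-1}g(s)\,ds$ for integrable $g$; the Caputo derivative of a differentiable $g$ is $\mathcal{D}_t^\alpha[g](t)=I^{1-\alpha}[g'](t)=\frac{1}{\Gamma(1-\alpha)}\int_0^t\frac{g'(s)}{(t-s)^\alpha}\,ds$. For a continuous but not necessarily differentiable $g$, $\mathcal{D}_t^\alpha g$ is understood in the usual extended sense $\mathcal{D}_t^\alpha g=\frac{d}{dt}I^{1-\alpha}[g-g(0)]$ (with $I^{1-\alpha}[g-g(0)]$ absolutely continuous), which agrees with the preceding formula for regular $g$. For $\alpha=1$, $\mathcal{D}_t^1=d/dt$. The same definitions are used for functions with values in a Hilbert space. Spaces: for $l,m\in\mathbb{R}$, powers of $\mathcal{L},\mathcal{M}$ are defined spectrally ($\mathcal{L}^l e_\xi=\lambda_\xi^l e_\xi$, $\mathcal{M}^m e_\xi=\mu_\xi^m e_\xi$) and $\mathcal{H}^l_{\mathcal{L}}=\{u\in\mathcal{H}:\mathcal{L}^l u\in\mathcal{H}\}$, $\mathcal{H}^m_{\mathcal{M}}=\{u\in\mathcal{H}:\mathcal{M}^m u\in\mathcal{H}\}$,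 normed by $\|\mathcal{L}^l u\|_{\mathcal{H}}$, $\|\mathcal{M}^m u\|_{\mathcal{H}}$ respectively. For a separable Hilbert space $X$ and $0<\alpha\le1$, $W^\alpha([0,T];X)$ is the space of all $L^2$-integrable $g:[0,T]\to X$ with $L^2$-integrable $\mathcal{D}_t^\alpha g:[0,T]\to X$, with norm $\|g\|_{L^2([0,T];X)}+\|\mathcal{D}_t^\alpha g\|_{L^2([0,T];X)}<\infty$. In particular $W^1([0,T];X)$ is the usual first-order $L^2$ Sobolev space of $X$-valued functions. A (generalised) solution of the problem is a function $u\in L^2([0,T];\mathcal{H}^1_{\mathcal{L}})\cap L^2([0,T];\mathcal{H}^1_{\mathcal{M}})\cap W^\alpha([0,T];\mathcal{H}^1_{\mathcal{L}})$ satisfying the equation in $\mathcal{H}$ (for almost every $t$) and the initial condition. *)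

theory Defs
  imports "HOL-Analysis.Analysis"
begin

text \<open>
  The scalar type \<open>'k\<close> ranges over the finite-dimensional normed fields, i.e. (up to isometric
  isomorphism) over \<^typ>\<open>real\<close> and \<^typ>\<open>complex\<close>.  In these, \<^term>\<open>inner z 1\<close> is the real
  part of \<open>z\<close>, so \<open>kcnj\<close> is the identity on \<^typ>\<open>real\<close> and \<^const>\<open>cnj\<close> on \<^typ>\<open>complex\<close>.
\<close>

definition kcnj :: "'k::{real_normed_field,euclidean_space} \<Rightarrow> 'k" where
  "kcnj z = of_real (2 * inner z 1) - z"

lemma kcnj_real: "kcnj (x::real) = x"
  by (simp add: kcnj_def)

lemma kcnj_complex: "kcnj z = cnj z"
  by (simp add: kcnj_def complex_eq_iff)

text \<open>
  The library's inner product is real-valued.  A Hilbert space over \<open>'k\<close> is a complete real inner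
  product space with a scalar multiplication extending \<^const>\<open>scaleR\<close> and a \<open>'k\<close>-valued inner
  product \<open>ip\<close> (linear in the first argument) whose real part is \<^const>\<open>inner\<close>; hence
  \<open>ip x x = of_real ((norm x)\<^sup>2)\<close>.  Separability is the class \<open>second_countable_topology\<close>.
\<close>

locale hilbert_over = vector_space sc
  for sc :: "'k::{real_normed_field,euclidean_space}
    \<Rightarrow> 'a::{real_inner,banach,second_countable_topology} \<Rightarrow> 'a" +
  fixes ip :: "'a \<Rightarrow> 'a \<Rightarrow> 'k"
  assumes scale_of_real: "sc (of_real r) x = r *\<^sub>R x"
    and ip_add_left: "ip (x + y) z = ip x z + ip y z"
    and ip_scale_left: "ip (sc c x) y = c * ip x y"
    and ip_commute: "ip y x = kcnj (ip x y)"
    and ip_inner: "inner (ip x y) 1 = inner x y"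

lemma hilbert_over_real:
  "hilbert_over ((*\<^sub>R) :: real \<Rightarrow> 'a \<Rightarrow> 'a::{real_inner,banach,second_countable_topology}) inner"
  by unfold_locales
    (auto simp: algebra_simps inner_add_left kcnj_real inner_commute)

definition orthonormal_basis ::
  "('k::field \<Rightarrow> 'a::{ab_group_add,topological_space} \<Rightarrow> 'a) \<Rightarrow> ('a \<Rightarrow> 'a \<Rightarrow> 'k)
    \<Rightarrow> 'i set \<Rightarrow> ('i \<Rightarrow> 'a) \<Rightarrow> bool" where
  "orthonormal_basis sc ip I e \<longleftrightarrow>
     (\<forall>\<xi>\<in>I. \<forall>\<eta>\<in>I. ip (e \<xi>) (e \<eta>) = (if \<xi> = \<eta> then 1 else 0)) \<and>
     closure (module.span sc (e ` I)) = UNIV"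

text \<open>
  A possibly unbounded operator is a function together with its domain \<open>D\<close>; values off \<open>D\<close> are
  irrelevant.  The last conjunct says that the domain of the adjoint is contained in \<open>D\<close>.
\<close>

definition self_adjoint ::
  "('k::field \<Rightarrow> 'a::{ab_group_add,topological_space} \<Rightarrow> 'a) \<Rightarrow> ('a \<Rightarrow> 'a \<Rightarrow> 'k)
    \<Rightarrow> 'a set \<Rightarrow> ('a \<Rightarrow> 'a) \<Rightarrow> bool" where
  "self_adjoint sc ip D A \<longleftrightarrow>
     module.subspace sc D \<and> closure D = UNIV \<and>
     (\<forall>x\<in>D. \<forall>y\<in>D. A (x + y) = A x + A y) \<and>
     (\<forall>c. \<forall>x\<in>D. A (sc c x) = sc c (A x)) \<and>
     (\<forall>x\<in>D. \<forall>y\<in>D. ip (A x) y = ip x (A y)) \<and>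
     (\<forall>y. (\<exists>z. \<forall>x\<in>D. ip (A x) y = ip x z) \<longrightarrow> y \<in> D)"

text \<open>
  Powers of the operator with eigenvalues \<open>\<nu> \<xi> > 0\<close> at \<open>e \<xi>\<close>, and their domains (the series has to
  converge in the space).
\<close>

definition spectral_power ::
  "('k::{real_normed_field,euclidean_space} \<Rightarrow> 'a::{real_inner,banach} \<Rightarrow> 'a)
    \<Rightarrow> ('a \<Rightarrow> 'a \<Rightarrow> 'k) \<Rightarrow> 'i set \<Rightarrow> ('i \<Rightarrow> 'a) \<Rightarrow> ('i \<Rightarrow> real) \<Rightarrow> real \<Rightarrow> 'a \<Rightarrow> 'a" where
  "spectral_power sc ip I e \<nu> l u =
     (\<Sum>\<^sub>\<infinity>\<xi>\<in>I. sc (of_real (\<nu> \<xi> powr l) * ip u (e \<xi>)) (e \<xi>))"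

definition spectral_space ::
  "('k::{real_normed_field,euclidean_space} \<Rightarrow> 'a::{real_inner,banach} \<Rightarrow> 'a)
    \<Rightarrow> ('a \<Rightarrow> 'a \<Rightarrow> 'k) \<Rightarrow> 'i set \<Rightarrow> ('i \<Rightarrow> 'a) \<Rightarrow> ('i \<Rightarrow> real) \<Rightarrow> real \<Rightarrow> 'a set" where
  "spectral_space sc ip I e \<nu> l =
     {u. (\<lambda>\<xi>. sc (of_real (\<nu> \<xi> powr l) * ip u (e \<xi>)) (e \<xi>)) summable_on I}"

definition mittag_leffler :: "real \<Rightarrow> real \<Rightarrow> real \<Rightarrow> real" where
  "mittag_leffler \<alpha> \<beta> z = (\<Sum>m. z ^ m / Gamma (\<alpha> * real m + \<beta>))"

definition rl_integral ::
  "real \<Rightarrow> (real \<Rightarrow> 'a::{banach,second_countable_topology}) \<Rightarrow> real \<Rightarrow> 'a" where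
  "rl_integral \<alpha> g t =
     (1 / Gamma \<alpha>) *\<^sub>R (LINT s:{0..t}|lebesgue. (t - s) powr (\<alpha> - 1) *\<^sub>R g s)"

text \<open>
  The extended Caputo derivative is the derivative of \<open>caputo_primitive\<close>: of
  \<open>I\<^sup>1\<^sup>-\<^sup>\<alpha>[g - g(0)]\<close> for \<open>0 < \<alpha> < 1\<close>, and of \<open>g\<close> itself for \<open>\<alpha> = 1\<close>.
\<close>

definition caputo_primitive ::
  "real \<Rightarrow> (real \<Rightarrow> 'a::{banach,second_countable_topology}) \<Rightarrow> real \<Rightarrow> 'a" where
  "caputo_primitive \<alpha> g = (if \<alpha> = 1 then g else rl_integral (1 - \<alpha>) (\<lambda>s. g s - g 0))"

definition caputo ::
  "real \<Rightarrow> (real \<Rightarrow> 'a::{banach,second_countable_topology}) \<Rightarrow> real \<Rightarrow> 'a" where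
  "caputo \<alpha> g t = vector_derivative (caputo_primitive \<alpha> g) (at t)"

definition absolutely_continuous_fun ::
  "real \<Rightarrow> real \<Rightarrow> (real \<Rightarrow> 'a::real_normed_vector) \<Rightarrow> bool" where
  "absolutely_continuous_fun a b g \<longleftrightarrow>
     (\<forall>\<epsilon>>0. \<exists>\<delta>>0. \<forall>(n::nat) p q.
        (\<forall>i<n. a \<le> p i \<and> p i \<le> q i \<and> q i \<le> b) \<and>
        disjoint_family_on (\<lambda>i. {p i<..<q i}) {..<n} \<and>
        (\<Sum>i<n. q i - p i) < \<delta> \<longrightarrow>
        (\<Sum>i<n. norm (g (q i) - g (p i))) < \<epsilon>)"

text \<open>
  Almost everywhere differentiability follows from absolute continuity for functions with values
  in a Hilbert space; it is listed so that \<^const>\<open>caputo\<close> is visibly a genuine derivative.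
\<close>

definition caputo_differentiable ::
  "real \<Rightarrow> real \<Rightarrow> (real \<Rightarrow> 'a::{banach,second_countable_topology}) \<Rightarrow> bool" where
  "caputo_differentiable \<alpha> T g \<longleftrightarrow>
     continuous_on {0..T} g \<and>
     absolutely_continuous_fun 0 T (caputo_primitive \<alpha> g) \<and>
     (AE t in lebesgue_on {0..T}. caputo_primitive \<alpha> g differentiable (at t))"

definition L2_on :: "real \<Rightarrow> (real \<Rightarrow> 'a::{banach,second_countable_topology}) \<Rightarrow> bool" where
  "L2_on T g \<longleftrightarrow>
     g \<in> borel_measurable (lebesgue_on {0..T}) \<and>
     integrable (lebesgue_on {0..T}) (\<lambda>t. (norm (g t))\<^sup>2)"

text \<open>
  Elements of \<open>W\<^sup>\<alpha>([0,T];\<H>)\<close> are represented by their continuous representatives, for which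
  \<open>g(0)\<close>, and hence the extended Caputo derivative, makes sense.
\<close>

definition W_on :: "real \<Rightarrow> real \<Rightarrow> (real \<Rightarrow> 'a::{banach,second_countable_topology}) \<Rightarrow> bool" where
  "W_on \<alpha> T g \<longleftrightarrow> L2_on T g \<and> caputo_differentiable \<alpha> T g \<and> L2_on T (caputo \<alpha> g)"

text \<open>
  The same spaces for functions with values in the Hilbert space \<open>X = spectral_space \<dots> \<nu> l\<close>, whose
  norm is \<open>norm (P u)\<close> for \<open>P = spectral_power \<dots> \<nu> l\<close>.  As the eigenvalues are bounded below by a
  positive constant (and \<open>l \<ge> 0\<close>), \<open>P\<close> is an isometric isomorphism from \<open>X\<close> onto the whole space, so
  measurability, continuity, integrals and derivatives in \<open>X\<close> are those of the composition with \<open>P\<close>.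
\<close>

definition L2_spectral ::
  "('k::{real_normed_field,euclidean_space} \<Rightarrow> 'a::{real_inner,banach,second_countable_topology} \<Rightarrow> 'a)
    \<Rightarrow> ('a \<Rightarrow> 'a \<Rightarrow> 'k) \<Rightarrow> 'i set \<Rightarrow> ('i \<Rightarrow> 'a) \<Rightarrow> ('i \<Rightarrow> real) \<Rightarrow> real
    \<Rightarrow> real \<Rightarrow> (real \<Rightarrow> 'a) \<Rightarrow> bool" where
  "L2_spectral sc ip I e \<nu> l T g \<longleftrightarrow>
     (AE t in lebesgue_on {0..T}. g t \<in> spectral_space sc ip I e \<nu> l) \<and>
     L2_on T (\<lambda>t. spectral_power sc ip I e \<nu> l (g t))"

definition W_spectral ::
  "('k::{real_normed_field,euclidean_space} \<Rightarrow> 'a::{real_inner,banach,second_countable_topology} \<Rightarrow> 'a)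
    \<Rightarrow> ('a \<Rightarrow> 'a \<Rightarrow> 'k) \<Rightarrow> 'i set \<Rightarrow> ('i \<Rightarrow> 'a) \<Rightarrow> ('i \<Rightarrow> real) \<Rightarrow> real
    \<Rightarrow> real \<Rightarrow> real \<Rightarrow> (real \<Rightarrow> 'a) \<Rightarrow> bool" where
  "W_spectral sc ip I e \<nu> l \<alpha> T g \<longleftrightarrow>
     (\<forall>t\<in>{0..T}. g t \<in> spectral_space sc ip I e \<nu> l) \<and>
     W_on \<alpha> T (\<lambda>t. spectral_power sc ip I e \<nu> l (g t))"

text \<open>
  The condition on \<open>caputo_differentiable\<close> follows from the preceding one; it records that the derivative
  in the equation exists.
\<close>

definition generalised_solution ::
  "('k::{real_normed_field,euclidean_space} \<Rightarrow> 'a::{real_inner,banach,second_countable_topology} \<Rightarrow> 'a)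
    \<Rightarrow> ('a \<Rightarrow> 'a \<Rightarrow> 'k) \<Rightarrow> 'i set \<Rightarrow> ('i \<Rightarrow> 'a)
    \<Rightarrow> ('a \<Rightarrow> 'a) \<Rightarrow> ('i \<Rightarrow> real) \<Rightarrow> ('a \<Rightarrow> 'a) \<Rightarrow> ('i \<Rightarrow> real)
    \<Rightarrow> real \<Rightarrow> real \<Rightarrow> 'a \<Rightarrow> (real \<Rightarrow> 'a) \<Rightarrow> (real \<Rightarrow> 'a) \<Rightarrow> bool" where
  "generalised_solution sc ip I e L lam M mu \<alpha> T \<phi> f u \<longleftrightarrow>
     L2_spectral sc ip I e lam 1 T u \<and>
     L2_spectral sc ip I e mu 1 T u \<and>
     W_spectral sc ip I e lam 1 \<alpha> T u \<and>
     caputo_differentiable \<alpha> T (\<lambda>s. u s + L (u s)) \<and>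
     (AE t in lebesgue_on {0<..<T}. caputo \<alpha> (\<lambda>s. u s + L (u s)) t + M (u t) = f t) \<and>
     u 0 = \<phi>"

end

(*
  Write c = mu_xi / (1 + lam_xi) and y(t) = E_{alpha,1}(-c t^alpha).  The function y solves the Volterra
  equation y = 1 - c I^alpha y, from which 0 <= y <= 1 and 1 - y <= c t^alpha / Gamma(alpha + 1) follow:
  zeros of y are isolated since E_{alpha,1} is entire, and since the kernel t^(alpha-1) is decreasing,
  y cannot become negative right after its first sign change.

  The coefficients of the solution are u_xi = phi_xi + V_xi / mu_xi, where
  V_xi = (1 - y) (f_xi(0) - mu_xi phi_xi) + (1 - y) * f_xi' (convolution on [0,t]).  The two bounds on y
  dominate lam_xi u_xi and mu_xi u_xi, uniformly in t, by square-summable sequences, and associativity of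
  convolution gives (1 + lam_xi) I^(1-alpha)[u_xi - phi_xi] = I^1[f_xi - mu_xi u_xi].  So the fractional
  derivatives of L u and u + L u are continuous functions with values in the Hilbert space.  No theorem on
  differentiating Bochner integrals of L^2 functions is therefore needed.

  For uniqueness, the coefficients d of the difference of two solutions satisfy I^(1-alpha) d = -c I^1 d by the
  fundamental theorem of calculus for absolutely continuous functions; applying I^alpha and iterating
  gives d = 0.
*)
theory Submission
  imports Defs "HOL-Complex_Analysis.Conformal_Mappings" "HOL-Real_Asymp.Real_Asymp"
begin

section \<open>Convolutions with power kernels\<close>

text \<open>Kernels and functions are extended by zero to the negative axis, so every integral over
  [0,t] is a convolution on the whole line; the composition rules then rest on the Beta integral and
  Fubini. The obstacle is the operator L. The single series of the formula, such as that of f_xi(t)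
  / mu_xi, need not lie in its domain, because lam_xi / mu_xi may be unbounded. Only the combination
  does, and regrouping it through 1 - y makes this visible: 1 - y is of size c, and c / mu_xi = 1 /
  (1 + lam_xi). The derivative f' is only square integrable. Its coefficients enter through their
  L^1 norms, which are square-summable by Cauchy-Schwarz on [0,T] and Bessel's inequality under the
  integral. Hence the scalar problem is set up for a merely integrable forcing. An arbitrary
  solution satisfies the equation only almost everywhere, with a merely absolutely continuous
  primitive. Its coefficients are handled by a gauge-integral proof of the fundamental theorem,
  which yields the integral of the derivative without knowing beforehand that it is
  integrable.\<close>

definition rl_kernel :: "real \<Rightarrow> real \<Rightarrow> real" where
  "rl_kernel b x = (if x > 0 then x powr (b - 1) / Gamma b else 0)"

text \<open>The integral runs over the whole line; when \<open>k\<close> and \<open>g\<close> vanish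
  on the negative axis, only \<open>s\<close> in [0,t] contributes.\<close>

definition conv :: "(real \<Rightarrow> real) \<Rightarrow> (real \<Rightarrow> 'b::{banach,second_countable_topology}) \<Rightarrow> real \<Rightarrow> 'b" where
  "conv k g t = (\<integral>s. k (t - s) *\<^sub>R g s \<partial>lborel)"

lemma rl_kernel_measurable[measurable]: "rl_kernel b \<in> borel_measurable borel"
  unfolding rl_kernel_def by measurable

lemma rl_kernel_nonneg: "b > 0 \<Longrightarrow> 0 \<le> rl_kernel b x"
  by (auto simp: rl_kernel_def intro!: divide_nonneg_pos Gamma_real_pos)

lemma rl_kernel_nonpos_arg: "x \<le> 0 \<Longrightarrow> rl_kernel b x = 0"
  by (simp add: rl_kernel_def)

lemma rl_kernel_one: "rl_kernel 1 x = (if x > 0 then 1 else 0)"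
  by (simp add: rl_kernel_def)

text \<open>The substitution s = x r reduces this to the Beta integral; it is the semigroup law I^a
  I^b = I^(a+b) for the kernels. Integrability is part of the statement because, with b = 1, this
  integrand serves later as majorant for bounded functions against the singular kernel.\<close>

lemma has_bochner_integral_rl_kernel:
  assumes a: "a > 0" and b: "b > 0"
  shows "has_bochner_integral lborel (\<lambda>s. rl_kernel a (x - s) * rl_kernel b s) (rl_kernel (a + b) x)"
proof (cases "x > 0")
  case False
  then have *: "rl_kernel a (x - s) * rl_kernel b s = 0" for s
    by (auto simp: rl_kernel_def)
  show ?thesis
    using False by (simp add: * rl_kernel_nonpos_arg has_bochner_integral_zero)
next
  case x: True
  let ?B = "\<lambda>t. indicator {0..1} t *\<^sub>R (t powr (b - 1) * (1 - t) powr (a - 1)) :: real"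
  have "has_bochner_integral lborel ?B (Beta b a)"
    unfolding has_bochner_integral_iff
  proof
    show "integrable lborel ?B"
      using integrable_Beta[OF b a] by (simp add: set_integrable_def)
    show "integral\<^sup>L lborel ?B = Beta b a"
      using set_borel_integral_eq_integral(2)[OF integrable_Beta[OF b a]]
        has_integral_Beta_real[OF b a]
      by (simp add: set_lebesgue_integral_def integral_unique)
  qed
  then have "has_bochner_integral lborel (\<lambda>s. ?B (0 + (1/x) * s)) (Beta b a /\<^sub>R \<bar>1/x\<bar>)"
    by (subst (asm) lborel_has_bochner_integral_real_affine_iff[where c="1/x" and t=0])
      (use x in auto)
  \<comment> \<open>The exponent a + b - 2 collects (a - 1) + (b - 1); the missing power of x is the
    factor produced by the substitution.\<close>
  then have "has_bochner_integral lborel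
      (\<lambda>s. (x powr (a + b - 2) / (Gamma a * Gamma b)) * ?B (0 + (1/x) * s))
      ((x powr (a + b - 2) / (Gamma a * Gamma b)) * (Beta b a /\<^sub>R \<bar>1/x\<bar>))"
    by (rule has_bochner_integral_mult_right)
  moreover have "(x powr (a + b - 2) / (Gamma a * Gamma b)) * (Beta b a /\<^sub>R \<bar>1/x\<bar>) = rl_kernel (a + b) x"
  proof -
    have "x powr (a + b - 2) * x = x powr (a + b - 2) * x powr 1"
      using x by simp
    also have "\<dots> = x powr (a + b - 1)"
      by (subst powr_add[symmetric]) (simp add: algebra_simps)
    finally have e: "x powr (a + b - 2) * x = x powr (a + b - 1)" .
    have "Gamma a > 0" "Gamma b > 0" "Gamma (a + b) > 0"
      using a b by (auto intro: Gamma_real_pos)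
    then show ?thesis
      using x by (simp add: rl_kernel_def Beta_def field_simps flip: e)
  qed
  moreover have "AE s in lborel. (x powr (a + b - 2) / (Gamma a * Gamma b)) * ?B (0 + (1/x) * s)
      = rl_kernel a (x - s) * rl_kernel b s"
  proof -
    have "AE s in lborel. s \<noteq> 0 \<and> s \<noteq> x"
      using AE_lborel_singleton[of 0] AE_lborel_singleton[of x] by auto
    then show ?thesis
    proof (rule AE_mp, intro AE_I2 impI)
      fix s :: real assume s: "s \<noteq> 0 \<and> s \<noteq> x"
      show "(x powr (a + b - 2) / (Gamma a * Gamma b)) * ?B (0 + (1/x) * s)
          = rl_kernel a (x - s) * rl_kernel b s"
      proof (cases "0 < s \<and> s < x")
        case True
        have 1: "(s/x) powr (b - 1) = s powr (b - 1) / x powr (b - 1)"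
          using True x by (simp add: powr_divide)
        have "1 - s/x = (x - s)/x" using x by (simp add: field_simps)
        then have 2: "(1 - s/x) powr (a - 1) = (x - s) powr (a - 1) / x powr (a - 1)"
          using True x by (simp add: powr_divide)
        have 3: "x powr (a + b - 2) = x powr (a - 1) * x powr (b - 1)"
          by (simp flip: powr_add)
        have "s / x \<in> {0..1}" using True x by (auto simp: field_simps)
        then show ?thesis using True x
          by (simp add: rl_kernel_def 1 2 3)
      next
        case False
        then have "s / x \<notin> {0..1}" using s x by (auto simp: field_simps)
        then show ?thesis using False s by (auto simp: rl_kernel_def)
      qed
    qed
  qed
  ultimately show ?thesis
    by (subst has_bochner_integral_cong_AE[symmetric])
      (auto simp: has_bochner_integral_iff)
qed

lemma conv_rl_kernel:
  assumes "a > 0" "b > 0"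
  shows "conv (rl_kernel a) (rl_kernel b) = rl_kernel (a + b)"
  using has_bochner_integral_rl_kernel[OF assms]
  by (auto simp: conv_def has_bochner_integral_iff fun_eq_iff)

lemma integrable_rl_kernel_conv:
  assumes "a > 0" "b > 0"
  shows "integrable lborel (\<lambda>s. rl_kernel a (x - s) * rl_kernel b s)"
  using has_bochner_integral_rl_kernel[OF assms] by (auto simp: has_bochner_integral_iff)

lemma conv_measurable[measurable]:
  assumes [measurable]: "k \<in> borel_measurable borel" "g \<in> borel_measurable borel"
  shows "conv k g \<in> borel_measurable borel"
proof -
  have "(\<lambda>t. \<integral>s. (\<lambda>(t, s). k (t - s) *\<^sub>R g s) (t, s) \<partial>lborel) \<in> borel_measurable borel"
    by (rule lborel.borel_measurable_lebesgue_integral) measurable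
  then show ?thesis by (simp add: conv_def[abs_def])
qed

text \<open>Only the values of \<open>g\<close> on \<open>{0..t}\<close> matter, so only local integrability is required of it.\<close>
lemma conv_assoc:
  fixes g :: "real \<Rightarrow> 'b::{banach,second_countable_topology}"
  assumes [measurable]: "a \<in> borel_measurable borel" "b \<in> borel_measurable borel"
      "g \<in> borel_measurable borel"
    and a0: "\<And>x. x < 0 \<Longrightarrow> a x = 0" and b0: "\<And>x. x < 0 \<Longrightarrow> b x = 0"
    and g0: "\<And>x. x < 0 \<Longrightarrow> g x = 0"
    and g_int: "integrable lborel (\<lambda>s. indicator {0..t} s *\<^sub>R g s)"
    and ab_int: "\<And>x. x \<le> t \<Longrightarrow> integrable lborel (\<lambda>s. a (x - s) * b s)"
    and ab_bound: "\<And>x. x \<le> t \<Longrightarrow> (\<integral>s. \<bar>a (x - s) * b s\<bar> \<partial>lborel) \<le> K"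
  shows "conv a (conv b g) t = conv (conv a b) g t"
proof -
  define F where "F = (\<lambda>r s. (a (t - s) * b (s - r)) *\<^sub>R g r)"
  have [measurable]: "case_prod F \<in> borel_measurable (lborel \<Otimes>\<^sub>M lborel)"
    unfolding F_def by measurable
  have shift: "(\<integral>s. h (a (t - s) * b (s - r)) \<partial>lborel) = (\<integral>s. h (a (t - r - s) * b s) \<partial>lborel)"
    for h :: "real \<Rightarrow> real" and r
    by (subst lborel_integral_real_affine[where c=1 and t=r]) (auto simp: algebra_simps)
  have shift_int: "integrable lborel (\<lambda>s. a (t - s) * b (s - r))" if "0 \<le> r" for r
    by (subst lborel_integrable_real_affine_iff[where c=1 and t=r, symmetric])
      (use ab_int[of "t - r"] that in \<open>auto simp: algebra_simps\<close>)
  \<comment> \<open>For r > t either s > t, where the first kernel vanishes, or s < r, where the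
    second does; for r < 0 it is \<open>g\<close> that vanishes.\<close>
  have F0: "F r s = 0" if "r \<notin> {0..t}" for r s
    using that a0[of "t - s"] b0[of "s - r"] g0[of r] by (cases "s > t"; cases "s < r") (auto simp: F_def)
  have slice: "integrable lborel (F r)" for r
  proof (cases "r \<in> {0..t}")
    case True
    then show ?thesis unfolding F_def by (intro integrable_scaleR_left shift_int) auto
  next
    case False
    then have "F r = (\<lambda>_. 0)" by (auto simp: F0)
    then show ?thesis by simp
  qed
  \<comment> \<open>The bound \<open>K\<close> on the convolution of |a| and |b| up to time t
    dominates the inner integrals by |g| on [0,t], which is what Tonelli's criterion asks
    for.\<close>
  have K: "(\<integral>s. norm (F r s) \<partial>lborel) \<le> K * norm (indicator {0..t} r *\<^sub>R g r)" for r
  proof (cases "r \<in> {0..t}")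
    case True
    have "(\<integral>s. norm (F r s) \<partial>lborel) = (\<integral>s. \<bar>a (t - s) * b (s - r)\<bar> \<partial>lborel) * norm (g r)"
      by (simp add: F_def)
    also have "\<dots> = (\<integral>s. \<bar>a (t - r - s) * b s\<bar> \<partial>lborel) * norm (g r)"
      by (subst shift[of abs]) simp
    also have "\<dots> \<le> K * norm (g r)"
      using True by (intro mult_right_mono ab_bound) auto
    finally show ?thesis using True by simp
  next
    case False
    then show ?thesis by (simp add: F0)
  qed
  have int: "integrable (lborel \<Otimes>\<^sub>M lborel) (case_prod F)"
  proof (rule lborel_pair.Fubini_integrable)
    have "integrable lborel (\<lambda>r. \<integral>s. norm (F r s) \<partial>lborel)"
    proof (rule Bochner_Integration.integrable_bound)
      show "integrable lborel (\<lambda>r. K * norm (indicator {0..t} r *\<^sub>R g r))"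
        using g_int by (intro integrable_mult_right integrable_norm)
      show "AE r in lborel. norm (\<integral>s. norm (F r s) \<partial>lborel)
          \<le> norm (K * norm (indicator {0..t} r *\<^sub>R g r))"
      proof (rule AE_I2)
        fix r
        have "0 \<le> (\<integral>s. norm (F r s) \<partial>lborel)" by simp
        then show "norm (\<integral>s. norm (F r s) \<partial>lborel) \<le> norm (K * norm (indicator {0..t} r *\<^sub>R g r))"
          using K[of r] by simp
      qed
    qed measurable
    then show "integrable lborel (\<lambda>r. \<integral>s. norm (case_prod F (r, s)) \<partial>lborel)" by simp
  qed (use slice in auto)
  have "conv a (conv b g) t = (\<integral>s. \<integral>r. F r s \<partial>lborel \<partial>lborel)"
    unfolding conv_def F_def
    by (simp flip: integral_scaleR_right add: scaleR_scaleR[symmetric] del: scaleR_scaleR)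
  also have "\<dots> = (\<integral>r. \<integral>s. F r s \<partial>lborel \<partial>lborel)"
    using int by (rule lborel_pair.Fubini_integral)
  also have "\<dots> = (\<integral>r. (\<integral>s. a (t - s) * b (s - r) \<partial>lborel) *\<^sub>R g r \<partial>lborel)"
  proof (rule Bochner_Integration.integral_cong[OF refl])
    fix r
    show "(\<integral>s. F r s \<partial>lborel) = (\<integral>s. a (t - s) * b (s - r) \<partial>lborel) *\<^sub>R g r"
    proof (cases "0 \<le> r")
      case True
      then show ?thesis unfolding F_def by (intro integral_scaleR_left shift_int)
    next
      case False
      then show ?thesis by (simp add: F_def g0)
    qed
  qed
  also have "\<dots> = conv (conv a b) g t"
    unfolding conv_def using shift[of id] by simp
  finally show ?thesis .
qed

lemma conv_cong:
  assumes "\<And>x. x < 0 \<Longrightarrow> k x = 0" "\<And>x. x < 0 \<Longrightarrow> g x = 0" "\<And>x. x < 0 \<Longrightarrow> h x = 0"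
    and "\<And>s. 0 \<le> s \<Longrightarrow> s \<le> t \<Longrightarrow> g s = h s"
  shows "conv k g t = conv k h t"
  unfolding conv_def
proof (rule Bochner_Integration.integral_cong[OF refl])
  fix s
  show "k (t - s) *\<^sub>R g s = k (t - s) *\<^sub>R h s"
    using assms(1)[of "t - s"] assms(2-4)[of s] by (cases "s < 0"; cases "s > t") auto
qed

section \<open>The Mittag-Leffler relaxation function\<close>

text \<open>Log-convexity of Gamma at x + 1 = (1 - a) (x + a + 1) + a (x + a), combined with the
  functional equation. The bound grows like x^a, so quotients of consecutive Mittag-Leffler
  coefficients tend to 0.\<close>

lemma Gamma_ratio_ge:
  assumes x: "x > 0" and a: "0 < a" "a < (1::real)"
  shows "x * (x + a) powr (a - 1) \<le> Gamma (x + a) / Gamma x"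
proof -
  have pos: "Gamma x > 0" "Gamma (x + a) > 0" "Gamma (x + a + 1) > 0" "Gamma (x + 1) > 0"
    using x a by (auto intro: Gamma_real_pos)
  have "ln (Gamma ((1 - a) *\<^sub>R (x + a + 1) + a *\<^sub>R (x + a)))
      \<le> (1 - a) * ln (Gamma (x + a + 1)) + a * ln (Gamma (x + a))"
    using convex_onD[OF log_convex_Gamma_real, of a "x + a + 1" "x + a"] x a by simp
  moreover have "(1 - a) *\<^sub>R (x + a + 1) + a *\<^sub>R (x + a) = x + 1"
    by (simp add: algebra_simps)
  moreover have "Gamma (x + a + 1) = (x + a) * Gamma (x + a)"
    using Gamma_plus1[of "x + a"] x a nonpos_Ints_nonpos[of "x + a"] by fastforce
  moreover have "ln ((x + a) * Gamma (x + a)) = ln (x + a) + ln (Gamma (x + a))"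
    using x a pos by (intro ln_mult_pos) auto
  ultimately have "ln (Gamma (x + 1)) \<le> (1 - a) * ln (x + a) + ln (Gamma (x + a))"
    by (simp add: algebra_simps)
  then have "Gamma (x + 1) \<le> exp ((1 - a) * ln (x + a) + ln (Gamma (x + a)))"
    using pos by (metis exp_le_cancel_iff exp_ln)
  also have "\<dots> = (x + a) powr (1 - a) * Gamma (x + a)"
    using x a pos by (simp add: exp_add powr_def)
  also have "Gamma (x + 1) = x * Gamma x"
    using Gamma_plus1[of x] x nonpos_Ints_nonpos[of x] by fastforce
  finally have "x * Gamma x \<le> (x + a) powr (1 - a) * Gamma (x + a)" .
  from mult_right_mono[OF this, of "(x + a) powr (a - 1)"]
  have "x * Gamma x * (x + a) powr (a - 1) \<le> Gamma (x + a) * ((x + a) powr (1 - a) * (x + a) powr (a - 1))"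
    by (simp add: mult_ac)
  also have "(x + a) powr (1 - a) * (x + a) powr (a - 1) = 1"
    using x a by (simp flip: powr_add)
  finally show ?thesis using pos by (simp add: pos_le_divide_eq mult_ac)
qed

text \<open>Ratio test with factor 1/2, since the Gamma quotients eventually exceed
  \<open>2 * norm z\<close>. The type is generic because the real series is integrated termwise
  while the complex one is needed for the isolation of zeros.\<close>

lemma summable_mittag_leffler:
  fixes z :: "'a::{real_normed_field,banach}"
  assumes a: "0 < a" "a < (1::real)"
  shows "summable (\<lambda>m. norm (z ^ m / of_real (Gamma (a * real m + 1))))"
proof -
  have g: "Gamma (a * real m + 1) > 0" for m
    using a by (intro Gamma_real_pos) (simp add: add_nonneg_pos)
  have "filterlim (\<lambda>m::nat. (a * real m + 1) * (a * real m + 1 + a) powr (a - 1)) at_top at_top"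
    using a by real_asymp
  then have "eventually (\<lambda>m. 2 * norm z \<le> (a * real m + 1) * (a * real m + 1 + a) powr (a - 1)) sequentially"
    by (simp add: filterlim_at_top)
  then obtain N where N: "\<And>m. m \<ge> N \<Longrightarrow> 2 * norm z \<le> (a * real m + 1) * (a * real m + 1 + a) powr (a - 1)"
    by (auto simp: eventually_sequentially)
  show ?thesis
  proof (rule summable_ratio_test[where c="1/2" and N=N])
    fix m assume "N \<le> m"
    then have "2 * norm z \<le> Gamma (a * real m + 1 + a) / Gamma (a * real m + 1)"
      using N[of m] Gamma_ratio_ge[of "a * real m + 1" a] a by (auto simp: add_nonneg_pos)
    moreover have "a * real m + 1 + a = a * real (Suc m) + 1" by (simp add: algebra_simps)
    ultimately have *: "2 * norm z * Gamma (a * real m + 1) \<le> Gamma (a * real (Suc m) + 1)"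
      using g[of m] by (simp add: field_simps)
    have "norm z * norm z ^ m / Gamma (a * real (Suc m) + 1)
        \<le> norm z ^ m / Gamma (a * real m + 1) / 2"
      using mult_left_mono[OF *, of "norm z ^ m"] g[of m] g[of "Suc m"]
      by (simp add: field_simps del: of_nat_Suc)
    then show "norm (norm (z ^ Suc m / of_real (Gamma (a * real (Suc m) + 1))))
        \<le> 1/2 * norm (norm (z ^ m / of_real (Gamma (a * real m + 1))))"
      using g[of m] g[of "Suc m"]
      by (simp add: norm_divide norm_mult norm_power del: of_nat_Suc)
  qed simp
qed

lemma mittag_leffler_sums:
  assumes "0 < a" "a < (1::real)"
  shows "(\<lambda>m. z ^ m / Gamma (a * real m + 1)) sums mittag_leffler a 1 z"
  unfolding mittag_leffler_def
  using summable_norm_cancel[OF summable_mittag_leffler[OF assms, of z]]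
  by (simp add: summable_sums)

text \<open>\<open>relaxation a c\<close> solves the scalar problem \<open>D\<^sup>a y = - c y\<close>, \<open>y 0 = 1\<close>.\<close>
definition relaxation :: "real \<Rightarrow> real \<Rightarrow> real \<Rightarrow> real" where
  "relaxation a c x = (if x < 0 then 0 else mittag_leffler a 1 (- c * x powr a))"

lemma relaxation_neg: "x < 0 \<Longrightarrow> relaxation a c x = 0"
  by (simp add: relaxation_def)

section \<open>Continuity of the relaxation function and its Volterra equation\<close>

lemma relaxation_0: "0 < a \<Longrightarrow> a < 1 \<Longrightarrow> relaxation a c 0 = 1"
  using mittag_leffler_sums[of a 0] powser_sums_zero[of "\<lambda>m. 1 / Gamma (a * real m + 1)"]
  by (auto simp: relaxation_def dest: sums_unique2)

lemma continuous_mittag_leffler: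
  assumes "0 < a" "a < 1"
  shows "continuous_on UNIV (mittag_leffler a 1)"
proof -
  have "summable (\<lambda>m. (1 / Gamma (a * real m + 1)) * z ^ m)" for z :: real
    using summable_norm_cancel[OF summable_mittag_leffler[OF assms, of z]] by simp
  then have "isCont (\<lambda>x. \<Sum>m. (1 / Gamma (a * real m + 1)) * x ^ m) z" for z :: real
    by (rule isCont_powser_converges_everywhere)
  then show ?thesis
    by (simp add: continuous_on_eq_continuous_at mittag_leffler_def[abs_def])
qed

text \<open>Restricted to the half-line because the extension by zero jumps from 0 to 1 at the
  origin.\<close>

lemma continuous_on_relaxation:
  assumes "0 < a" "a < 1"
  shows "continuous_on {0..} (relaxation a c)"
proof -
  have "continuous_on {0..} (\<lambda>x. mittag_leffler a 1 (- c * x powr a))"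
    using assms by (intro continuous_on_compose2[OF continuous_mittag_leffler] continuous_on_mult continuous_on_const
        continuous_on_powr' continuous_on_id) auto
  then show ?thesis
    by (rule continuous_on_eq) (auto simp: relaxation_def)
qed

lemma relaxation_measurable[measurable]:
  assumes "0 < a" "a < 1"
  shows "relaxation a c \<in> borel_measurable borel"
proof -
  have [measurable]: "mittag_leffler a 1 \<in> borel_measurable borel"
    using continuous_mittag_leffler[OF assms] by (rule borel_measurable_continuous_onI)
  show ?thesis unfolding relaxation_def[abs_def] by measurable
qed

lemma power_powr_eq: "x > 0 \<Longrightarrow> (x powr a) ^ m = x powr (a * real m)"
  by (metis powr_powr powr_realpow powr_gt_zero)

text \<open>The right-hand side is (- c I^a)^m applied to the constant 1: the Mittag-Leffler series
  is the Neumann series of the Volterra equation y = 1 - c I^a y.\<close>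

lemma relaxation_series_term:
  assumes "0 < a" "x > 0"
  shows "(- c * x powr a) ^ m / Gamma (a * real m + 1) = (- c) ^ m * rl_kernel (a * real m + 1) x"
  using assms by (simp only: power_mult_distrib power_powr_eq) (simp add: rl_kernel_def)

lemma relaxation_sums:
  assumes "0 < a" "a < 1" "x > 0"
  shows "(\<lambda>m. (- c) ^ m * rl_kernel (a * real m + 1) x) sums relaxation a c x"
  using mittag_leffler_sums[OF assms(1,2), of "- c * x powr a"] assms
  by (simp only: relaxation_series_term) (simp add: relaxation_def)

lemma summable_rl_kernel:
  assumes "0 < a" "a < 1" "x > 0"
  shows "summable (\<lambda>m. \<bar>c ^ m * rl_kernel (a * real m + 1) x\<bar>)"
proof -
  have "(\<lambda>m. \<bar>c ^ m * rl_kernel (a * real m + 1) x\<bar>)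
      = (\<lambda>m. norm ((c * x powr a) ^ m / of_real (Gamma (a * real m + 1))))"
    using relaxation_series_term[OF assms(1,3), of "- c"] by (auto simp: fun_eq_iff)
  then show ?thesis
    using summable_mittag_leffler[OF assms(1,2), of "c * x powr a"] by simp
qed

text \<open>Convolution with \<open>rl_kernel a\<close> raises the index of each term of the series
  by one, by the semigroup law. Hence - c I^a y is the series of y without its first term; absolute
  summability of the integrals permits the exchange.\<close>

lemma relaxation_conv:
  assumes a: "0 < a" "a < 1" and x: "x > 0"
  shows "integrable lborel (\<lambda>s. rl_kernel a (x - s) * relaxation a c s)"
    and "relaxation a c x = 1 - c * conv (rl_kernel a) (relaxation a c) x"
proof -
  let ?f = "\<lambda>m s. rl_kernel a (x - s) * ((- c) ^ m * rl_kernel (a * real m + 1) s)"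
  let ?g = "\<lambda>m. rl_kernel (a * real (Suc m) + 1) x"
  have hb: "has_bochner_integral lborel (\<lambda>s. rl_kernel a (x - s) * rl_kernel (a * real m + 1) s) (?g m)" for m
    using has_bochner_integral_rl_kernel[of a "a * real m + 1" x] a
    by (simp add: algebra_simps add_pos_nonneg)
  have hb1: "has_bochner_integral lborel (?f m) ((- c) ^ m * ?g m)" for m
    using has_bochner_integral_mult_right[OF hb, of "(-c)^m" m] by (simp add: algebra_simps)
  have nn: "0 \<le> rl_kernel (a * real m + 1) s" "0 \<le> rl_kernel a s" for m s
    using a by (auto intro!: rl_kernel_nonneg add_nonneg_pos)
  have hb2: "has_bochner_integral lborel (\<lambda>s. norm (?f m s)) (\<bar>c\<bar> ^ m * ?g m)" for m
    using has_bochner_integral_mult_right[OF hb, of "\<bar>c\<bar>^m" m] nn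
    by (simp add: algebra_simps abs_mult power_abs)
  \<comment> \<open>The known series is the one shifted by an index, that is |c| times this one, so
    c = 0 needs an argument of its own.\<close>
  have sm: "summable (\<lambda>m. \<bar>c\<bar> ^ m * ?g m)"
  proof (cases "c = 0")
    case True
    then have "(\<lambda>m. \<bar>c\<bar> ^ m * ?g m) = (\<lambda>m. if m = 0 then ?g 0 else 0)"
      by (auto simp: fun_eq_iff power_0_left)
    then show ?thesis
      by (simp only:) (rule summable_If_finite, simp)
  next
    case False
    have "(\<lambda>m. \<bar>\<bar>c\<bar> ^ Suc m * ?g m\<bar>) = (\<lambda>m. \<bar>c\<bar> * (\<bar>c\<bar> ^ m * ?g m))"
      using nn(1)[of "Suc _"] by (simp add: abs_mult mult_ac del: of_nat_Suc)
    moreover have "summable (\<lambda>m. \<bar>\<bar>c\<bar> ^ Suc m * ?g m\<bar>)"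
      using summable_rl_kernel[OF a x, of "\<bar>c\<bar>"]
      by (subst summable_Suc_iff)
    ultimately have "summable (\<lambda>m. \<bar>c\<bar> * (\<bar>c\<bar> ^ m * ?g m))"
      by simp
    then show ?thesis using False by (simp add: summable_cmult_iff del: of_nat_Suc)
  qed
  have ae: "AE s in lborel. summable (\<lambda>m. norm (?f m s))"
  proof (rule AE_I2)
    fix s
    show "summable (\<lambda>m. norm (?f m s))"
    proof (cases "s > 0")
      case True
      then show ?thesis
        using summable_mult[OF summable_rl_kernel[OF a True, of "\<bar>c\<bar>"], of "\<bar>rl_kernel a (x - s)\<bar>"]
        by (simp add: abs_mult power_abs)
    next
      case False
      then show ?thesis by (simp add: rl_kernel_nonpos_arg)
    qed
  qed
  \<comment> \<open>At s = 0 all kernels vanish while y is 1, so the equality holds only off this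
    null set.\<close>
  have sums: "(\<Sum>m. ?f m s) = rl_kernel a (x - s) * relaxation a c s" if "s \<noteq> 0" for s
  proof (cases "s > 0")
    case True
    then show ?thesis
      using sums_mult[OF relaxation_sums[OF a True, of c], of "rl_kernel a (x - s)"] by (simp add: sums_iff)
  next
    case False
    with that show ?thesis by (simp add: rl_kernel_nonpos_arg relaxation_neg)
  qed
  have ae_eq: "AE s in lborel. (\<Sum>m. ?f m s) = rl_kernel a (x - s) * relaxation a c s"
    using AE_lborel_singleton[of 0] by (rule AE_mp) (simp add: sums)
  note S = hb1[unfolded has_bochner_integral_iff] hb2[unfolded has_bochner_integral_iff]
  have int: "integrable lborel (\<lambda>s. \<Sum>m. ?f m s)"
    by (rule integrable_suminf) (use S ae sm in auto)
  note [measurable] = relaxation_measurable[OF a]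
  show "integrable lborel (\<lambda>s. rl_kernel a (x - s) * relaxation a c s)"
    by (subst integrable_cong_AE[OF _ _ ae_eq, symmetric]) (use int in auto)
  have "(\<lambda>m. (- c) ^ m * ?g m) sums (\<integral>s. (\<Sum>m. ?f m s) \<partial>lborel)"
    using sums_integral[of lborel ?f] S ae sm by simp
  also have "(\<integral>s. (\<Sum>m. ?f m s) \<partial>lborel) = conv (rl_kernel a) (relaxation a c) x"
    unfolding conv_def real_scaleR_def
    by (rule integral_cong_AE[OF _ _ ae_eq]) (use int in auto)
  finally have "(\<lambda>m. - c * ((- c) ^ m * ?g m)) sums (- c * conv (rl_kernel a) (relaxation a c) x)"
    by (rule sums_mult)
  then have "(\<lambda>m. (- c) ^ Suc m * rl_kernel (a * real (Suc m) + 1) x)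
      sums (- c * conv (rl_kernel a) (relaxation a c) x)"
    by (simp add: mult_ac del: of_nat_Suc)
  \<comment> \<open>The term of index 0 is \<open>rl_kernel 1 x\<close>, which is 1 as x > 0; it is
    the constant of the Volterra equation.\<close>
  then have "(\<lambda>m. (- c) ^ m * rl_kernel (a * real m + 1) x)
      sums (- c * conv (rl_kernel a) (relaxation a c) x + 1)"
    using x by (subst (asm) sums_Suc_iff) (simp add: rl_kernel_one)
  with relaxation_sums[OF a x, of c]
  show "relaxation a c x = 1 - c * conv (rl_kernel a) (relaxation a c) x"
    by (auto dest: sums_unique2)
qed

text \<open>The zeros are isolated because the Mittag-Leffler function is entire.\<close>
lemma relaxation_isolated_zero:
  assumes a: "0 < a" "a < 1" and c: "c > 0" and t: "t > 0" and z: "relaxation a c t = 0"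
  obtains r where "r > 0" "\<And>s. t < s \<Longrightarrow> s < t + r \<Longrightarrow> relaxation a c s \<noteq> 0"
proof -
  \<comment> \<open>The entire extension of the Mittag-Leffler function, to which the theorem on
    isolated zeros applies.\<close>
  define F :: "complex \<Rightarrow> complex" where "F = (\<lambda>z. \<Sum>m. (1 / of_real (Gamma (a * real m + 1))) * z ^ m)"
  define p where "p = (\<lambda>s. - c * s powr a)"
  have sm: "summable (\<lambda>m. (1 / of_real (Gamma (a * real m + 1))) * z ^ m)" for z :: complex
    using summable_norm_cancel[OF summable_mittag_leffler[OF a, of z]] by simp
  have F_real: "F (of_real x) = of_real (mittag_leffler a 1 x)" for x
  proof -
    have "(\<lambda>m. of_real (x ^ m / Gamma (a * real m + 1)) :: complex) sums of_real (mittag_leffler a 1 x)"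
      using mittag_leffler_sums[OF a] by (rule sums_of_real)
    then show ?thesis by (simp add: F_def sums_iff)
  qed
  have "F holomorphic_on UNIV"
  proof -
    have "\<exists>D. (F has_field_derivative D) (at z)" for z
      unfolding F_def using termdiffs_strong_converges_everywhere[OF sm] by blast
    then show ?thesis
      by (auto simp: holomorphic_on_def field_differentiable_def)
  qed
  moreover have "F (of_real (p t)) = 0"
    using z t by (simp only: F_real) (simp add: relaxation_def p_def)
  \<comment> \<open>The value at 0 is 1, which excludes the zero function.\<close>
  moreover have "F 0 \<noteq> 0"
    using F_real[of 0] relaxation_0[OF a, of 0] by (simp add: relaxation_def)
  ultimately obtain r where r: "r > 0" "\<And>z. z \<in> ball (of_real (p t)) r - {of_real (p t)} \<Longrightarrow> F z \<noteq> 0"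
    using isolated_zeros[of F UNIV "of_real (p t)" 0] by auto
  have "isCont p t"
    unfolding p_def using t by (intro continuous_intros) auto
  then obtain d where d: "d > 0" "\<And>s. \<bar>s - t\<bar> < d \<Longrightarrow> \<bar>p s - p t\<bar> < r"
    unfolding continuous_at_eps_delta using r(1) by (auto simp: dist_real_def)
  show thesis
  proof
    fix s assume s: "t < s" "s < t + d"
    \<comment> \<open>The map s -> - c s^a is continuous and strictly decreasing, so an isolated
      zero of \<open>F\<close> is pulled back to an isolated zero of y.\<close>
    have "t powr a < s powr a" using s t a by (intro powr_less_mono2) auto
    then have "p s \<noteq> p t" using c by (simp add: p_def)
    moreover have "dist (of_real (p t) :: complex) (of_real (p s)) < r"
      using d(2)[of s] s by (simp add: dist_of_real dist_real_def abs_minus_commute)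
    ultimately have "F (of_real (p s)) \<noteq> 0" by (intro r) auto
    then show "relaxation a c s \<noteq> 0"
      using s t by (simp only: F_real) (simp add: relaxation_def p_def)
  qed (rule d)
qed

lemma rl_kernel_antimono:
  assumes "0 < a" "a < 1" "0 < x" "x \<le> y"
  shows "rl_kernel a y \<le> rl_kernel a x"
  using assms Gamma_real_pos[of a] by (auto simp: rl_kernel_def intro!: divide_right_mono powr_mono2')

text \<open>Just after its first sign change the solution would be negative; but it exceeds its value \<open>0\<close>
  there, since the kernel decreases and the solution was nonnegative before.\<close>
lemma relaxation_nonneg:
  assumes a: "0 < a" "a < 1" and c: "c > 0"
  shows "0 \<le> relaxation a c t"
proof (rule ccontr)
  let ?y = "relaxation a c"
  define S where "S = {t. ?y t < 0}"
  define t0 where "t0 = Inf S"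
  have cont: "continuous_on {0..} ?y" by (rule continuous_on_relaxation[OF a])
  assume "\<not> 0 \<le> ?y t"
  then have S: "S \<noteq> {}" by (auto simp: S_def not_le)
  have Spos: "s > 0" if "s \<in> S" for s
    using that relaxation_neg[of s a c] relaxation_0[OF a, of c]
    by (cases "s = 0"; cases "s < 0") (auto simp: S_def)
  have bdd: "bdd_below S" using Spos by (auto intro!: bdd_belowI[of _ 0] less_imp_le)
  have t0: "0 \<le> t0" unfolding t0_def using S Spos by (intro cInf_greatest) (auto intro: less_imp_le)
  have before: "0 \<le> ?y s" if "s < t0" for s
    using that cInf_lower[OF _ bdd, of s] by (force simp: S_def t0_def)
  \<comment> \<open>Positivity at \<open>t0\<close> would persist nearby by continuity,
    contradicting the choice of \<open>t0\<close> as the infimum of the times with y < 0.\<close>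
  have "\<not> 0 < ?y t0"
  proof
    assume "0 < ?y t0"
    then obtain d where d: "d > 0" "\<And>s. s \<ge> 0 \<Longrightarrow> dist s t0 < d \<Longrightarrow> dist (?y s) (?y t0) < ?y t0"
      using cont t0 unfolding continuous_on_iff by (metis atLeast_iff)
    have "Inf S < t0 + d" using d by (simp add: t0_def)
    then obtain s where s: "s \<in> S" "s < t0 + d" using cInf_less_iff[OF S bdd] by auto
    have "t0 \<le> s" unfolding t0_def by (rule cInf_lower[OF s(1) bdd])
    then have "dist (?y s) (?y t0) < ?y t0" using s Spos[OF s(1)] by (intro d) (auto simp: dist_real_def)
    then show False using s(1) by (auto simp: S_def dist_real_def)
  qed
  then have "t0 \<noteq> 0" using relaxation_0[OF a, of c] by auto
  with t0 have t0: "t0 > 0" by simp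
  have "0 \<le> ?y t0"
  proof (rule tendsto_lowerbound)
    have "isCont ?y t0"
      using cont t0 by (intro continuous_on_interior[OF cont]) auto
    then show "(?y \<longlongrightarrow> ?y t0) (at_left t0)"
      by (auto simp: isCont_def intro: tendsto_mono[OF at_le])
    show "\<forall>\<^sub>F s in at_left t0. 0 \<le> ?y s"
      using before by (auto simp: eventually_at_filter)
  qed auto
  with \<open>\<not> 0 < ?y t0\<close> have y0: "?y t0 = 0" by simp
  obtain r where r: "r > 0" "\<And>s. t0 < s \<Longrightarrow> s < t0 + r \<Longrightarrow> ?y s \<noteq> 0"
    using relaxation_isolated_zero[OF a c t0 y0] by metis
  have "Inf S < t0 + r" using r by (simp add: t0_def)
  then obtain t1 where t1: "t1 \<in> S" "t1 < t0 + r" using cInf_less_iff[OF S bdd] by auto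
  have "t0 \<le> t1" unfolding t0_def by (rule cInf_lower[OF t1(1) bdd])
  with t1(1) y0 have "t0 < t1" by (cases "t0 = t1") (auto simp: S_def)
  \<comment> \<open>There is no zero on (t0, t0 + r), so by the intermediate value theorem y keeps
    there the sign that it has at \<open>t1\<close>.\<close>
  have after: "?y s \<le> 0" if "t0 < s" "s \<le> t1" for s
  proof (rule ccontr)
    assume "\<not> ?y s \<le> 0"
    then have "\<exists>z. s \<le> z \<and> z \<le> t1 \<and> ?y z = 0"
      using t1(1) that t0 by (intro IVT2' continuous_on_subset[OF cont]) (auto simp: S_def)
    then show False using r(2) that t1(2) by (metis le_less_trans less_le_trans)
  qed
  let ?k = "\<lambda>t s. rl_kernel a (t - s) * ?y s"
  have int: "integrable lborel (?k t0)" "integrable lborel (?k t1)"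
    using relaxation_conv(1)[OF a] t0 \<open>t0 < t1\<close> by auto
  \<comment> \<open>For s < t0 the kernel at \<open>t1\<close> is the smaller one and y >= 0; for t0
    < s < t1 only the kernel at \<open>t1\<close> is left and y <= 0. So I^a y does not grow from
    \<open>t0\<close> to \<open>t1\<close>, and y = 1 - c I^a y does not decrease.\<close>
  have "0 \<le> (\<integral>s. ?k t0 s - ?k t1 s \<partial>lborel)"
  proof (rule integral_nonneg_AE)
    show "AE s in lborel. 0 \<le> ?k t0 s - ?k t1 s"
      using AE_lborel_singleton[of t0]
    proof (rule AE_mp, intro AE_I2 impI)
      fix s assume "s \<noteq> t0"
      consider "s < 0" | "0 \<le> s" "s < t0" | "t0 < s" "s < t1" | "t1 \<le> s" using \<open>s \<noteq> t0\<close> by linarith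
      then show "0 \<le> ?k t0 s - ?k t1 s"
      proof cases
        case 1 then show ?thesis by (simp add: relaxation_neg)
      next
        case 2
        then show ?thesis using \<open>t0 < t1\<close> before[of s]
          by (auto intro!: mult_right_mono rl_kernel_antimono[OF a])
      next
        case 3
        then show ?thesis using after[of s] rl_kernel_nonneg[OF a(1), of "t1 - s"]
          by (simp add: rl_kernel_nonpos_arg mult_nonneg_nonpos)
      next
        case 4 then show ?thesis using \<open>t0 < t1\<close> by (simp add: rl_kernel_nonpos_arg)
      qed
    qed
  qed
  also have "\<dots> = conv (rl_kernel a) ?y t0 - conv (rl_kernel a) ?y t1"
    unfolding conv_def real_scaleR_def using int by simp
  finally have "0 \<le> c * (conv (rl_kernel a) ?y t0 - conv (rl_kernel a) ?y t1)" using c by simp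
  also have "\<dots> = ?y t1 - ?y t0"
    using relaxation_conv(2)[OF a, of t0 c] relaxation_conv(2)[OF a, of t1 c] t0 \<open>t0 < t1\<close>
    by (simp add: algebra_simps)
  finally show False using y0 t1(1) by (simp add: S_def)
qed

section \<open>Bounds on y and on the defect 1 - y\<close>

lemma conv_nonneg:
  assumes "\<And>x. 0 \<le> k x" "\<And>x. 0 \<le> g x"
  shows "(0::real) \<le> conv k g t"
  unfolding conv_def using assms by (intro integral_nonneg_AE) auto

lemma relaxation_le_1:
  assumes a: "0 < a" "a < 1" and c: "c > 0"
  shows "relaxation a c t \<le> 1"
proof -
  have "0 \<le> conv (rl_kernel a) (relaxation a c) t"
    using relaxation_nonneg[OF a c] rl_kernel_nonneg[OF a(1)] by (intro conv_nonneg) auto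
  then show ?thesis
    using relaxation_conv(2)[OF a, of t c] relaxation_neg[of t a c] relaxation_0[OF a, of c] c
    by (cases "t < 0"; cases "t = 0") (auto simp: mult_nonneg_nonneg)
qed

text \<open>Unlike y itself, 1 - y extended by zero is continuous on the whole line. This makes its
  convolution with an integrable function continuous.\<close>

definition relaxation_defect :: "real \<Rightarrow> real \<Rightarrow> real \<Rightarrow> real" where
  "relaxation_defect a c x = (if x < 0 then 0 else 1 - relaxation a c x)"

context
  fixes a c :: real
  assumes a: "0 < a" "a < 1" and c: "c > 0"
begin

lemma relaxation_defect_measurable: "relaxation_defect a c \<in> borel_measurable borel"
proof -
  note [measurable] = relaxation_measurable[OF a]
  show ?thesis unfolding relaxation_defect_def[abs_def] by measurable
qed

lemma relaxation_defect_nonneg: "0 \<le> relaxation_defect a c x"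
  and relaxation_defect_le_1: "relaxation_defect a c x \<le> 1"
  using relaxation_le_1[OF a c, of x] relaxation_nonneg[OF a c, of x]
  by (auto simp: relaxation_defect_def)

lemma relaxation_defect_nonpos: "x \<le> 0 \<Longrightarrow> relaxation_defect a c x = 0"
  using relaxation_0[OF a] by (cases "x = 0") (auto simp: relaxation_defect_def)

lemma relaxation_defect_eq: "relaxation_defect a c x = c * conv (rl_kernel a) (relaxation a c) x"
proof (cases "x > 0")
  case True
  then show ?thesis using relaxation_conv(2)[OF a, of x c] by (simp add: relaxation_defect_def)
next
  case False
  have *: "rl_kernel a (x - s) * relaxation a c s = 0" for s
    using False by (cases "s < 0") (auto simp: rl_kernel_nonpos_arg relaxation_neg)
  show ?thesis
    using False by (simp add: relaxation_defect_nonpos conv_def *)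
qed

text \<open>Off the origin 0 <= y <= \<open>rl_kernel 1\<close>, so the semigroup law with second
  index 1 supplies both the integrable majorant and the value of the bound.\<close>

lemma integrable_rl_kernel_relaxation: "integrable lborel (\<lambda>s. rl_kernel b (x - s) * relaxation a c s)"
  and conv_rl_kernel_relaxation_le: "conv (rl_kernel b) (relaxation a c) x \<le> rl_kernel (b + 1) x"
  if b: "b > 0"
proof -
  have hb: "has_bochner_integral lborel (\<lambda>s. rl_kernel b (x - s) * rl_kernel 1 s) (rl_kernel (b + 1) x)"
    using has_bochner_integral_rl_kernel[OF b, of 1] by simp
  have ae: "AE s in lborel. 0 \<le> rl_kernel b (x - s) * relaxation a c s \<and>
      rl_kernel b (x - s) * relaxation a c s \<le> rl_kernel b (x - s) * rl_kernel 1 s"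
    using AE_lborel_singleton[of 0]
  proof (rule AE_mp, intro AE_I2 impI)
    fix s :: real assume "s \<noteq> 0"
    have "relaxation a c s \<le> rl_kernel 1 s"
      using relaxation_le_1[OF a c, of s] relaxation_neg[of s a c] \<open>s \<noteq> 0\<close> by (auto simp: rl_kernel_one)
    then show "0 \<le> rl_kernel b (x - s) * relaxation a c s \<and>
      rl_kernel b (x - s) * relaxation a c s \<le> rl_kernel b (x - s) * rl_kernel 1 s"
      using rl_kernel_nonneg[OF b] relaxation_nonneg[OF a c] by (auto intro!: mult_left_mono)
  qed
  note [measurable] = relaxation_measurable[OF a]
  show int: "integrable lborel (\<lambda>s. rl_kernel b (x - s) * relaxation a c s)"
    by (rule Bochner_Integration.integrable_bound[OF hb[unfolded has_bochner_integral_iff, THEN conjunct1]])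
      (use ae in auto)
  have "conv (rl_kernel b) (relaxation a c) x \<le> (\<integral>s. rl_kernel b (x - s) * rl_kernel 1 s \<partial>lborel)"
    unfolding conv_def real_scaleR_def
    by (rule integral_mono_AE[OF int hb[unfolded has_bochner_integral_iff, THEN conjunct1]]) (use ae in auto)
  then show "conv (rl_kernel b) (relaxation a c) x \<le> rl_kernel (b + 1) x"
    using hb by (simp add: has_bochner_integral_iff)
qed

text \<open>Inserts I^a y <= I^a 1 = x^a / Gamma (a + 1) into 1 - y = c I^a y. The factor c is the
  point: the trivial bound 1 would not control the operator L.\<close>

lemma relaxation_defect_le: "0 \<le> x \<Longrightarrow> relaxation_defect a c x \<le> c * (x powr a / Gamma (a + 1))"
  using mult_left_mono[OF conv_rl_kernel_relaxation_le[OF a(1), of x], of c] c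
  by (cases "x = 0") (simp_all add: relaxation_defect_nonpos relaxation_defect_eq[of x] rl_kernel_def)

lemma continuous_relaxation_defect: "continuous_on UNIV (relaxation_defect a c)"
proof -
  have "continuous_on ({..0} \<union> {0..}) (\<lambda>x. if x \<le> 0 then 0 else 1 - relaxation a c x)"
    by (rule continuous_on_If)
      (auto intro!: continuous_intros continuous_on_relaxation[OF a] simp: relaxation_0[OF a])
  moreover have "(\<lambda>x. if x \<le> 0 then 0 else 1 - relaxation a c x) = relaxation_defect a c"
    by (auto simp: relaxation_defect_nonpos fun_eq_iff) (simp add: relaxation_defect_def)
  moreover have "{..0} \<union> {0..} = (UNIV :: real set)" by auto
  ultimately show ?thesis by metis
qed

lemma relaxation_local_integrable: "integrable lborel (\<lambda>s. indicator {0..t} s *\<^sub>R relaxation a c s)"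
proof (rule Bochner_Integration.integrable_bound)
  note [measurable] = relaxation_measurable[OF a]
  show "(\<lambda>s. indicator {0..t} s *\<^sub>R relaxation a c s) \<in> borel_measurable lborel" by measurable
  show "integrable lborel (indicat_real {0..t})"
    by (intro integrable_real_indicator) (auto simp: emeasure_lborel_Icc_eq)
  show "AE s in lborel. norm (indicator {0..t} s *\<^sub>R relaxation a c s) \<le> norm (indicat_real {0..t} s)"
    using relaxation_nonneg[OF a c] relaxation_le_1[OF a c] by (auto simp: indicator_def)
qed

text \<open>From 1 - y = c I^a y and I^(1-a) I^a = I^1; this is the equation D^a y = - c y in
  integrated form.\<close>

lemma conv_relaxation_defect:
  "conv (rl_kernel (1 - a)) (relaxation_defect a c) = (\<lambda>t. c * conv (rl_kernel 1) (relaxation a c) t)"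
proof
  fix t
  have k: "conv (rl_kernel (1 - a)) (rl_kernel a) = rl_kernel 1"
    using conv_rl_kernel[of "1 - a" a] a by simp
  have "conv (rl_kernel (1 - a)) (relaxation_defect a c) t
      = (\<integral>s. c * (rl_kernel (1 - a) (t - s) * conv (rl_kernel a) (relaxation a c) s) \<partial>lborel)"
    unfolding conv_def[of "rl_kernel (1 - a)"] by (simp add: relaxation_defect_eq mult_ac)
  also have "\<dots> = c * conv (rl_kernel (1 - a)) (conv (rl_kernel a) (relaxation a c)) t"
    by (simp add: conv_def[of "rl_kernel (1 - a)"])
  also have "conv (rl_kernel (1 - a)) (conv (rl_kernel a) (relaxation a c)) t
      = conv (rl_kernel 1) (relaxation a c) t"
  proof (subst k[symmetric], rule conv_assoc[where K=1])
    fix x :: real assume "x \<le> t"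
    have "(\<integral>s. \<bar>rl_kernel (1 - a) (x - s) * rl_kernel a s\<bar> \<partial>lborel) = conv (rl_kernel (1-a)) (rl_kernel a) x"
      using a by (simp add: conv_def abs_mult rl_kernel_nonneg)
    then show "(\<integral>s. \<bar>rl_kernel (1 - a) (x - s) * rl_kernel a s\<bar> \<partial>lborel) \<le> 1"
      by (simp add: k rl_kernel_one)
  qed (use a relaxation_local_integrable relaxation_measurable[OF a] integrable_rl_kernel_conv[of "1-a" a]
      in \<open>auto simp: rl_kernel_nonpos_arg relaxation_neg\<close>)
  finally show "conv (rl_kernel (1 - a)) (relaxation_defect a c) t = c * conv (rl_kernel 1) (relaxation a c) t" .
qed

lemma integrable_rl_kernel_defect:
  assumes b: "b > 0"
  shows "integrable lborel (\<lambda>s. rl_kernel b (x - s) * relaxation_defect a c s)"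
proof (rule Bochner_Integration.integrable_bound)
  note [measurable] = relaxation_defect_measurable
  show "(\<lambda>s. rl_kernel b (x - s) * relaxation_defect a c s) \<in> borel_measurable lborel" by measurable
  show "integrable lborel (\<lambda>s. rl_kernel b (x - s) * rl_kernel 1 s)"
    by (intro integrable_rl_kernel_conv b) simp
  show "AE s in lborel. norm (rl_kernel b (x - s) * relaxation_defect a c s) \<le> norm (rl_kernel b (x - s) * rl_kernel 1 s)"
  proof (rule AE_I2)
    fix s
    have "\<bar>relaxation_defect a c s\<bar> \<le> \<bar>rl_kernel 1 s\<bar>"
      using relaxation_defect_nonneg[of s] relaxation_defect_le_1[of s] relaxation_defect_nonpos[of s]
      by (auto simp: rl_kernel_one)
    then show "norm (rl_kernel b (x - s) * relaxation_defect a c s) \<le> norm (rl_kernel b (x - s) * rl_kernel 1 s)"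
      by (simp add: abs_mult mult_left_mono)
  qed
qed

end

section \<open>Absolutely continuous functions\<close>

text \<open>The fundamental theorem for the gauge integral. At tags off \<open>N\<close>
  differentiability controls the Riemann sum; intervals tagged in \<open>N\<close> lie in an open
  set of small measure, where absolute continuity makes the total increment of \<open>g\<close>
  small.\<close>

lemma absolutely_continuous_has_integral:
  fixes g :: "real \<Rightarrow> 'b::banach"
  assumes ab: "a \<le> b" and ac: "absolutely_continuous_fun a b g" and N: "negligible N"
    and der: "\<And>x. x \<in> {a..b} - N \<Longrightarrow> (g has_vector_derivative g' x) (at x within {a..b})"
  shows "(g' has_integral (g b - g a)) {a..b}"
proof -
  define f' where "f' = (\<lambda>x. if x \<in> N then 0 else g' x)"
  have "(f' has_integral (g b - g a)) (cbox a b)"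
    unfolding has_integral
  proof (intro allI impI)
    fix e :: real assume "e > 0"
    \<comment> \<open>The summand 1 keeps the quotient meaningful for a = b and makes e1 (b - a) < e
      / 2 strict.\<close>
    define e1 where "e1 = e / (2 * (b - a + 1))"
    have e1: "e1 > 0" using \<open>e > 0\<close> ab by (simp add: e1_def)
    have "\<exists>d>0. x \<in> {a..b} - N \<longrightarrow>
        (\<forall>y\<in>{a..b}. norm (y - x) < d \<longrightarrow> norm (g y - g x - (y - x) *\<^sub>R g' x) \<le> e1 * norm (y - x))" for x
    proof (cases "x \<in> {a..b} - N")
      case True
      then show ?thesis
        using der[OF True, unfolded has_vector_derivative_def has_derivative_within_alt] e1 by blast
    next
      case False
      then show ?thesis by (intro exI[of _ 1]) auto
    qed
    then obtain d where d: "\<And>x. d x > 0"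
        "\<And>x y. x \<in> {a..b} - N \<Longrightarrow> y \<in> {a..b} \<Longrightarrow> norm (y - x) < d x \<Longrightarrow>
          norm (g y - g x - (y - x) *\<^sub>R g' x) \<le> e1 * norm (y - x)"
      by metis
    obtain \<delta> where \<delta>: "\<delta> > 0" "\<And>(n::nat) p q. \<forall>i<n. a \<le> p i \<and> p i \<le> q i \<and> q i \<le> b \<Longrightarrow>
        disjoint_family_on (\<lambda>i. {p i<..<q i}) {..<n} \<Longrightarrow> (\<Sum>i<n. q i - p i) < \<delta> \<Longrightarrow>
        (\<Sum>i<n. norm (g (q i) - g (p i))) < e / 2"
      using ac[unfolded absolutely_continuous_fun_def, rule_format, OF half_gt_zero[OF \<open>e > 0\<close>]] by blast
    \<comment> \<open>An open superset of \<open>N\<close> with measure below the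
      \<open>\<delta>\<close> of absolute continuity; passing from U - N to U costs nothing because
      \<open>N\<close> is null.\<close>
    have "N \<in> sets lebesgue" using N by (simp add: negligible_imp_sets)
    from sets_lebesgue_outer_open[OF this \<open>\<delta> > 0\<close>]
    obtain U where U: "open U" "N \<subseteq> U" "(U - N) \<in> lmeasurable" "emeasure lebesgue (U - N) < ennreal \<delta>"
      by metis
    have NN: "N \<in> null_sets lebesgue" using N by (simp add: negligible_iff_null_sets)
    have "U \<in> sets lebesgue" using U(1) by auto
    have emU: "emeasure lebesgue U < ennreal \<delta>"
      using emeasure_Diff_null_set[OF NN \<open>U \<in> sets lebesgue\<close>] U(4) by simp
    have Um: "U \<in> lmeasurable"
      using emU \<open>U \<in> sets lebesgue\<close> by (auto intro!: fmeasurableI less_trans[OF emU])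
    have mU: "measure lebesgue U < \<delta>"
      using emU Um \<open>\<delta> > 0\<close> by (simp add: emeasure_eq_measure2 ennreal_less_iff)
    have "\<exists>r>0. x \<in> N \<longrightarrow> ball x r \<subseteq> U" for x
    proof (cases "x \<in> N")
      case True
      then show ?thesis using U(1,2) by (auto simp: open_contains_ball)
    next
      case False
      then show ?thesis by (intro exI[of _ 1]) auto
    qed
    then obtain r where r: "\<And>x. r x > 0" "\<And>x. x \<in> N \<Longrightarrow> ball x (r x) \<subseteq> U" by metis
    \<comment> \<open>One gauge for both kinds of tags: \<open>d\<close> is the radius of
      differentiability, \<open>r\<close> keeps the intervals tagged in \<open>N\<close> inside
      \<open>U\<close>.\<close>
    let ?\<gamma> = "\<lambda>x. ball x (min (d x) (r x))"
    show "\<exists>\<gamma>. gauge \<gamma> \<and> (\<forall>\<D>. \<D> tagged_division_of cbox a b \<and> \<gamma> fine \<D> \<longrightarrow>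
        norm ((\<Sum>(x, K)\<in>\<D>. measure lborel K *\<^sub>R f' x) - (g b - g a)) < e)"
    proof (intro exI[of _ ?\<gamma>] conjI allI impI)
      show "gauge ?\<gamma>" using d(1) r(1) by (intro gauge_ball_dependent) auto
    next
      fix p assume "p tagged_division_of cbox a b \<and> ?\<gamma> fine p"
      then have p: "p tagged_division_of {a..b}" and fine: "?\<gamma> fine p" by auto
      note pD = tagged_division_ofD[OF p]
      define q where "q = {xk \<in> p. fst xk \<in> N}"
      have qp: "q \<subseteq> p" and fq: "finite q" using pD(1) by (auto simp: q_def)
      have K: "Inf K \<le> Sup K \<and> K = {Inf K..Sup K} \<and> a \<le> Inf K \<and> Sup K \<le> b \<and> x \<in> K \<and> measure lborel K = Sup K - Inf K
          \<and> K \<subseteq> ball x (d x) \<and> K \<subseteq> ball x (r x)" if xk: "(x, K) \<in> p" for x K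
      proof -
        obtain u v where uv: "K = cbox u v" using pD(4)[OF xk] by blast
        have "x \<in> K" by (rule pD(2)[OF xk])
        then have "u \<le> v" using uv by auto
        then show ?thesis using uv pD(2,3)[OF xk] fineD[OF fine xk] by auto
      qed
      let ?T = "\<lambda>(x, K). measure lborel K *\<^sub>R f' x - (g (Sup K) - g (Inf K))"
      have ba: "b - a = (\<Sum>(x,K)\<in>p. Sup K - Inf K)" "g b - g a = (\<Sum>(x,K)\<in>p. g (Sup K) - g (Inf K))"
        using additive_tagged_division_1[where f= "\<lambda>x. x"] additive_tagged_division_1[where f= g] ab p by auto
      \<comment> \<open>Straddle estimate: the tag lies between the endpoints, so the two
        linearisation errors add up to e1 times the length of the interval.\<close>
      have "norm (\<Sum>xk\<in>p - q. ?T xk) \<le> (\<Sum>(x,K)\<in>p - q. e1 * (Sup K - Inf K))"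
      proof (rule sum_norm_le, safe)
        fix x K assume xk: "(x, K) \<in> p" "(x, K) \<notin> q"
        then have x: "x \<in> {a..b} - N" using pD(3)[OF xk(1)] K[OF xk(1)] by (auto simp: q_def)
        note KK = K[OF xk(1)]
        have in_ab: "Inf K \<in> {a..b}" "Sup K \<in> {a..b}" using KK by auto
        have xK: "Inf K \<le> x" "x \<le> Sup K" using KK by (metis atLeastAtMost_iff, metis atLeastAtMost_iff)
        have "Inf K \<in> K" "Sup K \<in> K"
          using KK by (metis atLeastAtMost_iff order_refl, metis atLeastAtMost_iff order_refl)
        then have "norm (Inf K - x) < d x" "norm (Sup K - x) < d x"
          using KK by (auto simp: dist_norm norm_minus_commute subset_iff)
        then have "norm (g (Inf K) - g x - (Inf K - x) *\<^sub>R g' x) \<le> e1 * norm (Inf K - x)"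
            "norm (g (Sup K) - g x - (Sup K - x) *\<^sub>R g' x) \<le> e1 * norm (Sup K - x)"
          using d(2)[OF x] in_ab by blast+
        moreover have "measure lborel K *\<^sub>R f' x - (g (Sup K) - g (Inf K)) =
            (g (Inf K) - g x - (Inf K - x) *\<^sub>R g' x) - (g (Sup K) - g x - (Sup K - x) *\<^sub>R g' x)"
        proof -
          have "measure lborel K = Sup K - Inf K" using KK by blast
          then have "measure lborel K *\<^sub>R f' x = (Sup K - Inf K) *\<^sub>R g' x" using x by (simp add: f'_def)
          then show ?thesis by (simp add: scaleR_diff_left)
        qed
        ultimately have "norm (measure lborel K *\<^sub>R f' x - (g (Sup K) - g (Inf K)))
            \<le> e1 * norm (Inf K - x) + e1 * norm (Sup K - x)"
          by (simp only:) (rule order_trans[OF norm_triangle_ineq4], rule add_mono)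
        also have "\<dots> = e1 * (Sup K - Inf K)" using xK by (simp add: algebra_simps)
        finally show "norm (measure lborel K *\<^sub>R f' x - (g (Sup K) - g (Inf K))) \<le> e1 * (Sup K - Inf K)" .
      qed
      also have "\<dots> \<le> (\<Sum>(x,K)\<in>p. e1 * (Sup K - Inf K))"
        using K e1 pD(1) by (intro sum_mono2) (auto intro!: mult_nonneg_nonneg)
      also have "\<dots> = e1 * (b - a)"
        by (simp add: ba(1) sum_distrib_left split_def)
      also have "\<dots> < e / 2"
        using \<open>e > 0\<close> ab by (simp add: e1_def field_simps)
      finally have 1: "norm (\<Sum>xk\<in>p - q. ?T xk) < e / 2" .
      \<comment> \<open>At these tags \<open>f'\<close> is 0, so only increments of \<open>g\<close>
        remain. The bijection turns them into a family indexed by {..<n}, as the definition of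
        absolute continuity requires.\<close>
      have 2: "norm (\<Sum>xk\<in>q. ?T xk) < e / 2"
      proof -
        obtain h where h: "bij_betw h {..<card q} q"
          using ex_bij_betw_nat_finite[OF fq] by (auto simp: atLeast0LessThan)
        define P Q where "P = (\<lambda>i. Inf (snd (h i)))" and "Q = (\<lambda>i. Sup (snd (h i)))"
        have hq: "h i \<in> q" if "i < card q" for i using h that by (auto simp: bij_betw_def)
        have hp: "(fst (h i), snd (h i)) \<in> p" if "i < card q" for i using hq[OF that] qp by auto
        have PQ: "\<forall>i<card q. a \<le> P i \<and> P i \<le> Q i \<and> Q i \<le> b"
          using K[OF hp] by (auto simp: P_def Q_def)
        have int: "{P i<..<Q i} = interior (snd (h i))" if "i < card q" for i
          using K[OF hp[OF that]] unfolding P_def Q_def by (metis interior_atLeastAtMost_real)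
        have disj: "disjoint_family_on (\<lambda>i. {P i<..<Q i}) {..<card q}"
          unfolding disjoint_family_on_def
        proof (intro ballI impI)
          fix i j assume ij: "i \<in> {..<card q}" "j \<in> {..<card q}" "i \<noteq> j"
          then have "h i \<noteq> h j" using h by (auto simp: bij_betw_def inj_on_def)
          then have "interior (snd (h i)) \<inter> interior (snd (h j)) = {}"
            using ij by (intro pD(5)[OF hp hp]) (auto simp: prod_eq_iff)
          then show "{P i<..<Q i} \<inter> {P j<..<Q j} = {}" using ij int by auto
        qed
        have "(\<Sum>i<card q. Q i - P i) = (\<Sum>i<card q. measure lebesgue {P i<..<Q i})"
          using PQ by (intro sum.cong) auto
        also have "\<dots> = measure lebesgue (\<Union>i<card q. {P i<..<Q i})"
          using PQ by (intro measure_finite_Union[symmetric] disj) auto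
        also have "\<dots> \<le> measure lebesgue U"
        proof (rule measure_mono_fmeasurable[OF _ _ Um])
          show "(\<Union>i<card q. {P i<..<Q i}) \<subseteq> U"
          proof (rule UN_least)
            fix i assume "i \<in> {..<card q}"
            then have i: "i < card q" by simp
            have "fst (h i) \<in> N" using hq[OF i] by (auto simp: q_def)
            then show "{P i<..<Q i} \<subseteq> U"
              using int[OF i] interior_subset[of "snd (h i)"] K[OF hp[OF i]] r(2)[of "fst (h i)"] by blast
          qed
        qed auto
        finally have "(\<Sum>i<card q. norm (g (Q i) - g (P i))) < e / 2"
          using mU by (intro \<delta>(2)[OF PQ disj]) simp
        also have "(\<Sum>i<card q. norm (g (Q i) - g (P i))) = (\<Sum>xk\<in>q. norm (g (Sup (snd xk)) - g (Inf (snd xk))))"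
          unfolding P_def Q_def
          by (rule sum.reindex_bij_betw[OF h, of "\<lambda>xk. norm (g (Sup (snd xk)) - g (Inf (snd xk)))"])
        finally have *: "(\<Sum>xk\<in>q. norm (g (Sup (snd xk)) - g (Inf (snd xk)))) < e / 2" .
        have "norm (\<Sum>xk\<in>q. ?T xk) \<le> (\<Sum>xk\<in>q. norm (g (Sup (snd xk)) - g (Inf (snd xk))))"
          by (rule sum_norm_le) (auto simp: q_def f'_def norm_minus_commute)
        with * show ?thesis by simp
      qed
      have "(\<Sum>(x, K)\<in>p. measure lborel K *\<^sub>R f' x) - (g b - g a) = (\<Sum>xk\<in>p. ?T xk)"
        by (simp add: ba(2) sum_subtractf split_def)
      also have "\<dots> = (\<Sum>xk\<in>p - q. ?T xk) + (\<Sum>xk\<in>q. ?T xk)"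
        by (rule sum.subset_diff[OF qp pD(1)])
      finally show "norm ((\<Sum>(x, K)\<in>p. measure lborel K *\<^sub>R f' x) - (g b - g a)) < e"
        using 1 2 norm_triangle_ineq[of "\<Sum>xk\<in>p - q. ?T xk" "\<Sum>xk\<in>q. ?T xk"] by simp
    qed
  qed
  then show ?thesis
    using has_integral_spike[OF N, of "{a..b}" g' f' "g b - g a"] by (auto simp: f'_def)
qed

section \<open>Orthonormal expansions\<close>

lemma inner_of_real_1: "inner (of_real r :: 'k::{real_normed_field,euclidean_space}) 1 = r"
proof -
  have "inner (1::'k) 1 = 1" by (simp flip: power2_norm_eq_inner)
  then show ?thesis by (simp add: of_real_def)
qed

lemma kcnj_of_real_mult: "kcnj (of_real r * z) = of_real r * kcnj (z :: 'k::{real_normed_field,euclidean_space})"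
proof -
  have "of_real r * z = r *\<^sub>R z" by (simp add: scaleR_conv_of_real)
  then have "inner (of_real r * z) 1 = r * inner z 1" by simp
  then show ?thesis by (simp add: kcnj_def algebra_simps)
qed

text \<open>If \<open>x\<close> is orthogonal to \<open>1\<close> and \<open>n = norm x\<close>, then \<open>norm (x\<^sup>2 - n\<^sup>2) = norm (x - n) * norm (x + n)
  = 2 n\<^sup>2\<close>, which is only possible for \<open>x\<^sup>2 = - n\<^sup>2\<close>.\<close>
lemma mult_kcnj: "z * kcnj z = of_real ((norm (z :: 'k::{real_normed_field,euclidean_space}))\<^sup>2)"
proof -
  define a where "a = inner z 1"
  define x where "x = z - of_real a"
  define n where "n = norm x"
  have 11: "inner (1::'k) 1 = 1" by (simp flip: power2_norm_eq_inner)
  have x1: "inner x 1 = 0" by (simp add: x_def a_def inner_diff_left inner_of_real_1)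
  have nrm: "(norm (y + of_real b))\<^sup>2 = (norm y)\<^sup>2 + 2 * b * inner y 1 + b\<^sup>2" for y :: 'k and b
    using 11 by (simp only: power2_norm_eq_inner of_real_def inner_add_left inner_add_right)
      (simp add: inner_commute[of 1 y] power2_eq_square algebra_simps)
  have "(x + of_real n) * (x + of_real (- n)) = x * x + of_real (- (n\<^sup>2))"
    by (simp add: algebra_simps power2_eq_square)
  then have "(norm (x + of_real n) * norm (x + of_real (- n)))\<^sup>2 = (norm (x * x + of_real (- (n\<^sup>2))))\<^sup>2"
    by (simp flip: norm_mult)
  then have "(norm (x + of_real n))\<^sup>2 * (norm (x + of_real (- n)))\<^sup>2 = (norm (x * x + of_real (- (n\<^sup>2))))\<^sup>2"
    by (simp add: power_mult_distrib)
  then have "(2 * n\<^sup>2) * (2 * n\<^sup>2) = (n\<^sup>2)\<^sup>2 + 2 * (- (n\<^sup>2)) * inner (x * x) 1 + (n\<^sup>2)\<^sup>2"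
    unfolding nrm x1 by (simp add: n_def norm_mult power2_eq_square)
  then have "2 * n\<^sup>2 * (inner (x * x) 1 + n\<^sup>2) = 0"
    by (simp add: power2_eq_square algebra_simps)
  then have "n\<^sup>2 = 0 \<or> inner (x * x) 1 = - (n\<^sup>2)"
    by (metis add_eq_0_iff2 mult_eq_0_iff zero_neq_numeral)
  then have "(norm (x * x + of_real (n\<^sup>2)))\<^sup>2 = 0"
  proof
    assume *: "inner (x * x) 1 = - (n\<^sup>2)"
    have "(norm (x * x))\<^sup>2 = (n\<^sup>2)\<^sup>2" by (simp add: n_def norm_mult power2_eq_square)
    then show ?thesis unfolding nrm * by (simp add: power2_eq_square)
  qed (simp add: n_def)
  then have xx: "x * x = - of_real (n\<^sup>2)" by (simp add: eq_neg_iff_add_eq_0)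
  have z: "z = x + of_real a" by (simp add: x_def)
  have "z * kcnj z = (of_real a + x) * (of_real a - x)"
    by (simp add: kcnj_def z inner_add_left x1 inner_of_real_1 algebra_simps)
  also have "\<dots> = of_real (a\<^sup>2) - x * x" by (simp add: algebra_simps power2_eq_square)
  also have "\<dots> = of_real ((norm z)\<^sup>2)"
    unfolding z nrm x1 xx by (simp add: n_def)
  finally show ?thesis .
qed

lemma norm_kcnj: "norm (kcnj z) = norm (z :: 'k::{real_normed_field,euclidean_space})"
proof -
  have "norm z * norm (kcnj z) = norm z * norm z"
    using arg_cong[OF mult_kcnj[of z], of norm] by (simp add: norm_mult power2_eq_square)
  then show ?thesis by (cases "z = 0") (auto simp: kcnj_def)
qed

context hilbert_over
begin

lemma ip_scale_real_right: "ip x (sc (of_real r) y) = of_real r * ip x y"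
  by (metis ip_commute ip_scale_left kcnj_of_real_mult)

lemma ip_self: "ip x x = of_real ((norm x)\<^sup>2)"
proof -
  have "ip x x = kcnj (ip x x)" by (rule ip_commute)
  then have "2 * ip x x = 2 * of_real (inner (ip x x) 1)" by (simp add: kcnj_def algebra_simps)
  then show ?thesis by (simp add: ip_inner power2_norm_eq_inner)
qed

text \<open>The norm belongs to the real inner product and is tied to the scalars only through
  \<open>ip\<close>; sesquilinearity gives ip (c x) (c x) = c (kcnj c) (ip x x), and
  \<open>mult_kcnj\<close> evaluates the product.\<close>

lemma norm_sc: "norm (sc c x) = norm c * norm x"
proof -
  have "ip x (sc c x) = kcnj (ip (sc c x) x)" by (rule ip_commute)
  also have "\<dots> = of_real ((norm x)\<^sup>2) * kcnj c"
    by (simp only: ip_scale_left ip_self mult.commute[of c] kcnj_of_real_mult)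
  finally have "ip (sc c x) (sc c x) = c * kcnj c * of_real ((norm x)\<^sup>2)"
    by (simp only: ip_scale_left mult_ac)
  then have "(of_real ((norm (sc c x))\<^sup>2) :: 'k) = of_real ((norm c * norm x)\<^sup>2)"
    by (simp add: ip_self mult_kcnj power_mult_distrib)
  then have "(norm (sc c x))\<^sup>2 = (norm c * norm x)\<^sup>2" by (simp only: of_real_eq_iff)
  then show ?thesis by simp
qed

text \<open>Real Cauchy-Schwarz applied to (kcnj z) x with z = ip x y: this rotation makes the
  product with y real, equal to |z|^2.\<close>

lemma norm_ip_le: "norm (ip x y) \<le> norm x * norm y"
proof -
  let ?z = "ip x y"
  have "(norm ?z)\<^sup>2 = inner (ip (sc (kcnj ?z) x) y) 1"
    by (simp add: ip_scale_left mult.commute[of "kcnj ?z"] mult_kcnj inner_of_real_1 del: of_real_power)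
  also have "\<dots> \<le> norm (sc (kcnj ?z) x) * norm y"
    unfolding ip_inner by (rule norm_cauchy_schwarz)
  also have "\<dots> = norm ?z * (norm x * norm y)" by (simp add: norm_sc norm_kcnj)
  finally show ?thesis
    by (cases "norm ?z = 0") (auto simp: power2_eq_square)
qed

text \<open>Real linearity is enough to carry sums, Bochner integrals and derivatives over to
  coefficients.\<close>

lemma bounded_linear_ip: "bounded_linear (\<lambda>x. ip x y)"
proof (rule bounded_linear_intro[where K="norm y"])
  show "ip (r *\<^sub>R x) y = r *\<^sub>R ip x y" for r x
    by (simp flip: scale_of_real add: ip_scale_left scaleR_conv_of_real)
qed (auto simp: ip_add_left norm_ip_le)

lemma ip_diff_left: "ip (x - y) z = ip x z - ip y z"
  by (rule linear_diff[OF bounded_linear.linear[OF bounded_linear_ip]])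

lemma bounded_linear_sc: "bounded_linear (\<lambda>c. sc c x)"
proof (rule bounded_linear_intro[where K="norm x"])
  show "sc (r *\<^sub>R c) x = r *\<^sub>R sc c x" for r c
    by (simp flip: scale_of_real add: scaleR_conv_of_real)
qed (auto simp: scale_left_distrib norm_sc)

end

section \<open>Orthonormal bases: Bessel, Riesz-Fischer, Parseval\<close>

locale hilbert_basis = hilbert_over sc ip
  for sc :: "'k::{real_normed_field,euclidean_space}
      \<Rightarrow> 'a::{real_inner,banach,second_countable_topology} \<Rightarrow> 'a"
    and ip :: "'a \<Rightarrow> 'a \<Rightarrow> 'k" +
  fixes I :: "'i set" and e :: "'i \<Rightarrow> 'a"
  assumes basis: "orthonormal_basis sc ip I e"
begin

lemma ip_basis: "\<xi> \<in> I \<Longrightarrow> \<eta> \<in> I \<Longrightarrow> ip (e \<xi>) (e \<eta>) = (if \<xi> = \<eta> then 1 else 0)"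
  using basis by (simp add: orthonormal_basis_def)

lemma norm_basis: "\<xi> \<in> I \<Longrightarrow> norm (e \<xi>) = 1"
proof -
  assume "\<xi> \<in> I"
  then have "(of_real ((norm (e \<xi>))\<^sup>2) :: 'k) = of_real 1"
    using ip_basis[of \<xi> \<xi>] by (simp add: ip_self)
  then have "(norm (e \<xi>))\<^sup>2 = 1\<^sup>2" by (simp only: of_real_eq_iff one_power2)
  then show ?thesis by (rule power2_eq_imp_eq) auto
qed

lemma norm_ip_basis_le: "\<xi> \<in> I \<Longrightarrow> norm (ip x (e \<xi>)) \<le> norm x"
  using norm_ip_le[of x "e \<xi>"] by (simp add: norm_basis)

lemma ip_sum_basis: "finite F \<Longrightarrow> F \<subseteq> I \<Longrightarrow> \<eta> \<in> I \<Longrightarrow>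
    ip (\<Sum>\<xi>\<in>F. sc (c \<xi>) (e \<xi>)) (e \<eta>) = (if \<eta> \<in> F then c \<eta> else 0)"
proof -
  assume F: "finite F" "F \<subseteq> I" and \<eta>: "\<eta> \<in> I"
  interpret bounded_linear "\<lambda>x. ip x (e \<eta>)" by (rule bounded_linear_ip)
  have "ip (\<Sum>\<xi>\<in>F. sc (c \<xi>) (e \<xi>)) (e \<eta>) = (\<Sum>\<xi>\<in>F. if \<eta> = \<xi> then c \<xi> else 0)"
    unfolding sum using F \<eta> by (intro sum.cong) (auto simp: ip_scale_left ip_basis)
  then show ?thesis using F by (simp add: sum.delta')
qed

text \<open>Orthogonality for \<open>ip\<close> implies orthogonality for its real part, so the real
  Pythagorean theorem applies.\<close>

lemma norm_sum_basis:
  assumes F: "finite F" "F \<subseteq> I"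
  shows "(norm (\<Sum>\<xi>\<in>F. sc (c \<xi>) (e \<xi>)))\<^sup>2 = (\<Sum>\<xi>\<in>F. (norm (c \<xi>))\<^sup>2)"
proof -
  have "pairwise (\<lambda>\<xi> \<eta>. orthogonal (sc (c \<xi>) (e \<xi>)) (sc (c \<eta>) (e \<eta>))) F"
  proof (rule pairwiseI)
    fix \<xi> \<eta> assume "\<xi> \<in> F" "\<eta> \<in> F" "\<xi> \<noteq> \<eta>"
    then have "ip (e \<eta>) (e \<xi>) = 0" using F ip_basis[of \<eta> \<xi>] by auto
    then have "ip (sc (c \<xi>) (e \<xi>)) (sc (c \<eta>) (e \<eta>)) = c \<xi> * kcnj (c \<eta> * 0)"
      using ip_commute[of "e \<xi>" "sc (c \<eta>) (e \<eta>)"] by (simp add: ip_scale_left)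
    then have "inner (sc (c \<xi>) (e \<xi>)) (sc (c \<eta>) (e \<eta>)) = 0"
      using ip_inner[of "sc (c \<xi>) (e \<xi>)" "sc (c \<eta>) (e \<eta>)"] by (simp add: kcnj_def)
    then show "orthogonal (sc (c \<xi>) (e \<xi>)) (sc (c \<eta>) (e \<eta>))" by (simp add: orthogonal_def)
  qed
  from norm_sum_Pythagorean[OF F(1) this] show ?thesis
    using F(2) by (simp add: norm_sc norm_basis subset_iff)
qed

lemma bessel:
  assumes F: "finite F" "F \<subseteq> I"
  shows "(\<Sum>\<xi>\<in>F. (norm (ip x (e \<xi>)))\<^sup>2) \<le> (norm x)\<^sup>2"
proof -
  let ?s = "\<Sum>\<xi>\<in>F. sc (ip x (e \<xi>)) (e \<xi>)"
  have "inner (sc (ip x (e \<xi>)) (e \<xi>)) x = (norm (ip x (e \<xi>)))\<^sup>2" for \<xi>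
  proof -
    have "ip (sc (ip x (e \<xi>)) (e \<xi>)) x = of_real ((norm (ip x (e \<xi>)))\<^sup>2)"
      using ip_commute[of "e \<xi>" x] by (simp add: ip_scale_left mult_kcnj)
    then show ?thesis
      using ip_inner[of "sc (ip x (e \<xi>)) (e \<xi>)" x] by (simp only: inner_of_real_1)
  qed
  then have "inner ?s x = (\<Sum>\<xi>\<in>F. (norm (ip x (e \<xi>)))\<^sup>2)" by (simp add: inner_sum_left)
  moreover have "inner ?s ?s = (\<Sum>\<xi>\<in>F. (norm (ip x (e \<xi>)))\<^sup>2)"
    using norm_sum_basis[OF F, of "\<lambda>\<xi>. ip x (e \<xi>)"] by (simp add: power2_norm_eq_inner)
  moreover have "0 \<le> inner (x - ?s) (x - ?s)" by simp
  ultimately show ?thesis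
    by (simp add: inner_diff_left inner_diff_right inner_commute power2_norm_eq_inner)
qed

lemma summable_ip_basis: "(\<lambda>\<xi>. (norm (ip x (e \<xi>)))\<^sup>2) summable_on I"
  by (rule nonneg_bdd_above_summable_on) (auto intro!: bdd_aboveI2 bessel)

text \<open>Riesz-Fischer: by Pythagoras the differences of finite partial sums are tails of the
  convergent series of squares, so the net of partial sums is Cauchy.\<close>

lemma square_summable_imp_summable:
  assumes "(\<lambda>\<xi>. (norm (c \<xi>))\<^sup>2) summable_on I"
  shows "(\<lambda>\<xi>. sc (c \<xi>) (e \<xi>)) summable_on I"
proof -
  let ?v = "\<lambda>\<xi>. sc (c \<xi>) (e \<xi>)" and ?n = "\<lambda>\<xi>. (norm (c \<xi>))\<^sup>2"
  have "cauchy_filter (filtermap (sum ?v) (finite_subsets_at_top I))"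
    unfolding cauchy_filter_metric_filtermap
  proof (intro allI impI)
    fix \<epsilon> :: real assume "\<epsilon> > 0"
    then obtain F0 where F0: "finite F0" "F0 \<subseteq> I" "dist (sum ?n F0) (infsum ?n I) \<le> (\<epsilon> / 3)\<^sup>2"
      using infsum_finite_approximation[OF assms, of "(\<epsilon>/3)\<^sup>2"] by auto
    have *: "dist (sum ?v F) (sum ?v F0) \<le> \<epsilon> / 3" if F: "finite F" "F0 \<subseteq> F" "F \<subseteq> I" for F
    proof -
      have "sum ?v F - sum ?v F0 = sum ?v (F - F0)" using F by (simp add: sum_diff)
      then have "(norm (sum ?v F - sum ?v F0))\<^sup>2 = sum ?n (F - F0)"
        using F by (simp add: norm_sum_basis subset_iff)
      also have "\<dots> = sum ?n F - sum ?n F0" using F by (simp add: sum_diff)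
      also have "\<dots> \<le> infsum ?n I - sum ?n F0"
        using F finite_sum_le_infsum[OF assms F(1,3)] by simp
      also have "\<dots> \<le> (\<epsilon> / 3)\<^sup>2" using F0(3) by (simp add: dist_real_def)
      finally show ?thesis
        unfolding dist_norm by (rule power2_le_imp_le) (use \<open>\<epsilon> > 0\<close> in simp)
    qed
    show "\<exists>P. eventually P (finite_subsets_at_top I) \<and> (\<forall>x y. P x \<and> P y \<longrightarrow> dist (sum ?v x) (sum ?v y) < \<epsilon>)"
    proof (intro exI[of _ "\<lambda>F. finite F \<and> F0 \<subseteq> F \<and> F \<subseteq> I"] conjI allI impI)
      show "\<forall>\<^sub>F F in finite_subsets_at_top I. finite F \<and> F0 \<subseteq> F \<and> F \<subseteq> I"
        using F0 by (auto simp: eventually_finite_subsets_at_top)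
      fix F G assume "(finite F \<and> F0 \<subseteq> F \<and> F \<subseteq> I) \<and> (finite G \<and> F0 \<subseteq> G \<and> G \<subseteq> I)"
      then have "dist (sum ?v F) (sum ?v F0) \<le> \<epsilon>/3" "dist (sum ?v G) (sum ?v F0) \<le> \<epsilon>/3"
        using * by blast+
      then show "dist (sum ?v F) (sum ?v G) < \<epsilon>"
        using dist_triangle2[of "sum ?v F" "sum ?v G" "sum ?v F0"] \<open>\<epsilon> > 0\<close> by simp
    qed
  qed
  then have "convergent_filter (filtermap (sum ?v) (finite_subsets_at_top I))"
    by (rule cauchy_filter_convergent)
  then show ?thesis
    by (auto simp: summable_on_def has_sum_def convergent_filter_iff filterlim_def)
qed

lemma ip_infsum_basis:
  assumes "(\<lambda>\<xi>. sc (c \<xi>) (e \<xi>)) summable_on I" "\<eta> \<in> I"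
  shows "ip (\<Sum>\<^sub>\<infinity>\<xi>\<in>I. sc (c \<xi>) (e \<xi>)) (e \<eta>) = c \<eta>"
proof -
  have "((\<lambda>\<xi>. ip (sc (c \<xi>) (e \<xi>)) (e \<eta>)) has_sum ip (\<Sum>\<^sub>\<infinity>\<xi>\<in>I. sc (c \<xi>) (e \<xi>)) (e \<eta>)) I"
    using has_sum_bounded_linear[OF bounded_linear_ip has_sum_infsum[OF assms(1)]] .
  moreover have "((\<lambda>\<xi>. ip (sc (c \<xi>) (e \<xi>)) (e \<eta>)) has_sum c \<eta>) I"
    by (rule has_sum_finite_neutralI[of "{\<eta>}"]) (use assms(2) in \<open>auto simp: ip_scale_left ip_basis\<close>)
  ultimately show ?thesis by (rule has_sum_unique)
qed

lemma summable_iff_square_summable: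
  "(\<lambda>\<xi>. sc (c \<xi>) (e \<xi>)) summable_on I \<longleftrightarrow> (\<lambda>\<xi>. (norm (c \<xi>))\<^sup>2) summable_on I"
proof
  assume *: "(\<lambda>\<xi>. sc (c \<xi>) (e \<xi>)) summable_on I"
  define x where "x = (\<Sum>\<^sub>\<infinity>\<xi>\<in>I. sc (c \<xi>) (e \<xi>))"
  have "(\<lambda>\<xi>. (norm (ip x (e \<xi>)))\<^sup>2) summable_on I \<longleftrightarrow> (\<lambda>\<xi>. (norm (c \<xi>))\<^sup>2) summable_on I"
    by (rule summable_on_cong) (simp only: x_def ip_infsum_basis[OF *])
  then show "(\<lambda>\<xi>. (norm (c \<xi>))\<^sup>2) summable_on I"
    using summable_ip_basis by (rule iffD1)
qed (rule square_summable_imp_summable)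

text \<open>The vectors orthogonal to \<open>x\<close> form a closed subspace containing the basis,
  hence everything, including \<open>x\<close> itself.\<close>

lemma eq_0_if_coefficients_0:
  assumes "\<And>\<xi>. \<xi> \<in> I \<Longrightarrow> ip x (e \<xi>) = 0"
  shows "x = 0"
proof -
  have "subspace {y. ip y x = 0}"
    using linear_0[OF bounded_linear.linear[OF bounded_linear_ip], of x]
    by (intro subspaceI) (simp_all add: ip_add_left ip_scale_left)
  moreover have "ip (e \<xi>) x = 0" if "\<xi> \<in> I" for \<xi>
    using ip_commute[of "e \<xi>" x] assms[OF that] by (simp add: kcnj_def)
  then have "e ` I \<subseteq> {y. ip y x = 0}" by blast
  ultimately have "span (e ` I) \<subseteq> {y. ip y x = 0}" by (rule span_minimal[rotated])
  moreover have "closed {y. ip y x = 0}"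
    by (intro closed_Collect_eq continuous_intros bounded_linear.continuous_on[OF bounded_linear_ip])
  ultimately have "closure (span (e ` I)) \<subseteq> {y. ip y x = 0}" by (rule closure_minimal)
  then have "ip x x = 0" using basis by (auto simp: orthonormal_basis_def)
  then show ?thesis by (simp add: ip_self)
qed

lemma eq_if_coefficients_eq:
  assumes "\<And>\<xi>. \<xi> \<in> I \<Longrightarrow> ip x (e \<xi>) = ip y (e \<xi>)"
  shows "x = y"
proof -
  have "ip (x - y) (e \<xi>) = ip x (e \<xi>) - ip y (e \<xi>)" for \<xi>
    by (rule bounded_linear.linear[OF bounded_linear_ip, THEN linear_diff])
  then show ?thesis using eq_0_if_coefficients_0[of "x - y"] assms by simp
qed

lemma has_sum_expansion: "((\<lambda>\<xi>. sc (ip x (e \<xi>)) (e \<xi>)) has_sum x) I"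
proof -
  have s: "(\<lambda>\<xi>. sc (ip x (e \<xi>)) (e \<xi>)) summable_on I"
    by (rule square_summable_imp_summable[OF summable_ip_basis])
  then have "(\<Sum>\<^sub>\<infinity>\<xi>\<in>I. sc (ip x (e \<xi>)) (e \<xi>)) = x"
    by (intro eq_if_coefficients_eq) (simp add: ip_infsum_basis)
  then show ?thesis using has_sum_infsum[OF s] by simp
qed

lemma parseval: "((\<lambda>\<xi>. (norm (ip x (e \<xi>)))\<^sup>2) has_sum (norm x)\<^sup>2) I"
proof -
  have "((\<lambda>F. (norm (\<Sum>\<xi>\<in>F. sc (ip x (e \<xi>)) (e \<xi>)))\<^sup>2) \<longlongrightarrow> (norm x)\<^sup>2) (finite_subsets_at_top I)"
    using has_sum_expansion[of x] unfolding has_sum_def by (intro tendsto_intros)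
  then show ?thesis
    unfolding has_sum_def
    by (rule Lim_transform_eventually)
      (auto simp: eventually_finite_subsets_at_top norm_sum_basis)
qed

text \<open>A Weierstrass test in l^2: a square-summable majorant makes the finite partial sums
  converge uniformly, since the terms are orthogonal. The series of norms need not converge.\<close>

lemma continuous_on_infsum_basis:
  fixes c :: "'i \<Rightarrow> 't::topological_space \<Rightarrow> 'k"
  assumes cont: "\<And>\<xi>. \<xi> \<in> I \<Longrightarrow> continuous_on S (c \<xi>)"
    and le: "\<And>\<xi> t. \<xi> \<in> I \<Longrightarrow> t \<in> S \<Longrightarrow> norm (c \<xi> t) \<le> b \<xi>"
    and b: "(\<lambda>\<xi>. (b \<xi>)\<^sup>2) summable_on I"
  shows "t \<in> S \<Longrightarrow> (\<lambda>\<xi>. sc (c \<xi> t) (e \<xi>)) summable_on I"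
    and "continuous_on S (\<lambda>t. \<Sum>\<^sub>\<infinity>\<xi>\<in>I. sc (c \<xi> t) (e \<xi>))"
proof -
  have le2: "(norm (c \<xi> t))\<^sup>2 \<le> (b \<xi>)\<^sup>2" if "\<xi> \<in> I" "t \<in> S" for \<xi> t
    using le[OF that] by (intro power_mono) auto
  show s: "(\<lambda>\<xi>. sc (c \<xi> t) (e \<xi>)) summable_on I" if "t \<in> S" for t
    by (rule square_summable_imp_summable, rule summable_on_comparison_test[OF b])
      (use le2 that in auto)
  show "continuous_on S (\<lambda>t. \<Sum>\<^sub>\<infinity>\<xi>\<in>I. sc (c \<xi> t) (e \<xi>))"
  proof (rule uniform_limit_theorem)
    show "\<forall>\<^sub>F F in finite_subsets_at_top I. continuous_on S (\<lambda>t. \<Sum>\<xi>\<in>F. sc (c \<xi> t) (e \<xi>))"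
      by (rule eventually_finite_subsets_at_top_weakI)
        (intro continuous_on_sum bounded_linear.continuous_on[OF bounded_linear_sc] cont, auto)
    show "uniform_limit S (\<lambda>F t. \<Sum>\<xi>\<in>F. sc (c \<xi> t) (e \<xi>)) (\<lambda>t. \<Sum>\<^sub>\<infinity>\<xi>\<in>I. sc (c \<xi> t) (e \<xi>))
        (finite_subsets_at_top I)"
      unfolding uniform_limit_iff
    proof (intro allI impI)
      fix \<epsilon> :: real assume "\<epsilon> > 0"
      then obtain F0 where F0: "finite F0" "F0 \<subseteq> I"
          "dist (sum (\<lambda>\<xi>. (b \<xi>)\<^sup>2) F0) (infsum (\<lambda>\<xi>. (b \<xi>)\<^sup>2) I) \<le> (\<epsilon> / 2)\<^sup>2"
        using infsum_finite_approximation[OF b, of "(\<epsilon>/2)\<^sup>2"] by auto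
      have "dist (\<Sum>\<xi>\<in>F. sc (c \<xi> t) (e \<xi>)) (\<Sum>\<^sub>\<infinity>\<xi>\<in>I. sc (c \<xi> t) (e \<xi>)) < \<epsilon>"
        if F: "finite F" "F0 \<subseteq> F" "F \<subseteq> I" and t: "t \<in> S" for F t
      proof -
        let ?d = "(\<Sum>\<^sub>\<infinity>\<xi>\<in>I. sc (c \<xi> t) (e \<xi>)) - (\<Sum>\<xi>\<in>F. sc (c \<xi> t) (e \<xi>))"
        have d: "ip ?d (e \<eta>) = (if \<eta> \<in> F then 0 else c \<eta> t)" if "\<eta> \<in> I" for \<eta>
          using linear_diff[OF bounded_linear.linear[OF bounded_linear_ip]] ip_infsum_basis[OF s[OF t] that]
            ip_sum_basis[OF F(1,3) that] by auto
        \<comment> \<open>By Parseval the remainder has only the coefficients outside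
          \<open>F\<close>, so its square is at most the tail of the squared majorant, whatever t
          is.\<close>
        have "(norm ?d)\<^sup>2 \<le> infsum (\<lambda>\<xi>. (b \<xi>)\<^sup>2) I - sum (\<lambda>\<xi>. (b \<xi>)\<^sup>2) F"
        proof (rule has_sum_le_finite_sums[OF parseval])
          fix G assume G: "finite G" "G \<subseteq> I"
          have "(\<Sum>\<xi>\<in>G. (norm (ip ?d (e \<xi>)))\<^sup>2) = (\<Sum>\<xi>\<in>G - F. (norm (c \<xi> t))\<^sup>2)"
            using G d by (intro sum.mono_neutral_cong_right) auto
          also have "\<dots> \<le> (\<Sum>\<xi>\<in>G - F. (b \<xi>)\<^sup>2)"
            using G t le2 by (intro sum_mono) auto
          also have "\<dots> = (\<Sum>\<xi>\<in>(G - F) \<union> F. (b \<xi>)\<^sup>2) - sum (\<lambda>\<xi>. (b \<xi>)\<^sup>2) F"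
            using G F by (subst sum.union_disjoint) auto
          also have "\<dots> \<le> infsum (\<lambda>\<xi>. (b \<xi>)\<^sup>2) I - sum (\<lambda>\<xi>. (b \<xi>)\<^sup>2) F"
            using G F by (intro diff_right_mono finite_sum_le_infsum[OF b]) auto
          finally show "(\<Sum>\<xi>\<in>G. (norm (ip ?d (e \<xi>)))\<^sup>2) \<le> \<dots>" .
        qed
        also have "\<dots> \<le> infsum (\<lambda>\<xi>. (b \<xi>)\<^sup>2) I - sum (\<lambda>\<xi>. (b \<xi>)\<^sup>2) F0"
          using F by (intro diff_left_mono sum_mono2) auto
        also have "\<dots> \<le> (\<epsilon> / 2)\<^sup>2" using F0(3) by (simp add: dist_real_def)
        finally have "norm ?d \<le> \<epsilon> / 2"
          by (rule power2_le_imp_le) (use \<open>\<epsilon> > 0\<close> in simp)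
        then show ?thesis using \<open>\<epsilon> > 0\<close> by (simp add: dist_norm norm_minus_commute)
      qed
      then show "\<forall>\<^sub>F F in finite_subsets_at_top I. \<forall>t\<in>S.
          dist (\<Sum>\<xi>\<in>F. sc (c \<xi> t) (e \<xi>)) (\<Sum>\<^sub>\<infinity>\<xi>\<in>I. sc (c \<xi> t) (e \<xi>)) < \<epsilon>"
        using F0(1,2) by (auto simp: eventually_finite_subsets_at_top)
    qed
  qed simp
qed

section \<open>Diagonal operators and their domains\<close>

lemma mem_spectral_space_iff:
  assumes "\<And>\<xi>. \<xi> \<in> I \<Longrightarrow> 0 < \<nu> \<xi>"
  shows "u \<in> spectral_space sc ip I e \<nu> 1 \<longleftrightarrow> (\<lambda>\<xi>. (\<nu> \<xi> * norm (ip u (e \<xi>)))\<^sup>2) summable_on I"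
proof -
  have "(norm (of_real (\<nu> \<xi> powr 1) * ip u (e \<xi>)))\<^sup>2 = (\<nu> \<xi> * norm (ip u (e \<xi>)))\<^sup>2" if "\<xi> \<in> I" for \<xi>
    using assms[OF that] by (simp add: norm_mult)
  then have "(\<lambda>\<xi>. (norm (of_real (\<nu> \<xi> powr 1) * ip u (e \<xi>)))\<^sup>2) summable_on I \<longleftrightarrow>
      (\<lambda>\<xi>. (\<nu> \<xi> * norm (ip u (e \<xi>)))\<^sup>2) summable_on I"
    by (rule summable_on_cong)
  then show ?thesis
    by (simp only: spectral_space_def mem_Collect_eq summable_iff_square_summable)
qed

lemma ip_spectral_power:
  assumes "\<And>\<xi>. \<xi> \<in> I \<Longrightarrow> 0 < \<nu> \<xi>" "u \<in> spectral_space sc ip I e \<nu> 1" "\<xi> \<in> I"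
  shows "ip (spectral_power sc ip I e \<nu> 1 u) (e \<xi>) = of_real (\<nu> \<xi>) * ip u (e \<xi>)"
proof -
  have "\<nu> \<xi> powr 1 = \<nu> \<xi>" using assms(1)[OF assms(3)] by simp
  then show ?thesis
    using ip_infsum_basis[OF assms(2)[unfolded spectral_space_def mem_Collect_eq] assms(3)]
    by (simp only: spectral_power_def)
qed

text \<open>Expanding \<open>u\<close> and using symmetry against each basis vector gives ip (A x) u
  = ip x z for all x in \<open>D\<close>, where z is the spectral series. Thus \<open>u\<close> lies
  in the domain of the adjoint, hence in \<open>D\<close>, and symmetry then identifies the
  coefficients of \<open>A u\<close>.\<close>

lemma self_adjoint_eq_spectral_power:
  assumes sa: "self_adjoint sc ip D A"
    and eig: "\<And>\<xi>. \<xi> \<in> I \<Longrightarrow> e \<xi> \<in> D \<and> A (e \<xi>) = sc (of_real (\<nu> \<xi>)) (e \<xi>)"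
    and pos: "\<And>\<xi>. \<xi> \<in> I \<Longrightarrow> 0 < \<nu> \<xi>"
    and u: "u \<in> spectral_space sc ip I e \<nu> 1"
  shows "A u = spectral_power sc ip I e \<nu> 1 u"
proof -
  let ?z = "spectral_power sc ip I e \<nu> 1 u"
  have sym: "\<And>x y. x \<in> D \<Longrightarrow> y \<in> D \<Longrightarrow> ip (A x) y = ip x (A y)"
    and dom: "\<And>y. (\<exists>z. \<forall>x\<in>D. ip (A x) y = ip x z) \<Longrightarrow> y \<in> D"
    using sa unfolding self_adjoint_def by blast+
  have "ip (A x) u = ip x ?z" if x: "x \<in> D" for x
  proof -
    have "((\<lambda>\<xi>. ip (sc (ip u (e \<xi>)) (e \<xi>)) (A x)) has_sum ip u (A x)) I"
      by (rule has_sum_bounded_linear[OF bounded_linear_ip has_sum_expansion])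
    moreover have "((\<lambda>\<xi>. ip (sc (ip ?z (e \<xi>)) (e \<xi>)) x) has_sum ip ?z x) I"
      by (rule has_sum_bounded_linear[OF bounded_linear_ip has_sum_expansion])
    moreover have "ip (sc (ip u (e \<xi>)) (e \<xi>)) (A x) = ip (sc (ip ?z (e \<xi>)) (e \<xi>)) x" if "\<xi> \<in> I" for \<xi>
      using sym[of "e \<xi>" x] x eig[OF that] ip_spectral_power[OF pos u that] by (simp add: ip_scale_left)
    then have "((\<lambda>\<xi>. ip (sc (ip ?z (e \<xi>)) (e \<xi>)) x) has_sum ip u (A x)) I"
      using calculation(1) by (subst (asm) has_sum_cong) auto
    ultimately have "ip u (A x) = ip ?z x"
      by (metis has_sum_unique)
    then show ?thesis by (metis ip_commute)
  qed
  then have "u \<in> D" using dom by blast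
  show ?thesis
  proof (rule eq_if_coefficients_eq)
    fix \<xi> assume \<xi>: "\<xi> \<in> I"
    show "ip (A u) (e \<xi>) = ip ?z (e \<xi>)"
      using sym[OF \<open>u \<in> D\<close>, of "e \<xi>"] eig[OF \<xi>] ip_spectral_power[OF pos u \<xi>] by (simp add: ip_scale_real_right)
  qed
qed

end

section \<open>The scalar problem\<close>

lemma conv_eq_0:
  assumes "\<And>s. k (t - s) = 0 \<or> g s = 0"
  shows "conv k g t = 0"
proof -
  have "(\<lambda>s. k (t - s) *\<^sub>R g s) = (\<lambda>_. 0)" using assms by auto
  then show ?thesis by (simp only: conv_def Bochner_Integration.integral_zero)
qed

lemma conv_neg:
  assumes "\<And>x. x < 0 \<Longrightarrow> k x = 0" "\<And>x. x < 0 \<Longrightarrow> g x = 0" "t < 0"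
  shows "conv k g t = 0"
  using assms by (intro conv_eq_0) (metis diff_less_0_iff_less order_less_le_trans not_less)

text \<open>Passes from the Lebesgue integral over [0,t] to a convolution over Borel functions. The
  integrand \<open>h\<close> is arbitrary off [0,t], so a Borel function \<open>h'\<close> that
  vanishes on the negative axis takes its place.\<close>

lemma rl_integral_eq_conv:
  assumes [measurable]: "h' \<in> borel_measurable borel"
    and eq: "\<And>s. 0 \<le> s \<Longrightarrow> s \<le> t \<Longrightarrow> h s = h' s" and neg: "\<And>s. s < 0 \<Longrightarrow> h' s = 0"
  shows "rl_integral b h t = conv (rl_kernel b) h' t"
proof -
  have *: "(\<lambda>s. indicator {0..t} s *\<^sub>R (t - s) powr (b - 1) *\<^sub>R h s) = (\<lambda>s. Gamma b *\<^sub>R rl_kernel b (t - s) *\<^sub>R h' s)"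
    if "Gamma b \<noteq> 0"
  proof
    fix s
    show "indicator {0..t} s *\<^sub>R (t - s) powr (b - 1) *\<^sub>R h s = Gamma b *\<^sub>R rl_kernel b (t - s) *\<^sub>R h' s"
      using eq[of s] neg[of s] that by (auto simp: rl_kernel_def indicator_def not_le)
  qed

  show ?thesis
  \<comment> \<open>In this case both sides contain a division by zero and are therefore 0.\<close>
  proof (cases "Gamma b = 0")
    case True
    then have "conv (rl_kernel b) h' t = 0" by (intro conv_eq_0) (simp add: rl_kernel_def)
    with True show ?thesis by (simp add: rl_integral_def)
  next
    case False
    have "rl_integral b h t = (1 / Gamma b) *\<^sub>R (\<integral>s. Gamma b *\<^sub>R rl_kernel b (t - s) *\<^sub>R h' s \<partial>lborel)"
      unfolding rl_integral_def set_lebesgue_integral_def *[OF False]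
      by (subst integral_completion) measurable
    also have "\<dots> = (1 / Gamma b) *\<^sub>R Gamma b *\<^sub>R conv (rl_kernel b) h' t"
      unfolding conv_def by (subst integral_scaleR_right) simp
    finally show ?thesis using False by simp
  qed
qed

lemma conv_one_eq_integral:
  fixes w :: "real \<Rightarrow> 'b::euclidean_space"
  assumes w: "continuous_on {0..t} w" and eq: "\<And>s. 0 \<le> s \<Longrightarrow> s \<le> t \<Longrightarrow> w' s = w s"
    and neg: "\<And>s. s < 0 \<Longrightarrow> w' s = 0" and [measurable]: "w' \<in> borel_measurable borel"
  shows "conv (rl_kernel 1) w' t = integral {0..t} w"
proof -
  have "set_integrable lborel {0..t} w" by (rule borel_integrable_atLeastAtMost'[OF w])
  then have "integral {0..t} w = (\<integral>s. indicator {0..t} s *\<^sub>R w s \<partial>lborel)"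
    using set_borel_integral_eq_integral(2)[of "{0..t}" w] by (simp add: set_lebesgue_integral_def)
  also have "\<dots> = (\<integral>s. indicator {0..t} s *\<^sub>R w' s \<partial>lborel)"
    by (intro Bochner_Integration.integral_cong) (auto simp: indicator_def eq)
  also have "\<dots> = conv (rl_kernel 1) w' t"
    unfolding conv_def
  proof (rule integral_cong_AE)
    show "AE s in lborel. indicator {0..t} s *\<^sub>R w' s = rl_kernel 1 (t - s) *\<^sub>R w' s"
      using AE_lborel_singleton[of t]
    proof (rule AE_mp, intro AE_I2 impI)
      fix s :: real assume "s \<noteq> t"
      then show "indicator {0..t} s *\<^sub>R w' s = rl_kernel 1 (t - s) *\<^sub>R w' s"
        using neg[of s] by (cases "s < 0") (auto simp: indicator_def rl_kernel_one)
    qed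
  qed measurable
  finally show ?thesis by simp
qed

section \<open>The scalar equation with an integrable forcing\<close>

lemma rl_kernel_mono:
  assumes "1 \<le> b" "x \<le> y"
  shows "rl_kernel b x \<le> rl_kernel b y"
  using assms Gamma_real_pos[of b] by (auto simp: rl_kernel_def intro!: divide_right_mono powr_mono2 divide_nonneg_pos)

lemma conv_scaleR_left: "conv (\<lambda>x. c * k x) g t = c *\<^sub>R conv k g t"
  unfolding conv_def by (simp flip: integral_scaleR_right)

lemma conv_scaleR_right: "conv k (\<lambda>x. c *\<^sub>R g x) t = c *\<^sub>R conv k g t"
  unfolding conv_def by (simp flip: integral_scaleR_right add: mult.commute)

text \<open>Here \<open>g\<close> stands for the derivative of a coefficient of f, and c for mu / (1
  + lam).\<close>

locale relaxation_forcing =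
  fixes a c :: real and g :: "real \<Rightarrow> 'b::{banach,second_countable_topology}"
  assumes a: "0 < a" "a < 1" and c: "c > 0"
    and g_int: "integrable lborel g" and g_neg: "\<And>s. s < 0 \<Longrightarrow> g s = 0"
begin

abbreviation "Y \<equiv> relaxation a c"
abbreviation "Z \<equiv> relaxation_defect a c"

lemmas Y_measurable[measurable] = relaxation_measurable[OF a, of c]
lemmas Z_measurable[measurable] = relaxation_defect_measurable[OF a c]
lemmas Z_bounds = relaxation_defect_nonneg[OF a c] relaxation_defect_le_1[OF a c]
lemmas Z_nonpos = relaxation_defect_nonpos[OF a c]
lemmas Y_bounds = relaxation_nonneg[OF a c] relaxation_le_1[OF a c]

lemma g_measurable[measurable]: "g \<in> borel_measurable borel"
  using g_int by (auto dest: borel_measurable_integrable)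

lemma integrable_bounded_mult:
  assumes [measurable]: "k \<in> borel_measurable borel" and "\<And>x. \<bar>k x\<bar> \<le> 1"
  shows "integrable lborel (\<lambda>s. k (t - s) *\<^sub>R g s)"
  by (rule Bochner_Integration.integrable_bound[OF g_int])
    (use assms(2) in \<open>auto intro!: mult_left_le_one_le\<close>)

text \<open>Two bounds on \<open>k\<close> with different tasks: the bound 1 gives integrability,
  while \<open>B\<close>, which may be small, gives the estimate on [0,t].\<close>

lemma norm_conv_le:
  assumes "k \<in> borel_measurable borel" and k: "\<And>x. \<bar>k x\<bar> \<le> 1"
    and le: "\<And>s. 0 \<le> s \<Longrightarrow> s \<le> t \<Longrightarrow> \<bar>k s\<bar> \<le> B" and "0 \<le> B" and neg: "\<And>x. x < 0 \<Longrightarrow> k x = 0"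
  shows "norm (conv k g t) \<le> B * (\<integral>s. norm (g s) \<partial>lborel)"
proof -
  have "norm (conv k g t) \<le> (\<integral>s. norm (k (t - s) *\<^sub>R g s) \<partial>lborel)"
    unfolding conv_def by (rule integral_norm_bound)
  also have "\<dots> \<le> (\<integral>s. B * norm (g s) \<partial>lborel)"
  proof (rule integral_mono)
    show "integrable lborel (\<lambda>s. norm (k (t - s) *\<^sub>R g s))"
      by (intro integrable_norm integrable_bounded_mult assms)
    show "integrable lborel (\<lambda>s. B * norm (g s))"
      by (intro integrable_mult_right integrable_norm g_int)
    fix s
    consider "s < 0" | "s > t" | "0 \<le> s" "s \<le> t" by linarith
    then show "norm (k (t - s) *\<^sub>R g s) \<le> B * norm (g s)"
      by cases (use le[of "t - s"] neg[of "t - s"] \<open>0 \<le> B\<close> in \<open>auto simp: g_neg intro!: mult_right_mono\<close>)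
  qed
  finally show ?thesis by simp
qed

lemma Z_abs_le: "\<bar>Z x\<bar> \<le> 1" and Y_abs_le: "\<bar>Y x\<bar> \<le> 1"
  using Z_bounds[of x] Y_bounds[of x] by auto

lemma conv_Z_nonpos: "t \<le> 0 \<Longrightarrow> conv Z g t = 0"
  using Z_nonpos g_neg by (intro conv_eq_0) (metis diff_le_0_iff_le order_trans not_less)

lemma conv_Y_neg: "t < 0 \<Longrightarrow> conv Y g t = 0"
  by (rule conv_neg) (simp_all add: relaxation_neg g_neg)

text \<open>Dominated convergence with majorant |g|; pointwise convergence holds at every
  \<open>s\<close> because \<open>Z\<close> has no jump at 0.\<close>

lemma continuous_conv_Z: "continuous_on UNIV (conv Z g)"
  unfolding continuous_on_sequentially
proof (intro allI ballI impI)
  fix X :: "nat \<Rightarrow> real" and x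
  assume X: "(\<forall>n. X n \<in> UNIV) \<and> X \<longlonglongrightarrow> x"
  have "(\<lambda>n. \<integral>s. Z (X n - s) *\<^sub>R g s \<partial>lborel) \<longlonglongrightarrow> (\<integral>s. Z (x - s) *\<^sub>R g s \<partial>lborel)"
  proof (rule integral_dominated_convergence)
    show "integrable lborel (\<lambda>s. norm (g s))" by (intro integrable_norm g_int)
    show "AE s in lborel. (\<lambda>n. Z (X n - s) *\<^sub>R g s) \<longlonglongrightarrow> Z (x - s) *\<^sub>R g s"
    proof (rule AE_I2)
      fix s
      have "(\<lambda>n. X n - s) \<longlonglongrightarrow> x - s" using X by (intro tendsto_intros) auto
      then have "(\<lambda>n. Z (X n - s)) \<longlonglongrightarrow> Z (x - s)"
        using continuous_relaxation_defect[OF a c] by (auto simp: continuous_on_sequentially o_def)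
      then show "(\<lambda>n. Z (X n - s) *\<^sub>R g s) \<longlonglongrightarrow> Z (x - s) *\<^sub>R g s" by (intro tendsto_intros)
    qed
    show "AE s in lborel. norm (Z (X n - s) *\<^sub>R g s) \<le> norm (g s)" for n
      using Z_abs_le by (auto intro!: mult_left_le_one_le)
  qed measurable
  then show "(conv Z g \<circ> X) \<longlonglongrightarrow> conv Z g x" by (simp add: o_def conv_def)
qed

text \<open>\<open>Y\<close> + \<open>Z\<close> is the indicator of the half-line [0,\<infinity>),
  and \<open>g\<close> vanishes before 0.\<close>

lemma conv_Y_plus_conv_Z:
  "conv Y g t + conv Z g t = (\<integral>s. indicator {0..t} s *\<^sub>R g s \<partial>lborel)"
proof -
  have "conv Y g t + conv Z g t = (\<integral>s. Y (t - s) *\<^sub>R g s + Z (t - s) *\<^sub>R g s \<partial>lborel)"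
    unfolding conv_def
    by (intro Bochner_Integration.integral_add[symmetric] integrable_bounded_mult Y_measurable Z_measurable Z_abs_le Y_abs_le)
  also have "\<dots> = (\<integral>s. indicator {0..t} s *\<^sub>R g s \<partial>lborel)"
  proof (rule Bochner_Integration.integral_cong[OF refl])
    fix s
    show "Y (t - s) *\<^sub>R g s + Z (t - s) *\<^sub>R g s = indicator {0..t} s *\<^sub>R g s"
      using g_neg[of s] by (cases "s < 0") (auto simp: relaxation_defect_def relaxation_neg indicator_def algebra_simps)
  qed
  finally show ?thesis .
qed

lemma integrable_rl_kernel_conv_le_one:
  assumes b: "b > 0" and k[measurable]: "k \<in> borel_measurable borel" and k1: "\<And>x. \<bar>k x\<bar> \<le> 1"
    and neg: "\<And>x. x < 0 \<Longrightarrow> k x = 0"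
  shows "integrable lborel (\<lambda>s. rl_kernel b (t - s) *\<^sub>R conv k g s)"
proof (rule Bochner_Integration.integrable_bound)
  let ?B = "\<integral>s. norm (g s) \<partial>lborel"
  show "(\<lambda>s. rl_kernel b (t - s) *\<^sub>R conv k g s) \<in> borel_measurable lborel" by measurable
  show "integrable lborel (\<lambda>s. ?B * (rl_kernel b (t - s) * rl_kernel 1 s))"
    by (intro integrable_mult_right integrable_rl_kernel_conv b) simp
  show "AE s in lborel. norm (rl_kernel b (t - s) *\<^sub>R conv k g s) \<le> norm (?B * (rl_kernel b (t - s) * rl_kernel 1 s))"
    using AE_lborel_singleton[of 0]
  proof (rule AE_mp, intro AE_I2 impI)
    fix s :: real assume "s \<noteq> 0"
    show "norm (rl_kernel b (t - s) *\<^sub>R conv k g s) \<le> norm (?B * (rl_kernel b (t - s) * rl_kernel 1 s))"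
    proof (cases "s < 0")
      case True
      then have "conv k g s = 0" by (intro conv_neg neg g_neg)
      then show ?thesis by simp
    next
      case False
      have "norm (conv k g s) \<le> ?B"
        using norm_conv_le[OF k k1, of s 1] k1 neg by auto
      then show ?thesis
        using False \<open>s \<noteq> 0\<close> by (simp add: rl_kernel_one abs_mult mult.commute[of ?B] mult_left_mono)
    qed
  qed
qed

lemma g_local_integrable: "integrable lborel (\<lambda>s. indicator {0..t} s *\<^sub>R g s)"
  by (intro integrable_mult_indicator g_int) auto

lemma conv_rl_kernel_le_one_assoc:
  assumes b: "b > 0" and k[measurable]: "k \<in> borel_measurable borel"
    and k1: "\<And>x. 0 \<le> k x \<and> k x \<le> 1"
    and neg: "\<And>x. x < 0 \<Longrightarrow> k x = 0"
    and int: "\<And>x. integrable lborel (\<lambda>s. rl_kernel b (x - s) * k s)"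
  shows "conv (rl_kernel b) (conv k g) t = conv (conv (rl_kernel b) k) g t"
proof (rule conv_assoc)
  \<comment> \<open>Off 0 the kernel \<open>k\<close> lies below \<open>rl_kernel 1\<close>. The
    resulting \<open>rl_kernel (b + 1) x\<close> increases in x because its index is at least 1,
    which makes the bound uniform for x <= t.\<close>
  show "(\<integral>s. \<bar>rl_kernel b (x - s) * k s\<bar> \<partial>lborel) \<le> rl_kernel (b + 1) t" if "x \<le> t" for x
  proof -
    have "(\<integral>s. \<bar>rl_kernel b (x - s) * k s\<bar> \<partial>lborel) \<le> (\<integral>s. rl_kernel b (x - s) * rl_kernel 1 s \<partial>lborel)"
    proof (rule integral_mono_AE)
      show "integrable lborel (\<lambda>s. \<bar>rl_kernel b (x - s) * k s\<bar>)" by (intro integrable_abs int)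
      show "integrable lborel (\<lambda>s. rl_kernel b (x - s) * rl_kernel 1 s)"
        by (intro integrable_rl_kernel_conv b) simp
      show "AE s in lborel. \<bar>rl_kernel b (x - s) * k s\<bar> \<le> rl_kernel b (x - s) * rl_kernel 1 s"
        using AE_lborel_singleton[of 0]
      proof (rule AE_mp, intro AE_I2 impI)
        fix s :: real assume "s \<noteq> 0"
        then have "k s \<le> rl_kernel 1 s" using k1[of s] neg[of s] by (auto simp: rl_kernel_one)
        then show "\<bar>rl_kernel b (x - s) * k s\<bar> \<le> rl_kernel b (x - s) * rl_kernel 1 s"
          using k1[of s] rl_kernel_nonneg[OF b, of "x - s"] by (simp add: abs_mult mult_left_mono)
      qed
    qed
    also have "\<dots> = rl_kernel (b + 1) x"
      using has_bochner_integral_rl_kernel[OF b, of 1 x] by (simp add: has_bochner_integral_iff)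
    also have "\<dots> \<le> rl_kernel (b + 1) t" using b that by (intro rl_kernel_mono) auto
    finally show ?thesis .
  qed
qed (use g_neg g_local_integrable int neg rl_kernel_nonpos_arg in auto)

text \<open>With \<open>G = f 0 - mu \<phi>\<close> and \<open>g = f'\<close>, the two functions below are \<open>mu (u - \<phi>)\<close> and \<open>f - mu u\<close>.\<close>
lemma conv_rl_kernel_solution:
  "conv (rl_kernel (1 - a)) (\<lambda>s. Z s *\<^sub>R G + conv Z g s) t
     = c *\<^sub>R conv (rl_kernel 1) (\<lambda>s. Y s *\<^sub>R G + conv Y g s) t"
proof -
  \<comment> \<open>Used for (1 - a, \<open>Z\<close>) and for (1, \<open>Y\<close>); between the
    two stands the identity I^(1-a) Z = c I^1 Y.\<close>
  have split: "conv (rl_kernel b) (\<lambda>s. k s *\<^sub>R G + conv k g s) t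
      = conv (rl_kernel b) k t *\<^sub>R G + conv (conv (rl_kernel b) k) g t"
    if "b > 0" "k \<in> borel_measurable borel" "\<And>x. 0 \<le> k x \<and> k x \<le> 1" "\<And>x. x < 0 \<Longrightarrow> k x = 0"
      "\<And>x. integrable lborel (\<lambda>s. rl_kernel b (x - s) * k s)" for b k
  proof -
    have "integrable lborel (\<lambda>s. rl_kernel b (t - s) *\<^sub>R conv k g s)"
      by (rule integrable_rl_kernel_conv_le_one) (use that in \<open>auto simp: abs_le_iff intro: order_trans[of _ 0]\<close>)
    moreover have "integrable lborel (\<lambda>s. (rl_kernel b (t - s) * k s) *\<^sub>R G)"
      by (intro integrable_scaleR_left that)
    moreover have "(\<lambda>s. rl_kernel b (t - s) *\<^sub>R (k s *\<^sub>R G + conv k g s))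
        = (\<lambda>s. (rl_kernel b (t - s) * k s) *\<^sub>R G + rl_kernel b (t - s) *\<^sub>R conv k g s)"
      by (simp add: scaleR_add_right)
    ultimately have "conv (rl_kernel b) (\<lambda>s. k s *\<^sub>R G + conv k g s) t
        = (\<integral>s. rl_kernel b (t - s) * k s \<partial>lborel) *\<^sub>R G + conv (rl_kernel b) (conv k g) t"
      unfolding conv_def[of "rl_kernel b"] using that(5) by simp
    then show ?thesis
      using conv_rl_kernel_le_one_assoc[OF that] by (simp add: conv_def[of "rl_kernel b" k])
  qed
  have "conv (rl_kernel (1 - a)) (\<lambda>s. Z s *\<^sub>R G + conv Z g s) t
      = conv (rl_kernel (1 - a)) Z t *\<^sub>R G + conv (conv (rl_kernel (1 - a)) Z) g t"
    by (rule split) (use a Z_bounds Z_nonpos integrable_rl_kernel_defect[OF a c] in auto)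
  also have "\<dots> = c *\<^sub>R (conv (rl_kernel 1) Y t *\<^sub>R G + conv (conv (rl_kernel 1) Y) g t)"
    unfolding conv_relaxation_defect[OF a c] conv_scaleR_left by (simp add: scaleR_add_right)
  also have "conv (rl_kernel 1) Y t *\<^sub>R G + conv (conv (rl_kernel 1) Y) g t
      = conv (rl_kernel 1) (\<lambda>s. Y s *\<^sub>R G + conv Y g s) t"
    by (rule split[symmetric]) (use Y_bounds relaxation_neg integrable_rl_kernel_relaxation[OF a c] in auto)
  finally show ?thesis .
qed

end

text \<open>Applying \<open>I\<^sup>\<alpha>\<close> to the equation for the difference \<open>d\<close> of two solutions gives
  \<open>D = - c I\<^sup>\<alpha> D\<close> for \<open>D = I\<^sup>1 d\<close>; iterating this \<open>n\<close> times bounds \<open>D\<close> by a multiple of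
  \<open>c\<^sup>n t\<^bsup>\<alpha> n\<^esup> / \<Gamma> (\<alpha> n + 1)\<close>.\<close>
lemma fractional_homogeneous_unique:
  fixes d :: "real \<Rightarrow> 'b::euclidean_space"
  assumes a: "0 < a" "a < 1" and c: "c > 0" and T: "0 < T"
    and d: "continuous_on {0..T} d"
    and eq: "\<And>t. t \<in> {0..T} \<Longrightarrow> rl_integral (1 - a) d t = - c *\<^sub>R integral {0..t} d"
    and t: "t \<in> {0..T}"
  shows "d t = 0"
proof -
  define d' where "d' = (\<lambda>s. indicator {0..T} s *\<^sub>R d s)"
  have [measurable]: "d' \<in> borel_measurable borel"
    unfolding d'_def by (rule borel_measurable_continuous_on_indicator) (use d in auto)
  have d'_neg: "d' s = 0" if "s < 0" for s using that by (simp add: d'_def)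
  have d'_eq: "d' s = d s" if "0 \<le> s" "s \<le> T" for s using that by (simp add: d'_def)
  have d'_int: "integrable lborel d'"
    using borel_integrable_atLeastAtMost'[OF d] by (simp add: d'_def set_integrable_def)
  define D where "D = conv (rl_kernel 1) d'"
  have [measurable]: "D \<in> borel_measurable borel" unfolding D_def by measurable
  have D_eq: "D t = integral {0..t} d" if "t \<in> {0..T}" for t
    unfolding D_def
    by (rule conv_one_eq_integral)
      (use that in \<open>auto simp: d'_eq d'_neg intro: continuous_on_subset[OF d]\<close>)
  have D_neg: "D s = 0" if "s < 0" for s
    unfolding D_def using that by (intro conv_neg d'_neg) (auto simp: rl_kernel_nonpos_arg)
  \<comment> \<open>I^1 = I^a I^(1-a), and the inner integral is - c D by hypothesis.\<close>
  have fix_eq: "D t = - c *\<^sub>R conv (rl_kernel a) D t" if t: "t \<in> {0..T}" for t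
  proof -
    have k: "conv (rl_kernel a) (rl_kernel (1 - a)) = rl_kernel 1"
      using conv_rl_kernel[of a "1 - a"] a by simp
    have "D t = conv (conv (rl_kernel a) (rl_kernel (1 - a))) d' t" by (simp add: k D_def)
    also have "\<dots> = conv (rl_kernel a) (conv (rl_kernel (1 - a)) d') t"
    proof (rule conv_assoc[symmetric, where K=1])
      fix x :: real
      have "(\<integral>s. \<bar>rl_kernel a (x - s) * rl_kernel (1 - a) s\<bar> \<partial>lborel) = conv (rl_kernel a) (rl_kernel (1 - a)) x"
        using a by (simp add: conv_def abs_mult rl_kernel_nonneg)
      then show "(\<integral>s. \<bar>rl_kernel a (x - s) * rl_kernel (1 - a) s\<bar> \<partial>lborel) \<le> 1"
        by (simp add: k rl_kernel_one)
      show "integrable lborel (\<lambda>s. rl_kernel a (x - s) * rl_kernel (1 - a) s)"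
        using a by (intro integrable_rl_kernel_conv) auto
      show "integrable lborel (\<lambda>s. indicator {0..t} s *\<^sub>R d' s)"
        by (intro integrable_mult_indicator d'_int) auto
    qed (auto simp: rl_kernel_nonpos_arg d'_neg)
    also have "\<dots> = conv (rl_kernel a) (\<lambda>s. - c *\<^sub>R D s) t"
    proof (rule conv_cong)
      fix s assume s: "0 \<le> s" "s \<le> t"
      have "conv (rl_kernel (1 - a)) d' s = rl_integral (1 - a) d s"
        by (rule rl_integral_eq_conv[symmetric]) (use s t in \<open>auto simp: d'_eq d'_neg\<close>)
      then show "conv (rl_kernel (1 - a)) d' s = - c *\<^sub>R D s"
        using eq[of s] D_eq[of s] s t by simp
    next
      fix s :: real assume "s < 0"
      then show "conv (rl_kernel (1 - a)) d' s = 0"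
        by (intro conv_neg d'_neg) (auto simp: rl_kernel_nonpos_arg)
    qed (auto simp: rl_kernel_nonpos_arg D_neg)
    also have "\<dots> = - c *\<^sub>R conv (rl_kernel a) D t" by (rule conv_scaleR_right)
    finally show ?thesis .
  qed
  define K where "K = (\<integral>s. norm (d' s) \<partial>lborel)"
  have D_bound: "norm (D t) \<le> K" for t
  proof -
    have int: "integrable lborel (\<lambda>s. rl_kernel 1 (t - s) *\<^sub>R d' s)"
      by (rule Bochner_Integration.integrable_bound[OF d'_int]) (auto simp: rl_kernel_one)
    have "norm (D t) \<le> (\<integral>s. norm (rl_kernel 1 (t - s) *\<^sub>R d' s) \<partial>lborel)"
      unfolding D_def conv_def by (rule integral_norm_bound)
    also have "\<dots> \<le> K"
      unfolding K_def using int d'_int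
      by (intro integral_mono integrable_norm) (auto simp: rl_kernel_one)
    finally show ?thesis .
  qed
  have K0: "0 \<le> K" by (simp add: K_def)
  \<comment> \<open>Each application of I^a raises the index of the kernel by a, by the semigroup
    law; the iteration starts from the constant bound \<open>K\<close>.\<close>
  have iter: "norm (D t) \<le> K * (c ^ n * rl_kernel (a * real n + 1) t)" if "0 < t" "t \<le> T" for n t
    using that
  proof (induction n arbitrary: t)
    case 0
    then show ?case using D_bound[of t] by (simp add: rl_kernel_one)
  next
    case (Suc n)
    let ?b = "a * real n + 1"
    have b: "?b > 0" using a by (simp add: add_nonneg_pos)
    let ?h = "\<lambda>s. K * c ^ n * (rl_kernel a (t - s) * rl_kernel ?b s)"
    have h: "has_bochner_integral lborel ?h (K * c ^ n * rl_kernel (a + ?b) t)"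
      by (intro has_bochner_integral_mult_right has_bochner_integral_rl_kernel a b)
    have ae: "AE s in lborel. norm (rl_kernel a (t - s) *\<^sub>R D s) \<le> ?h s"
      using AE_lborel_singleton[of 0]
    proof (rule AE_mp, intro AE_I2 impI)
      fix s :: real assume "s \<noteq> 0"
      consider "s < 0" | "t \<le> s" | "0 < s" "s < t" using \<open>s \<noteq> 0\<close> by linarith
      then show "norm (rl_kernel a (t - s) *\<^sub>R D s) \<le> ?h s"
      proof cases
        case 3
        then have "norm (D s) \<le> K * (c ^ n * rl_kernel ?b s)" using Suc by (intro Suc.IH) auto
        then have "rl_kernel a (t - s) * norm (D s) \<le> rl_kernel a (t - s) * (K * (c ^ n * rl_kernel ?b s))"
          using rl_kernel_nonneg[OF a(1)] by (intro mult_left_mono)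
        then show ?thesis using rl_kernel_nonneg[OF a(1), of "t - s"] by (simp add: mult_ac)
      qed (simp_all add: D_neg rl_kernel_nonpos_arg)
    qed
    have "norm (conv (rl_kernel a) D t) \<le> (\<integral>s. norm (rl_kernel a (t - s) *\<^sub>R D s) \<partial>lborel)"
      unfolding conv_def by (rule integral_norm_bound)
    also have "\<dots> \<le> integral\<^sup>L lborel ?h"
    proof (rule integral_mono_AE)
      show h': "integrable lborel ?h" using h by (simp add: has_bochner_integral_iff)
      show "integrable lborel (\<lambda>s. norm (rl_kernel a (t - s) *\<^sub>R D s))"
        by (rule Bochner_Integration.integrable_bound[OF h']) (use ae in auto)
    qed (rule ae)
    also have "\<dots> = K * c ^ n * rl_kernel (a * real (Suc n) + 1) t"
      using h by (simp add: has_bochner_integral_iff algebra_simps)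
    finally have "c * norm (conv (rl_kernel a) D t) \<le> c * (K * c ^ n * rl_kernel (a * real (Suc n) + 1) t)"
      using c by (intro mult_left_mono) auto
    moreover have "norm (D t) = c * norm (conv (rl_kernel a) D t)"
      using fix_eq[of t] Suc c by simp
    ultimately show ?case by (simp add: mult_ac)
  qed
  have D0: "D t = 0" if "t \<in> {0..T}" for t
  proof (cases "t = 0")
    case True
    then show ?thesis using D_eq[of 0] T by simp
  next
    case False
    \<comment> \<open>These are the terms of a convergent Mittag-Leffler series.\<close>
    have "(\<lambda>n. \<bar>c ^ n * rl_kernel (a * real n + 1) t\<bar>) \<longlonglongrightarrow> 0"
      using False that by (intro summable_LIMSEQ_zero summable_rl_kernel a) auto
    then have "(\<lambda>n. K * \<bar>c ^ n * rl_kernel (a * real n + 1) t\<bar>) \<longlonglongrightarrow> K * 0"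
      by (intro tendsto_intros)
    moreover have "norm (D t) \<le> K * \<bar>c ^ n * rl_kernel (a * real n + 1) t\<bar>" for n
      using iter[of t n] False that K0 by (smt (verit, best) atLeastAtMost_iff mult_left_mono)
    ultimately have "norm (D t) \<le> K * 0" by (intro LIMSEQ_le_const) auto
    then show ?thesis by simp
  qed
  \<comment> \<open>As \<open>d\<close> is continuous, it is the derivative of its own integral D =
    0.\<close>
  have "((\<lambda>u. integral {0..u} d) has_vector_derivative d t) (at t within {0..T})"
    using integral_has_vector_derivative[OF d t] .
  then have "((\<lambda>u. 0) has_vector_derivative d t) (at t within {0..T})"
    by (rule has_vector_derivative_transform[OF t, rotated]) (use D0 D_eq in auto)
  moreover have "((\<lambda>u. 0) has_vector_derivative (0::'b)) (at t within {0..T})"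
    by (rule has_vector_derivative_const)
  ultimately show "d t = 0"
    using T t by (metis islimpt_Icc trivial_limit_within vector_derivative_unique_within)
qed

section \<open>Caputo derivatives of vector-valued functions\<close>

lemma L2_on_continuous:
  fixes g :: "real \<Rightarrow> 'b::{banach,second_countable_topology}"
  assumes g: "continuous_on {0..T} g"
  shows "L2_on T g"
  unfolding L2_on_def
proof
  have "(\<lambda>t. indicator {0..T} t *\<^sub>R g t) \<in> borel_measurable borel"
    by (rule borel_measurable_continuous_on_indicator) (use g in auto)
  then show "g \<in> borel_measurable (lebesgue_on {0..T})"
    by (subst borel_measurable_restrict_space_iff) (auto intro: measurable_completion)
  have "(\<lambda>t. (norm (g t))\<^sup>2) absolutely_integrable_on {0..T}"
    by (intro absolutely_integrable_continuous_real continuous_intros g)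
  then show "integrable (lebesgue_on {0..T}) (\<lambda>t. (norm (g t))\<^sup>2)"
    by (simp add: integrable_restrict_space set_integrable_def)
qed

text \<open>The Caputo derivative is a two-sided derivative, so its values at 0 and T depend on the
  primitive outside [0,T]; two points form a null set.\<close>

lemma L2_on_cong_interior:
  fixes g :: "real \<Rightarrow> 'b::{banach,second_countable_topology}"
  assumes g: "L2_on T g" and eq: "\<And>t. 0 < t \<Longrightarrow> t < T \<Longrightarrow> h t = g t"
  shows "L2_on T h"
proof -
  have eq': "g t = h t" if "t \<in> space (lebesgue_on {0..T})" "t \<notin> {0, T} \<inter> {0..T}" for t
    using that by (intro eq[symmetric]) auto
  have null: "emeasure (lebesgue_on {0..T}) {x} = 0" if "x \<in> {0, T} \<inter> {0..T}" for x
    using that by (subst emeasure_restrict_space) auto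
  have cnt: "countable ({0, T} \<inter> {0..T})" by (intro countable_finite) simp
  have sets: "{x} \<in> sets (lebesgue_on {0..T})" if "x \<in> {0, T} \<inter> {0..T}" for x
    using that by (auto simp: sets_restrict_space_iff)
  show ?thesis
    unfolding L2_on_def
  proof
    show "h \<in> borel_measurable (lebesgue_on {0..T})"
    proof (rule measurable_discrete_difference[OF _ cnt sets _ eq'])
      show "g \<in> borel_measurable (lebesgue_on {0..T})" using g by (simp add: L2_on_def)
      show "h x \<in> space borel" for x by simp
    qed
    have "integrable (lebesgue_on {0..T}) (\<lambda>t. (norm (g t))\<^sup>2) \<longleftrightarrow> integrable (lebesgue_on {0..T}) (\<lambda>t. (norm (h t))\<^sup>2)"
    proof (rule integrable_discrete_difference[OF cnt null sets])
      fix t assume "t \<in> space (lebesgue_on {0..T})" "t \<notin> {0, T} \<inter> {0..T}"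
      from eq'[OF this] show "(norm (g t))\<^sup>2 = (norm (h t))\<^sup>2" by simp
    qed
    then show "integrable (lebesgue_on {0..T}) (\<lambda>t. (norm (h t))\<^sup>2)"
      using g by (simp add: L2_on_def)
  qed
qed

lemma lipschitz_imp_absolutely_continuous_fun:
  assumes "\<And>x y. a \<le> x \<Longrightarrow> x \<le> y \<Longrightarrow> y \<le> b \<Longrightarrow> norm (g y - g x) \<le> B * (y - x)" and "0 \<le> B"
  shows "absolutely_continuous_fun a b g"
  unfolding absolutely_continuous_fun_def
proof (intro allI impI)
  fix \<epsilon> :: real assume "\<epsilon> > 0"
  show "\<exists>\<delta>>0. \<forall>(n::nat) p q.
        (\<forall>i<n. a \<le> p i \<and> p i \<le> q i \<and> q i \<le> b) \<and>
        disjoint_family_on (\<lambda>i. {p i<..<q i}) {..<n} \<and>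
        (\<Sum>i<n. q i - p i) < \<delta> \<longrightarrow>
        (\<Sum>i<n. norm (g (q i) - g (p i))) < \<epsilon>"
  proof (intro exI[of _ "\<epsilon> / (B + 1)"] conjI allI impI)
    show "\<epsilon> / (B + 1) > 0" using \<open>\<epsilon> > 0\<close> \<open>0 \<le> B\<close> by simp
    fix n :: nat and p q
    assume *: "(\<forall>i<n. a \<le> p i \<and> p i \<le> q i \<and> q i \<le> b) \<and>
        disjoint_family_on (\<lambda>i. {p i<..<q i}) {..<n} \<and> (\<Sum>i<n. q i - p i) < \<epsilon> / (B + 1)"
    have "(\<Sum>i<n. norm (g (q i) - g (p i))) \<le> (\<Sum>i<n. B * (q i - p i))"
      using * assms(1) by (intro sum_mono) auto
    also have "\<dots> \<le> (\<Sum>i<n. (B + 1) * (q i - p i))"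
      using * by (intro sum_mono mult_right_mono) auto
    also have "\<dots> = (B + 1) * (\<Sum>i<n. q i - p i)" by (simp add: sum_distrib_left)
    also have "\<dots> < (B + 1) * (\<epsilon> / (B + 1))"
      using * \<open>0 \<le> B\<close> by (intro mult_strict_left_mono) auto
    finally show "(\<Sum>i<n. norm (g (q i) - g (p i))) < \<epsilon>" using \<open>0 \<le> B\<close> by simp
  qed
qed

text \<open>Continuity of \<open>w\<close> makes the primitive Lipschitz, hence absolutely
  continuous, and differentiable at every interior time. All regularity of the constructed solution
  is obtained from this criterion.\<close>

lemma caputo_if_primitive_eq_integral:
  fixes P w :: "real \<Rightarrow> 'b::{banach,second_countable_topology}"
  assumes T: "0 < T" and P: "continuous_on {0..T} P" and w: "continuous_on {0..T} w"
    and eq: "\<And>t. t \<in> {0..T} \<Longrightarrow> caputo_primitive a P t = integral {0..t} w"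
  shows "caputo_differentiable a T P"
    and "W_on a T P"
    and "\<And>t. 0 < t \<Longrightarrow> t < T \<Longrightarrow> caputo a P t = w t"
proof -
  have der: "(caputo_primitive a P has_vector_derivative w t) (at t)" if t: "0 < t" "t < T" for t
  proof -
    have "((\<lambda>u. integral {0..u} w) has_vector_derivative w t) (at t within {0..T})"
      using integral_has_vector_derivative[OF w, of t] t by simp
    then have "(caputo_primitive a P has_vector_derivative w t) (at t within {0..T})"
      by (rule has_vector_derivative_transform[rotated 2]) (use t eq in auto)
    then show ?thesis using t by (simp add: at_within_Icc_at)
  qed
  then show cap: "caputo a P t = w t" if "0 < t" "t < T" for t
    using that by (simp add: caputo_def vector_derivative_at)
  have "bounded (w ` {0..T})" using w by (intro compact_imp_bounded compact_continuous_image) auto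
  then obtain B where B: "\<And>t. t \<in> {0..T} \<Longrightarrow> norm (w t) \<le> B" "B > 0"
    unfolding bounded_pos by blast
  have ac: "absolutely_continuous_fun 0 T (caputo_primitive a P)"
  proof (rule lipschitz_imp_absolutely_continuous_fun)
    fix x y assume xy: "0 \<le> x" "x \<le> y" "y \<le> T"
    have "integral {0..x} w + integral {x..y} w = integral {0..y} w"
      using xy by (intro Henstock_Kurzweil_Integration.integral_combine integrable_continuous_real continuous_on_subset[OF w]) auto
    then have "caputo_primitive a P y - caputo_primitive a P x = integral {x..y} w"
      using eq[of x] eq[of y] xy by (simp add: algebra_simps)
    also have "norm \<dots> \<le> B * (y - x)"
      using xy B by (intro integral_bound continuous_on_subset[OF w]) auto
    finally show "norm (caputo_primitive a P y - caputo_primitive a P x) \<le> B * (y - x)" .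
  qed (use B in auto)
  have "AE t in lebesgue. t \<noteq> 0 \<and> t \<noteq> T"
    using AE_completion[OF AE_lborel_singleton[of 0]] AE_completion[OF AE_lborel_singleton[of T]] by auto
  then have "AE t in lebesgue. t \<in> {0..T} \<longrightarrow> caputo_primitive a P differentiable (at t)"
  proof eventually_elim
    case (elim t)
    show ?case
    proof
      assume "t \<in> {0..T}"
      with elim have "0 < t" "t < T" by auto
      from der[OF this] show "caputo_primitive a P differentiable (at t)"
        by (rule differentiableI_vector)
    qed
  qed
  then have ae: "AE t in lebesgue_on {0..T}. caputo_primitive a P differentiable (at t)"
    by (subst AE_restrict_space_iff) auto
  show cd: "caputo_differentiable a T P"
    unfolding caputo_differentiable_def using P ac ae by blast
  show "W_on a T P"
    unfolding W_on_def
    using L2_on_continuous[OF P] cd L2_on_cong_interior[OF L2_on_continuous[OF w] cap] by blast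
qed

text \<open>Continuity bounds \<open>h\<close> on the compact interval, which makes the integrand
  Bochner integrable against the singular kernel; \<open>A\<close> then passes under the
  integral.\<close>

lemma bounded_linear_rl_integral:
  fixes h :: "real \<Rightarrow> 'b::{banach,second_countable_topology}"
    and A :: "'b \<Rightarrow> 'c::{banach,second_countable_topology}"
  assumes A: "bounded_linear A" and h: "continuous_on {0..t} h" and b: "0 < b"
  shows "A (rl_integral b h t) = rl_integral b (\<lambda>s. A (h s)) t"
proof -
  interpret A: bounded_linear A by fact
  define h' where "h' = (\<lambda>s. indicator {0..t} s *\<^sub>R h s)"
  have m[measurable]: "h' \<in> borel_measurable borel"
    unfolding h'_def by (rule borel_measurable_continuous_on_indicator) (use h in auto)
  have "bounded (h ` {0..t})" using h by (intro compact_imp_bounded compact_continuous_image) auto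
  then obtain B where B: "\<And>s. s \<in> {0..t} \<Longrightarrow> norm (h s) \<le> B" "B > 0"
    unfolding bounded_pos by blast
  have Ah: "A (h' s) = indicator {0..t} s *\<^sub>R A (h s)" for s by (simp add: h'_def A.scaleR)
  have [measurable]: "(\<lambda>s. A (h' s)) \<in> borel_measurable borel"
    by (rule borel_measurable_continuous_on[OF A.continuous_on[OF continuous_on_id] m])
  have int: "integrable lborel (\<lambda>s. rl_kernel b (t - s) *\<^sub>R h' s)"
  proof (rule Bochner_Integration.integrable_bound)
    show "integrable lborel (\<lambda>s. B * (rl_kernel b (t - s) * rl_kernel 1 s))"
      by (intro integrable_mult_right integrable_rl_kernel_conv b) simp
    show "AE s in lborel. norm (rl_kernel b (t - s) *\<^sub>R h' s) \<le> norm (B * (rl_kernel b (t - s) * rl_kernel 1 s))"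
      using AE_lborel_singleton[of 0]
    proof (rule AE_mp, intro AE_I2 impI)
      fix s :: real assume "s \<noteq> 0"
      have "norm (h' s) \<le> B * rl_kernel 1 s"
        using \<open>s \<noteq> 0\<close> B(1)[of s] B(2) by (auto simp: h'_def rl_kernel_one indicator_def)
      then have "rl_kernel b (t - s) * norm (h' s) \<le> rl_kernel b (t - s) * (B * rl_kernel 1 s)"
        using rl_kernel_nonneg[OF b] by (intro mult_left_mono)
      then show "norm (rl_kernel b (t - s) *\<^sub>R h' s) \<le> norm (B * (rl_kernel b (t - s) * rl_kernel 1 s))"
        using rl_kernel_nonneg[OF b, of "t - s"] rl_kernel_nonneg[of 1 s] B(2)
        by (simp add: mult_ac)
    qed
  qed measurable
  have "A (rl_integral b h t) = A (conv (rl_kernel b) h' t)"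
    by (subst rl_integral_eq_conv[of h']) (auto simp: h'_def[THEN fun_cong])
  also have "\<dots> = conv (rl_kernel b) (\<lambda>s. A (h' s)) t"
    unfolding conv_def using integral_bounded_linear[OF A int] by (simp add: A.scaleR)
  also have "\<dots> = rl_integral b (\<lambda>s. A (h s)) t"
  proof (rule rl_integral_eq_conv[symmetric])
    show "(\<lambda>s. A (h' s)) \<in> borel_measurable borel" by measurable
  qed (simp_all add: Ah)
  finally show ?thesis .
qed

lemma absolutely_continuous_fun_bounded_linear:
  assumes A: "bounded_linear A" and ac: "absolutely_continuous_fun a b g"
  shows "absolutely_continuous_fun a b (\<lambda>t. A (g t))"
  unfolding absolutely_continuous_fun_def
proof (intro allI impI)
  interpret A: bounded_linear A by fact
  fix \<epsilon> :: real assume "\<epsilon> > 0"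
  obtain K where K: "K > 0" "\<And>x. norm (A x) \<le> norm x * K" using A.pos_bounded by blast
  have "\<epsilon> / K > 0" using K \<open>\<epsilon> > 0\<close> by simp
  from ac[unfolded absolutely_continuous_fun_def, rule_format, OF this]
  obtain \<delta> where \<delta>: "\<delta> > 0" "\<And>(n::nat) p q. (\<forall>i<n. a \<le> p i \<and> p i \<le> q i \<and> q i \<le> b) \<and>
        disjoint_family_on (\<lambda>i. {p i<..<q i}) {..<n} \<and> (\<Sum>i<n. q i - p i) < \<delta> \<Longrightarrow>
        (\<Sum>i<n. norm (g (q i) - g (p i))) < \<epsilon> / K" by blast
  show "\<exists>\<delta>>0. \<forall>(n::nat) p q.
        (\<forall>i<n. a \<le> p i \<and> p i \<le> q i \<and> q i \<le> b) \<and>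
        disjoint_family_on (\<lambda>i. {p i<..<q i}) {..<n} \<and>
        (\<Sum>i<n. q i - p i) < \<delta> \<longrightarrow>
        (\<Sum>i<n. norm (A (g (q i)) - A (g (p i)))) < \<epsilon>"
  proof (intro exI[of _ \<delta>] conjI allI impI \<delta>(1))
    fix n :: nat and p q
    assume *: "(\<forall>i<n. a \<le> p i \<and> p i \<le> q i \<and> q i \<le> b) \<and>
        disjoint_family_on (\<lambda>i. {p i<..<q i}) {..<n} \<and> (\<Sum>i<n. q i - p i) < \<delta>"
    have "(\<Sum>i<n. norm (A (g (q i)) - A (g (p i)))) \<le> (\<Sum>i<n. norm (g (q i) - g (p i)) * K)"
      by (intro sum_mono) (simp flip: A.diff add: K)
    also have "\<dots> = (\<Sum>i<n. norm (g (q i) - g (p i))) * K" by (simp add: sum_distrib_right)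
    also have "\<dots> < \<epsilon> / K * K" using \<delta>(2)[OF *] K by (intro mult_strict_right_mono) auto
    finally show "(\<Sum>i<n. norm (A (g (q i)) - A (g (p i)))) < \<epsilon>" using K by simp
  qed
qed

lemma absolutely_continuous_fun_subset:
  assumes "absolutely_continuous_fun a b g" "a \<le> a'" "b' \<le> b"
  shows "absolutely_continuous_fun a' b' g"
  using assms unfolding absolutely_continuous_fun_def by (meson order_trans)

text \<open>Meant for A = ip _ (e \<xi>): both absolute continuity and derivatives pass through
  \<open>A\<close>. The endpoints join the exceptional null set because the hypothesis speaks of the
  open interval only.\<close>

lemma bounded_linear_has_integral_derivative:
  fixes g :: "real \<Rightarrow> 'b::{banach,second_countable_topology}" and A :: "'b \<Rightarrow> 'c::banach"
  assumes A: "bounded_linear A" and t: "t \<in> {0..T}"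
    and ac: "absolutely_continuous_fun 0 T g"
    and ae: "AE x in lebesgue_on {0<..<T}. g differentiable (at x) \<and> A (vector_derivative g (at x)) = w x"
  shows "(w has_integral (A (g t) - A (g 0))) {0..t}"
proof -
  have "AE x in lebesgue. x \<in> {0<..<T} \<longrightarrow> g differentiable (at x) \<and> A (vector_derivative g (at x)) = w x"
    using ae by (subst (asm) AE_restrict_space_iff) auto
  then obtain N where N: "negligible N"
      "\<And>x. x \<in> {0<..<T} \<Longrightarrow> x \<notin> N \<Longrightarrow> g differentiable (at x) \<and> A (vector_derivative g (at x)) = w x"
    by (auto simp: eventually_ae_filter_negligible)
  show ?thesis
  proof (rule absolutely_continuous_has_integral)
    show "absolutely_continuous_fun 0 t (\<lambda>t. A (g t))"
      using absolutely_continuous_fun_subset[OF absolutely_continuous_fun_bounded_linear[OF A ac], of 0 t] t by auto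
    show "negligible (N \<union> {0, T})" using N(1) by auto
    fix x assume "x \<in> {0..t} - (N \<union> {0, T})"
    then have x: "x \<in> {0<..<T}" "x \<notin> N" using t by auto
    then have "(g has_vector_derivative vector_derivative g (at x)) (at x)"
      using N(2)[OF x] by (simp add: vector_derivative_works)
    from bounded_linear.has_vector_derivative[OF A this] N(2)[OF x]
    show "((\<lambda>t. A (g t)) has_vector_derivative w x) (at x within {0..t})"
      by (auto intro: has_vector_derivative_at_within)
  qed (use t in auto)
qed

text \<open>Componentwise in an orthonormal basis of the range. The convolutions are built on Borel
  functions, whereas f' is given as a Lebesgue measurable function.\<close>

lemma lebesgue_measurable_ex_borel:
  fixes F :: "'n::euclidean_space \<Rightarrow> 'b::euclidean_space"
  assumes "F \<in> borel_measurable lebesgue"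
  obtains g where "g \<in> borel_measurable borel" "AE x in lebesgue. F x = g x"
proof -
  have "\<exists>h\<in>borel_measurable lborel. AE x in lborel. inner (F x) b = (h x :: real)" for b
    by (rule completion_ex_borel_measurable_real) (use assms in measurable)
  then obtain h where h: "\<And>b. h b \<in> borel_measurable borel" "\<And>b. AE x in lborel. inner (F x) b = h b x"
    by simp metis
  show thesis
  proof
    show "(\<lambda>x. \<Sum>b\<in>Basis. h b x *\<^sub>R b) \<in> borel_measurable borel"
      using h(1) by measurable
    have "AE x in lborel. \<forall>b\<in>Basis. inner (F x) b = h b x"
      using h(2) by (intro AE_finite_allI) auto
    then show "AE x in lebesgue. F x = (\<Sum>b\<in>Basis. h b x *\<^sub>R b)"
      by (intro AE_completion) (auto elim!: eventually_mono simp: euclidean_representation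
          intro!: trans[OF euclidean_representation[symmetric] sum.cong])
  qed
qed

lemma square_summable_add:
  fixes a b :: "'i \<Rightarrow> real"
  assumes "(\<lambda>\<xi>. (a \<xi>)\<^sup>2) summable_on I" "(\<lambda>\<xi>. (b \<xi>)\<^sup>2) summable_on I"
  shows "(\<lambda>\<xi>. (a \<xi> + b \<xi>)\<^sup>2) summable_on I"
proof (rule summable_on_comparison_test)
  show "(\<lambda>\<xi>. 2 * (a \<xi>)\<^sup>2 + 2 * (b \<xi>)\<^sup>2) summable_on I"
    by (intro summable_on_add summable_on_cmult_right assms)
  show "(a \<xi> + b \<xi>)\<^sup>2 \<le> 2 * (a \<xi>)\<^sup>2 + 2 * (b \<xi>)\<^sup>2" for \<xi>
    using zero_le_power2[of "a \<xi> - b \<xi>"] by (simp add: power2_eq_square algebra_simps)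
qed simp

lemma square_summable_cmult:
  fixes a :: "'i \<Rightarrow> real"
  assumes "(\<lambda>\<xi>. (a \<xi>)\<^sup>2) summable_on I"
  shows "(\<lambda>\<xi>. (k * a \<xi>)\<^sup>2) summable_on I"
  unfolding power_mult_distrib by (intro summable_on_cmult_right assms)

section \<open>The solution\<close>

lemma rl_integral_cong:
  assumes "\<And>s. 0 \<le> s \<Longrightarrow> s \<le> t \<Longrightarrow> h s = k s"
  shows "rl_integral b h t = rl_integral b k t"
proof -
  have "(\<lambda>s. indicator {0..t} s *\<^sub>R (t - s) powr (b - 1) *\<^sub>R h s) = (\<lambda>s. indicator {0..t} s *\<^sub>R (t - s) powr (b - 1) *\<^sub>R k s)"
    by (auto simp: fun_eq_iff indicator_def assms)
  then show ?thesis by (simp only: rl_integral_def set_lebesgue_integral_def)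
qed

lemma rl_integral_scaleR: "rl_integral b (\<lambda>s. r *\<^sub>R h s) t = r *\<^sub>R rl_integral b h t"
  unfolding rl_integral_def set_lebesgue_integral_def
  by (simp flip: integral_scaleR_right add: mult_ac)

text \<open>\<open>g \<xi>\<close> is a Borel representative of the derivative of \<open>\<lambda>t. ip (f t) (e \<xi>)\<close>, extended by zero.\<close>
locale pseudo_parabolic = hilbert_basis sc ip I e
  for sc :: "'k::{real_normed_field,euclidean_space}
      \<Rightarrow> 'a::{real_inner,banach,second_countable_topology} \<Rightarrow> 'a"
    and ip :: "'a \<Rightarrow> 'a \<Rightarrow> 'k" and I :: "'i set" and e :: "'i \<Rightarrow> 'a" +
  fixes lam mu :: "'i \<Rightarrow> real" and \<alpha> T m :: real and \<phi> :: 'a and f :: "real \<Rightarrow> 'a"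
    and g :: "'i \<Rightarrow> real \<Rightarrow> 'k"
  assumes \<alpha>: "0 < \<alpha>" "\<alpha> < 1" and T: "0 < T"
    and lam_pos: "\<And>\<xi>. \<xi> \<in> I \<Longrightarrow> 0 < lam \<xi>"
    and m_pos: "0 < m" and mu_ge: "\<And>\<xi>. \<xi> \<in> I \<Longrightarrow> m \<le> mu \<xi>"
    and \<phi>_lam: "(\<lambda>\<xi>. (lam \<xi> * norm (ip \<phi> (e \<xi>)))\<^sup>2) summable_on I"
    and \<phi>_mu: "(\<lambda>\<xi>. (mu \<xi> * norm (ip \<phi> (e \<xi>)))\<^sup>2) summable_on I"
    and f_cont: "continuous_on {0..T} f"
    and g_int: "\<And>\<xi>. \<xi> \<in> I \<Longrightarrow> integrable lborel (g \<xi>)"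
    and g_neg: "\<And>\<xi> s. \<xi> \<in> I \<Longrightarrow> s < 0 \<Longrightarrow> g \<xi> s = 0"
    and g_primitive: "\<And>\<xi> t. \<xi> \<in> I \<Longrightarrow> t \<in> {0..T} \<Longrightarrow>
      (\<integral>s. indicator {0..t} s *\<^sub>R g \<xi> s \<partial>lborel) = ip (f t) (e \<xi>) - ip (f 0) (e \<xi>)"
    and g_sum: "(\<lambda>\<xi>. (\<integral>s. norm (g \<xi> s) \<partial>lborel)\<^sup>2) summable_on I"
begin

definition rate :: "'i \<Rightarrow> real" where
  "rate \<xi> = mu \<xi> / (1 + lam \<xi>)"

text \<open>The value at time 0 of the coefficient of f - M u.\<close>

definition drive :: "'i \<Rightarrow> 'k" where
  "drive \<xi> = ip (f 0) (e \<xi>) - of_real (mu \<xi>) * ip \<phi> (e \<xi>)"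

text \<open>\<open>V \<xi>\<close> and \<open>W \<xi>\<close> are the coefficients of \<open>M (u - \<phi>)\<close> and \<open>f - M u\<close>.\<close>
definition V :: "'i \<Rightarrow> real \<Rightarrow> 'k" where
  "V \<xi> t = relaxation_defect \<alpha> (rate \<xi>) t *\<^sub>R drive \<xi> + conv (relaxation_defect \<alpha> (rate \<xi>)) (g \<xi>) t"

definition W :: "'i \<Rightarrow> real \<Rightarrow> 'k" where
  "W \<xi> t = relaxation \<alpha> (rate \<xi>) t *\<^sub>R drive \<xi> + conv (relaxation \<alpha> (rate \<xi>)) (g \<xi>) t"

text \<open>The coefficient in the formula of the theorem, regrouped: writing y as 1 minus the
  defect and f_xi as f_xi(0) plus the integral of its derivative collects everything but phi_xi in V
  / mu.\<close>

definition coef :: "'i \<Rightarrow> real \<Rightarrow> 'k" where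
  "coef \<xi> t = ip \<phi> (e \<xi>) + of_real (1 / mu \<xi>) * V \<xi> t"

definition amplitude :: "'i \<Rightarrow> real" where
  "amplitude \<xi> = norm (drive \<xi>) + (\<integral>s. norm (g \<xi> s) \<partial>lborel)"

definition sol :: "real \<Rightarrow> 'a" where
  "sol t = (\<Sum>\<^sub>\<infinity>\<xi>\<in>I. sc (coef \<xi> t) (e \<xi>))"

section \<open>Estimates for the coefficients, uniform in time\<close>

lemma mu_pos: "\<xi> \<in> I \<Longrightarrow> 0 < mu \<xi>"
  using m_pos mu_ge[of \<xi>] by simp

lemma rate_pos: "\<xi> \<in> I \<Longrightarrow> 0 < rate \<xi>"
  using lam_pos[of \<xi>] mu_pos[of \<xi>] by (simp add: rate_def)

lemma forcing: "\<xi> \<in> I \<Longrightarrow> relaxation_forcing \<alpha> (rate \<xi>) (g \<xi>)"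
  using \<alpha> rate_pos[of \<xi>] g_int[of \<xi>] g_neg[of \<xi>] by unfold_locales auto

lemma amplitude_nonneg: "0 \<le> amplitude \<xi>"
  by (simp add: amplitude_def)

lemma V_nonpos: "\<xi> \<in> I \<Longrightarrow> t \<le> 0 \<Longrightarrow> V \<xi> t = 0"
  using relaxation_defect_nonpos[OF \<alpha> rate_pos] relaxation_forcing.conv_Z_nonpos[OF forcing]
  by (simp add: V_def)

lemma W_neg: "\<xi> \<in> I \<Longrightarrow> t < 0 \<Longrightarrow> W \<xi> t = 0"
  using relaxation_forcing.conv_Y_neg[OF forcing] by (simp add: W_def relaxation_neg)

lemma W_plus_V:
  assumes \<xi>: "\<xi> \<in> I" and t: "t \<in> {0..T}"
  shows "W \<xi> t + V \<xi> t = drive \<xi> + (ip (f t) (e \<xi>) - ip (f 0) (e \<xi>))"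
proof -
  let ?Y = "relaxation \<alpha> (rate \<xi>)" and ?Z = "relaxation_defect \<alpha> (rate \<xi>)"
  have "?Y t + ?Z t = 1" using t by (simp add: relaxation_defect_def)
  then have "?Y t *\<^sub>R drive \<xi> + ?Z t *\<^sub>R drive \<xi> = drive \<xi>"
    by (simp flip: scaleR_add_left)
  then have "W \<xi> t + V \<xi> t = drive \<xi> + (conv ?Y (g \<xi>) t + conv ?Z (g \<xi>) t)"
    unfolding W_def V_def by (simp add: algebra_simps)
  then show ?thesis
    using relaxation_forcing.conv_Y_plus_conv_Z[OF forcing[OF \<xi>]] g_primitive[OF \<xi> t] by simp
qed

lemma W_eq:
  assumes \<xi>: "\<xi> \<in> I" and t: "t \<in> {0..T}"
  shows "W \<xi> t = ip (f t) (e \<xi>) - of_real (mu \<xi>) * coef \<xi> t"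
proof -
  have "W \<xi> t = ip (f t) (e \<xi>) - of_real (mu \<xi>) * ip \<phi> (e \<xi>) - V \<xi> t"
    using W_plus_V[OF \<xi> t] by (simp add: drive_def algebra_simps)
  moreover have "of_real (mu \<xi>) * coef \<xi> t = of_real (mu \<xi>) * ip \<phi> (e \<xi>) + V \<xi> t"
    using mu_pos[OF \<xi>] by (simp add: coef_def distrib_left)
  ultimately show ?thesis by simp
qed

text \<open>The common source of the estimates for \<open>V\<close> and \<open>W\<close>: B = 1 for
  both kernels, and a multiple of the rate for the defect.\<close>

lemma norm_conv_combination_le:
  assumes \<xi>: "\<xi> \<in> I" and k: "k \<in> borel_measurable borel" "\<And>x. 0 \<le> k x \<and> k x \<le> 1" "\<And>x. x < 0 \<Longrightarrow> k x = 0"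
    and B: "\<And>s. 0 \<le> s \<Longrightarrow> s \<le> t \<Longrightarrow> k s \<le> B" and t: "0 \<le> t"
  shows "norm (k t *\<^sub>R drive \<xi> + conv k (g \<xi>) t) \<le> B * amplitude \<xi>"
proof -
  have "0 \<le> B" using B[of t] k(2)[of t] t by linarith
  have "norm (conv k (g \<xi>) t) \<le> B * (\<integral>s. norm (g \<xi> s) \<partial>lborel)"
  proof (rule relaxation_forcing.norm_conv_le[OF forcing[OF \<xi>] k(1)])
    show "\<bar>k x\<bar> \<le> 1" for x using k(2)[of x] by simp
    show "\<bar>k s\<bar> \<le> B" if "0 \<le> s" "s \<le> t" for s using B[OF that] k(2)[of s] by simp
  qed (use k \<open>0 \<le> B\<close> in auto)
  moreover have "norm (k t *\<^sub>R drive \<xi>) \<le> B * norm (drive \<xi>)"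
    using B[of t] t k(2)[of t] by (simp add: mult_right_mono)
  ultimately show ?thesis
    unfolding amplitude_def distrib_left by (meson add_mono norm_triangle_le)
qed

lemma W_bound:
  assumes \<xi>: "\<xi> \<in> I" and t: "t \<in> {0..T}"
  shows "norm (W \<xi> t) \<le> amplitude \<xi>"
proof -
  have "norm (W \<xi> t) \<le> 1 * amplitude \<xi>"
    unfolding W_def
    by (rule norm_conv_combination_le[OF \<xi> relaxation_measurable[OF \<alpha>]])
      (use relaxation_nonneg[OF \<alpha> rate_pos[OF \<xi>]] relaxation_le_1[OF \<alpha> rate_pos[OF \<xi>]] t in \<open>auto simp: relaxation_neg\<close>)
  then show ?thesis by simp
qed

lemma V_bound:
  assumes \<xi>: "\<xi> \<in> I" and t: "t \<in> {0..T}"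
  shows "norm (V \<xi> t) \<le> amplitude \<xi>"
proof -
  have "norm (V \<xi> t) \<le> 1 * amplitude \<xi>"
    unfolding V_def
    by (rule norm_conv_combination_le[OF \<xi> relaxation_defect_measurable[OF \<alpha> rate_pos[OF \<xi>]]])
      (use relaxation_defect_nonneg[OF \<alpha> rate_pos[OF \<xi>]] relaxation_defect_le_1[OF \<alpha> rate_pos[OF \<xi>]]
        relaxation_defect_nonpos[OF \<alpha> rate_pos[OF \<xi>]] t in auto)
  then show ?thesis by simp
qed

text \<open>The factor \<open>rate \<xi>\<close> cancels the unbounded factor \<open>lam \<xi> / mu \<xi>\<close> in \<open>L u\<close>.\<close>
lemma V_bound_rate:
  assumes \<xi>: "\<xi> \<in> I" and t: "t \<in> {0..T}"
  shows "norm (V \<xi> t) \<le> rate \<xi> * (T powr \<alpha> / Gamma (\<alpha> + 1)) * amplitude \<xi>"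
  unfolding V_def
proof (rule norm_conv_combination_le[OF \<xi> relaxation_defect_measurable[OF \<alpha> rate_pos[OF \<xi>]]])
  fix s assume s: "0 \<le> s" "s \<le> t"
  have G: "Gamma (\<alpha> + 1) > 0" using \<alpha> by (intro Gamma_real_pos) auto
  have "relaxation_defect \<alpha> (rate \<xi>) s \<le> rate \<xi> * (s powr \<alpha> / Gamma (\<alpha> + 1))"
    by (rule relaxation_defect_le[OF \<alpha> rate_pos[OF \<xi>] s(1)])
  also have "\<dots> \<le> rate \<xi> * (T powr \<alpha> / Gamma (\<alpha> + 1))"
    using rate_pos[OF \<xi>] G s t \<alpha> by (intro mult_left_mono divide_right_mono powr_mono2) auto
  finally show "relaxation_defect \<alpha> (rate \<xi>) s \<le> rate \<xi> * (T powr \<alpha> / Gamma (\<alpha> + 1))" .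
qed (use relaxation_defect_nonneg[OF \<alpha> rate_pos[OF \<xi>]] relaxation_defect_le_1[OF \<alpha> rate_pos[OF \<xi>]]
        relaxation_defect_nonpos[OF \<alpha> rate_pos[OF \<xi>]] t in auto)

lemma V_cont:
  assumes \<xi>: "\<xi> \<in> I"
  shows "continuous_on UNIV (V \<xi>)"
  unfolding V_def[abs_def]
  by (intro continuous_intros continuous_relaxation_defect[OF \<alpha> rate_pos[OF \<xi>]]
      relaxation_forcing.continuous_conv_Z[OF forcing[OF \<xi>]])

lemma coef_cont: "\<xi> \<in> I \<Longrightarrow> continuous_on S (coef \<xi>)"
  unfolding coef_def[abs_def] by (intro continuous_intros continuous_on_subset[OF V_cont]) auto

text \<open>Read off from \<open>W_eq\<close>, since the kernel in the definition of
  \<open>W\<close> jumps at 0.\<close>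

lemma W_cont: "\<xi> \<in> I \<Longrightarrow> continuous_on {0..T} (W \<xi>)"
proof -
  assume \<xi>: "\<xi> \<in> I"
  have "continuous_on {0..T} (\<lambda>t. ip (f t) (e \<xi>) - of_real (mu \<xi>) * coef \<xi> t)"
    by (intro continuous_intros coef_cont[OF \<xi>] bounded_linear.continuous_on[OF bounded_linear_ip] f_cont)
  then show ?thesis by (rule continuous_on_eq) (simp add: W_eq[OF \<xi>])
qed

text \<open>Three sources: Bessel's inequality for f(0), membership of \<phi> in the domain of M,
  and \<open>g_sum\<close> for the derivative of f.\<close>

lemma square_summable_amplitude: "(\<lambda>\<xi>. (amplitude \<xi>)\<^sup>2) summable_on I"
proof (rule summable_on_comparison_test)
  show "(\<lambda>\<xi>. ((norm (ip (f 0) (e \<xi>)) + mu \<xi> * norm (ip \<phi> (e \<xi>))) + (\<integral>s. norm (g \<xi> s) \<partial>lborel))\<^sup>2) summable_on I"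
    by (intro square_summable_add summable_ip_basis \<phi>_mu g_sum)
  fix \<xi> assume \<xi>: "\<xi> \<in> I"
  have "norm (drive \<xi>) \<le> norm (ip (f 0) (e \<xi>)) + mu \<xi> * norm (ip \<phi> (e \<xi>))"
    unfolding drive_def using norm_triangle_ineq4[of "ip (f 0) (e \<xi>)" "of_real (mu \<xi>) * ip \<phi> (e \<xi>)"] mu_pos[OF \<xi>]
    by (simp add: norm_mult)
  then show "(amplitude \<xi>)\<^sup>2 \<le> ((norm (ip (f 0) (e \<xi>)) + mu \<xi> * norm (ip \<phi> (e \<xi>))) + (\<integral>s. norm (g \<xi> s) \<partial>lborel))\<^sup>2"
    using amplitude_nonneg[of \<xi>] by (intro power_mono) (auto simp: amplitude_def)
qed simp

definition majorant :: "'i \<Rightarrow> real" where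
  "majorant \<xi> = (norm (ip \<phi> (e \<xi>)) + lam \<xi> * norm (ip \<phi> (e \<xi>))) + T powr \<alpha> / Gamma (\<alpha> + 1) * amplitude \<xi>"

lemma square_summable_majorant: "(\<lambda>\<xi>. (majorant \<xi>)\<^sup>2) summable_on I"
  unfolding majorant_def
  by (intro square_summable_add square_summable_cmult summable_ip_basis \<phi>_lam square_summable_amplitude)

text \<open>Since rate / mu = 1 / (1 + lam), the bound \<open>V_bound_rate\<close> loses mu
  altogether and absorbs the factor 1 + lam.\<close>

lemma coef_lam_bound:
  assumes \<xi>: "\<xi> \<in> I" and t: "t \<in> {0..T}"
  shows "(1 + lam \<xi>) * norm (coef \<xi> t) \<le> majorant \<xi>"
proof -
  let ?C = "T powr \<alpha> / Gamma (\<alpha> + 1)"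
  have pos: "0 < mu \<xi>" "0 < 1 + lam \<xi>" using mu_pos[OF \<xi>] lam_pos[OF \<xi>] by auto
  have "norm (coef \<xi> t) \<le> norm (ip \<phi> (e \<xi>)) + norm (V \<xi> t) / mu \<xi>"
    unfolding coef_def using norm_triangle_ineq[of "ip \<phi> (e \<xi>)" "of_real (1 / mu \<xi>) * V \<xi> t"] pos
    by (simp add: norm_mult norm_divide)
  also have "\<dots> \<le> norm (ip \<phi> (e \<xi>)) + rate \<xi> * ?C * amplitude \<xi> / mu \<xi>"
    using V_bound_rate[OF \<xi> t] pos by (intro add_left_mono divide_right_mono) auto
  also have "\<dots> = norm (ip \<phi> (e \<xi>)) + ?C * amplitude \<xi> / (1 + lam \<xi>)"
    using pos by (simp add: rate_def)
  finally have "(1 + lam \<xi>) * norm (coef \<xi> t) \<le> (1 + lam \<xi>) * (norm (ip \<phi> (e \<xi>)) + ?C * amplitude \<xi> / (1 + lam \<xi>))"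
    using pos by (intro mult_left_mono) auto
  also have "\<dots> = majorant \<xi>"
  proof -
    have "(1 + lam \<xi>) * (x + y / (1 + lam \<xi>)) = (x + lam \<xi> * x) + y" for x y
      using pos by (simp add: field_simps)
    then show ?thesis by (simp only: majorant_def)
  qed
  finally show ?thesis .
qed

lemma coef_mu_bound:
  assumes \<xi>: "\<xi> \<in> I" and t: "t \<in> {0..T}"
  shows "mu \<xi> * norm (coef \<xi> t) \<le> mu \<xi> * norm (ip \<phi> (e \<xi>)) + amplitude \<xi>"
proof -
  have pos: "0 < mu \<xi>" by (rule mu_pos[OF \<xi>])
  have "norm (coef \<xi> t) \<le> norm (ip \<phi> (e \<xi>)) + norm (V \<xi> t) / mu \<xi>"
    unfolding coef_def using norm_triangle_ineq[of "ip \<phi> (e \<xi>)" "of_real (1 / mu \<xi>) * V \<xi> t"] pos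
    by (simp add: norm_mult norm_divide)
  also have "\<dots> \<le> norm (ip \<phi> (e \<xi>)) + amplitude \<xi> / mu \<xi>"
    using V_bound[OF \<xi> t] pos by (intro add_left_mono divide_right_mono) auto
  finally show ?thesis using pos by (simp add: field_simps)
qed

lemma coef_0: "\<xi> \<in> I \<Longrightarrow> coef \<xi> 0 = ip \<phi> (e \<xi>)"
  by (simp add: coef_def V_nonpos)

text \<open>The increment of \<open>coef\<close> is V / mu, and I^(1 - alpha) V is rate times I^1 W.
  With rate / mu = 1 / (1 + lam) this is the coefficient equation in integrated form.\<close>

lemma rl_integral_coef:
  assumes \<xi>: "\<xi> \<in> I" and t: "t \<in> {0..T}"
  shows "rl_integral (1 - \<alpha>) (\<lambda>s. coef \<xi> s - coef \<xi> 0) t = (1 / (1 + lam \<xi>)) *\<^sub>R integral {0..t} (W \<xi>)"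
proof -
  have [measurable]: "V \<xi> \<in> borel_measurable borel"
    by (rule borel_measurable_continuous_onI[OF V_cont[OF \<xi>]])
  note [measurable] = relaxation_measurable[OF \<alpha>] relaxation_forcing.g_measurable[OF forcing[OF \<xi>]]
  have [measurable]: "W \<xi> \<in> borel_measurable borel" unfolding W_def[abs_def] by measurable
  have "(\<lambda>s. coef \<xi> s - coef \<xi> 0) = (\<lambda>s. (1 / mu \<xi>) *\<^sub>R V \<xi> s)"
    using \<xi> by (simp add: coef_def V_nonpos scaleR_conv_of_real)
  then have "rl_integral (1 - \<alpha>) (\<lambda>s. coef \<xi> s - coef \<xi> 0) t = (1 / mu \<xi>) *\<^sub>R rl_integral (1 - \<alpha>) (V \<xi>) t"
    by (simp only: rl_integral_scaleR)
  also have "rl_integral (1 - \<alpha>) (V \<xi>) t = conv (rl_kernel (1 - \<alpha>)) (V \<xi>) t"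
    using \<xi> by (intro rl_integral_eq_conv) (auto simp: V_nonpos)
  also have "\<dots> = rate \<xi> *\<^sub>R conv (rl_kernel 1) (W \<xi>) t"
    unfolding V_def[abs_def] W_def[abs_def]
    by (rule relaxation_forcing.conv_rl_kernel_solution[OF forcing[OF \<xi>]])
  also have "conv (rl_kernel 1) (W \<xi>) t = integral {0..t} (W \<xi>)"
    using \<xi> t by (intro conv_one_eq_integral continuous_on_subset[OF W_cont]) (auto simp: W_neg)
  finally show ?thesis using mu_pos[OF \<xi>] by (simp add: rate_def)
qed

text \<open>Covers L u with r = lam and u + L u with r = 1 + lam. As r / (1 + lam) <= 1, the series
  of the derivatives is dominated by \<open>amplitude\<close> and has a continuous sum, while the
  function itself is dominated by \<open>majorant\<close>.\<close>

lemma fractional_derivative_of_multiple: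
  assumes r: "\<And>\<xi>. \<xi> \<in> I \<Longrightarrow> 0 \<le> r \<xi> \<and> r \<xi> \<le> 1 + lam \<xi>"
    and P: "\<And>\<xi> t. \<xi> \<in> I \<Longrightarrow> t \<in> {0..T} \<Longrightarrow> ip (P t) (e \<xi>) = of_real (r \<xi>) * coef \<xi> t"
  shows "W_on \<alpha> T P"
    and "\<And>\<xi> t. \<xi> \<in> I \<Longrightarrow> 0 < t \<Longrightarrow> t < T \<Longrightarrow>
      ip (caputo \<alpha> P t) (e \<xi>) = of_real (r \<xi> / (1 + lam \<xi>)) * W \<xi> t"
proof -
  define Q where "Q = (\<lambda>t. \<Sum>\<^sub>\<infinity>\<xi>\<in>I. sc (of_real (r \<xi>) * coef \<xi> t) (e \<xi>))"
  define w where "w = (\<lambda>t. \<Sum>\<^sub>\<infinity>\<xi>\<in>I. sc (of_real (r \<xi> / (1 + lam \<xi>)) * W \<xi> t) (e \<xi>))"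
  have bQ: "norm (of_real (r \<xi>) * coef \<xi> t) \<le> majorant \<xi>" if "\<xi> \<in> I" "t \<in> {0..T}" for \<xi> t
  proof -
    have "norm (of_real (r \<xi>) * coef \<xi> t) \<le> (1 + lam \<xi>) * norm (coef \<xi> t)"
      using r[OF that(1)] by (simp add: norm_mult mult_right_mono)
    then show ?thesis using coef_lam_bound[OF that] by linarith
  qed
  have cQ: "continuous_on {0..T} (\<lambda>t. of_real (r \<xi>) * coef \<xi> t)" if "\<xi> \<in> I" for \<xi>
    by (intro continuous_intros coef_cont that)
  note Q = continuous_on_infsum_basis[of "{0..T}" "\<lambda>\<xi> t. of_real (r \<xi>) * coef \<xi> t" majorant, OF cQ bQ square_summable_majorant]
  have bw: "norm (of_real (r \<xi> / (1 + lam \<xi>)) * W \<xi> t) \<le> amplitude \<xi>" if "\<xi> \<in> I" "t \<in> {0..T}" for \<xi> t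
  proof -
    have "\<bar>r \<xi> / (1 + lam \<xi>)\<bar> \<le> 1" using r[OF that(1)] lam_pos[OF that(1)] by auto
    then have "\<bar>r \<xi> / (1 + lam \<xi>)\<bar> * norm (W \<xi> t) \<le> 1 * amplitude \<xi>"
      using W_bound[OF that] by (intro mult_mono) auto
    then show ?thesis by (simp only: norm_mult norm_of_real mult_1)
  qed
  have cw: "continuous_on {0..T} (\<lambda>t. of_real (r \<xi> / (1 + lam \<xi>)) * W \<xi> t)" if "\<xi> \<in> I" for \<xi>
    by (intro continuous_intros W_cont that)
  note w = continuous_on_infsum_basis[of "{0..T}" "\<lambda>\<xi> t. of_real (r \<xi> / (1 + lam \<xi>)) * W \<xi> t" amplitude, OF cw bw square_summable_amplitude]
  have w_coef: "ip (w t) (e \<xi>) = of_real (r \<xi> / (1 + lam \<xi>)) * W \<xi> t" if "\<xi> \<in> I" "t \<in> {0..T}" for \<xi> t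
    unfolding w_def by (rule ip_infsum_basis[OF w(1)]) (use that in auto)
  have PQ: "P t = Q t" if "t \<in> {0..T}" for t
  proof (rule eq_if_coefficients_eq)
    fix \<xi> assume \<xi>: "\<xi> \<in> I"
    have "ip (Q t) (e \<xi>) = of_real (r \<xi>) * coef \<xi> t"
      unfolding Q_def by (rule ip_infsum_basis[OF Q(1)]) (use that \<xi> in auto)
    then show "ip (P t) (e \<xi>) = ip (Q t) (e \<xi>)" using P[OF \<xi> that] by simp
  qed
  have "continuous_on {0..T} Q" unfolding Q_def by (rule Q(2)) auto
  then have contP: "continuous_on {0..T} P"
    by (rule continuous_on_eq) (rule PQ[symmetric])
  have contw: "continuous_on {0..T} w" unfolding w_def by (rule w(2)) auto
  \<comment> \<open>Both sides are vector-valued integrals, so they are compared coefficient by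
    coefficient, with \<open>ip\<close> moved inside.\<close>
  have prim: "caputo_primitive \<alpha> P t = integral {0..t} w" if t: "t \<in> {0..T}" for t
  proof (rule eq_if_coefficients_eq)
    fix \<xi> assume \<xi>: "\<xi> \<in> I"
    have diff: "ip (P s - P 0) (e \<xi>) = r \<xi> *\<^sub>R (coef \<xi> s - coef \<xi> 0)" if "s \<in> {0..T}" for s
      using P[OF \<xi> that] P[OF \<xi>, of 0] T
      by (simp add: ip_diff_left scaleR_conv_of_real right_diff_distrib)
    have "ip (caputo_primitive \<alpha> P t) (e \<xi>) = ip (rl_integral (1 - \<alpha>) (\<lambda>s. P s - P 0) t) (e \<xi>)"
      using \<alpha> by (simp add: caputo_primitive_def)
    also have "\<dots> = rl_integral (1 - \<alpha>) (\<lambda>s. ip (P s - P 0) (e \<xi>)) t"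
      using t \<alpha> by (intro bounded_linear_rl_integral[OF bounded_linear_ip] continuous_intros continuous_on_subset[OF contP]) auto
    also have "\<dots> = rl_integral (1 - \<alpha>) (\<lambda>s. r \<xi> *\<^sub>R (coef \<xi> s - coef \<xi> 0)) t"
      by (rule rl_integral_cong) (use t diff in auto)
    also have "\<dots> = r \<xi> *\<^sub>R (1 / (1 + lam \<xi>)) *\<^sub>R integral {0..t} (W \<xi>)"
      by (simp only: rl_integral_scaleR rl_integral_coef[OF \<xi> t])
    also have "\<dots> = integral {0..t} (\<lambda>s. (r \<xi> / (1 + lam \<xi>)) *\<^sub>R W \<xi> s)"
      by simp
    also have "\<dots> = integral {0..t} (\<lambda>s. ip (w s) (e \<xi>))"
      by (rule integral_cong) (use t w_coef[OF \<xi>] in \<open>auto simp: scaleR_conv_of_real\<close>)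
    also have "\<dots> = ip (integral {0..t} w) (e \<xi>)"
      using integral_linear[OF integrable_continuous_real bounded_linear_ip, of 0 t w "e \<xi>"]
        continuous_on_subset[OF contw, of "{0..t}"] t by (simp add: o_def)
    finally show "ip (caputo_primitive \<alpha> P t) (e \<xi>) = ip (integral {0..t} w) (e \<xi>)" .
  qed
  note * = caputo_if_primitive_eq_integral[OF T contP contw prim]
  show "W_on \<alpha> T P" by (rule *(2))
  show "ip (caputo \<alpha> P t) (e \<xi>) = of_real (r \<xi> / (1 + lam \<xi>)) * W \<xi> t" if "\<xi> \<in> I" "0 < t" "t < T" for \<xi> t
    using that *(3)[of t] w_coef[of \<xi> t] by simp
qed

section \<open>The series solves the problem\<close>

lemma ip_sol: "\<xi> \<in> I \<Longrightarrow> t \<in> {0..T} \<Longrightarrow> ip (sol t) (e \<xi>) = coef \<xi> t"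
proof -
  assume \<xi>: "\<xi> \<in> I" and t: "t \<in> {0..T}"
  have "norm (coef \<eta> t) \<le> majorant \<eta>" if "\<eta> \<in> I" for \<eta>
  proof -
    have "1 * norm (coef \<eta> t) \<le> (1 + lam \<eta>) * norm (coef \<eta> t)"
      using lam_pos[OF that] by (intro mult_right_mono) auto
    then show ?thesis using coef_lam_bound[OF that t] by simp
  qed
  then have "(\<lambda>\<xi>. sc (coef \<xi> t) (e \<xi>)) summable_on I"
    by (intro square_summable_imp_summable summable_on_comparison_test[OF square_summable_majorant]) (auto intro: power_mono)
  then show ?thesis unfolding sol_def using \<xi> by (rule ip_infsum_basis)
qed

lemma sol_mem_lam: "t \<in> {0..T} \<Longrightarrow> sol t \<in> spectral_space sc ip I e lam 1"
proof (subst mem_spectral_space_iff[OF lam_pos])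
  assume t: "t \<in> {0..T}"
  show "(\<lambda>\<xi>. (lam \<xi> * norm (ip (sol t) (e \<xi>)))\<^sup>2) summable_on I"
  proof (rule summable_on_comparison_test[OF square_summable_majorant])
    fix \<xi> assume \<xi>: "\<xi> \<in> I"
    have "lam \<xi> * norm (coef \<xi> t) \<le> (1 + lam \<xi>) * norm (coef \<xi> t)" by (intro mult_right_mono) auto
    then have "lam \<xi> * norm (coef \<xi> t) \<le> majorant \<xi>" using coef_lam_bound[OF \<xi> t] by linarith
    then show "(lam \<xi> * norm (ip (sol t) (e \<xi>)))\<^sup>2 \<le> (majorant \<xi>)\<^sup>2"
      using lam_pos[OF \<xi>] by (intro power_mono) (auto simp: ip_sol[OF \<xi> t])
  qed simp
qed

lemma square_summable_mu_majorant: "(\<lambda>\<xi>. (mu \<xi> * norm (ip \<phi> (e \<xi>)) + amplitude \<xi>)\<^sup>2) summable_on I"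
  by (intro square_summable_add \<phi>_mu square_summable_amplitude)

lemma sol_mem_mu: "t \<in> {0..T} \<Longrightarrow> sol t \<in> spectral_space sc ip I e mu 1"
proof (subst mem_spectral_space_iff[OF mu_pos])
  assume t: "t \<in> {0..T}"
  show "(\<lambda>\<xi>. (mu \<xi> * norm (ip (sol t) (e \<xi>)))\<^sup>2) summable_on I"
  proof (rule summable_on_comparison_test[OF square_summable_mu_majorant])
    fix \<xi> assume \<xi>: "\<xi> \<in> I"
    show "(mu \<xi> * norm (ip (sol t) (e \<xi>)))\<^sup>2 \<le> (mu \<xi> * norm (ip \<phi> (e \<xi>)) + amplitude \<xi>)\<^sup>2"
      using mu_pos[OF \<xi>] coef_mu_bound[OF \<xi> t] by (intro power_mono) (auto simp: ip_sol[OF \<xi> t])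
  qed simp
qed

lemma L2_on_mu_sol: "L2_on T (\<lambda>t. spectral_power sc ip I e mu 1 (sol t))"
proof (rule L2_on_continuous)
  have b: "norm (of_real (mu \<xi>) * coef \<xi> t) \<le> mu \<xi> * norm (ip \<phi> (e \<xi>)) + amplitude \<xi>" if "\<xi> \<in> I" "t \<in> {0..T}" for \<xi> t
    using coef_mu_bound[OF that] mu_pos[OF that(1)] by (simp add: norm_mult)
  have c: "continuous_on {0..T} (\<lambda>t. of_real (mu \<xi>) * coef \<xi> t)" if "\<xi> \<in> I" for \<xi>
    by (intro continuous_intros coef_cont that)
  note Q = continuous_on_infsum_basis[of "{0..T}" "\<lambda>\<xi> t. of_real (mu \<xi>) * coef \<xi> t", OF c b square_summable_mu_majorant]
  have "continuous_on {0..T} (\<lambda>t. \<Sum>\<^sub>\<infinity>\<xi>\<in>I. sc (of_real (mu \<xi>) * coef \<xi> t) (e \<xi>))"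
    by (rule Q(2)) auto
  then show "continuous_on {0..T} (\<lambda>t. spectral_power sc ip I e mu 1 (sol t))"
  proof (rule continuous_on_eq)
    fix t assume t: "t \<in> {0..T}"
    show "(\<Sum>\<^sub>\<infinity>\<xi>\<in>I. sc (of_real (mu \<xi>) * coef \<xi> t) (e \<xi>)) = spectral_power sc ip I e mu 1 (sol t)"
    proof (rule eq_if_coefficients_eq)
      fix \<xi> assume \<xi>: "\<xi> \<in> I"
      have s: "(\<lambda>\<xi>. sc (of_real (mu \<xi>) * coef \<xi> t) (e \<xi>)) summable_on I"
        by (rule Q(1)) (use t in auto)
      show "ip (\<Sum>\<^sub>\<infinity>\<xi>\<in>I. sc (of_real (mu \<xi>) * coef \<xi> t) (e \<xi>)) (e \<xi>) = ip (spectral_power sc ip I e mu 1 (sol t)) (e \<xi>)"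
        using ip_infsum_basis[OF s \<xi>] ip_spectral_power[OF mu_pos sol_mem_mu[OF t] \<xi>] ip_sol[OF \<xi> t] by simp
    qed
  qed
qed

lemma sol_generalised_solution:
  assumes L: "self_adjoint sc ip DL L" "\<And>\<xi>. \<xi> \<in> I \<Longrightarrow> e \<xi> \<in> DL \<and> L (e \<xi>) = sc (of_real (lam \<xi>)) (e \<xi>)"
    and M: "self_adjoint sc ip DM M" "\<And>\<xi>. \<xi> \<in> I \<Longrightarrow> e \<xi> \<in> DM \<and> M (e \<xi>) = sc (of_real (mu \<xi>)) (e \<xi>)"
  shows "generalised_solution sc ip I e L lam M mu \<alpha> T \<phi> f sol"
  unfolding generalised_solution_def
proof (intro conjI)
  have P: "ip (spectral_power sc ip I e lam 1 (sol t)) (e \<xi>) = of_real (lam \<xi>) * coef \<xi> t"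
    if "\<xi> \<in> I" "t \<in> {0..T}" for \<xi> t
    using ip_spectral_power[OF lam_pos sol_mem_lam that(1)] ip_sol that by simp
  have Leq: "L (sol t) = spectral_power sc ip I e lam 1 (sol t)" if "t \<in> {0..T}" for t
    by (rule self_adjoint_eq_spectral_power[OF L lam_pos sol_mem_lam[OF that]])
  have Q: "ip (sol t + L (sol t)) (e \<xi>) = of_real (1 + lam \<xi>) * coef \<xi> t"
    if "\<xi> \<in> I" "t \<in> {0..T}" for \<xi> t
    using P[OF that] that by (simp add: ip_add_left Leq ip_sol algebra_simps)
  have 1: "W_on \<alpha> T (\<lambda>t. spectral_power sc ip I e lam 1 (sol t))"
    by (rule fractional_derivative_of_multiple(1)[of lam]) (use P lam_pos in \<open>auto intro: less_imp_le\<close>)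
  have 2: "W_on \<alpha> T (\<lambda>s. sol s + L (sol s))"
    and 3: "\<And>\<xi> t. \<xi> \<in> I \<Longrightarrow> 0 < t \<Longrightarrow> t < T \<Longrightarrow>
      ip (caputo \<alpha> (\<lambda>s. sol s + L (sol s)) t) (e \<xi>) = of_real ((1 + lam \<xi>) / (1 + lam \<xi>)) * W \<xi> t"
    by (rule fractional_derivative_of_multiple[of "\<lambda>\<xi>. 1 + lam \<xi>"]; use Q lam_pos in \<open>auto simp: add_nonneg_nonneg less_imp_le\<close>)+
  show "W_spectral sc ip I e lam 1 \<alpha> T sol"
    unfolding W_spectral_def using 1 sol_mem_lam by blast
  have ae: "AE t in lebesgue_on {0..T}. t \<in> {0..T}"
    by (rule AE_I2) simp
  show "L2_spectral sc ip I e lam 1 T sol"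
    unfolding L2_spectral_def using 1 eventually_mono[OF ae sol_mem_lam] by (simp add: W_on_def)
  show "L2_spectral sc ip I e mu 1 T sol"
    unfolding L2_spectral_def using L2_on_mu_sol eventually_mono[OF ae sol_mem_mu] by simp
  show "caputo_differentiable \<alpha> T (\<lambda>s. sol s + L (sol s))"
    using 2 by (simp add: W_on_def)
  \<comment> \<open>On coefficients the equation reads W + mu u = f, which is \<open>W_eq\<close>;
    it holds at every interior time.\<close>
  show "AE t in lebesgue_on {0<..<T}. caputo \<alpha> (\<lambda>s. sol s + L (sol s)) t + M (sol t) = f t"
  proof (rule AE_I2, rule eq_if_coefficients_eq)
    fix t \<xi> assume "t \<in> space (lebesgue_on {0<..<T})" and \<xi>: "\<xi> \<in> I"
    then have t: "0 < t" "t < T" "t \<in> {0..T}" by auto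
    have "ip (M (sol t)) (e \<xi>) = of_real (mu \<xi>) * coef \<xi> t"
      using ip_spectral_power[OF mu_pos sol_mem_mu[OF t(3)] \<xi>] ip_sol[OF \<xi> t(3)]
        self_adjoint_eq_spectral_power[OF M mu_pos sol_mem_mu[OF t(3)]] by simp
    then show "ip (caputo \<alpha> (\<lambda>s. sol s + L (sol s)) t + M (sol t)) (e \<xi>) = ip (f t) (e \<xi>)"
      using 3[OF \<xi> t(1,2)] W_eq[OF \<xi> t(3)] lam_pos[OF \<xi>] by (simp add: ip_add_left)
  qed
  show "sol 0 = \<phi>"
    using T by (intro eq_if_coefficients_eq) (simp add: ip_sol coef_0)
qed

end

section \<open>Uniqueness and the series representation\<close>

text \<open>By completeness of Lebesgue measure. It supplies the measurability of integrands that
  contain \<open>vector_derivative\<close>, which is meaningful only almost everywhere.\<close>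

lemma lebesgue_measurable_cong_AE:
  assumes H: "H \<in> borel_measurable lebesgue" and ae: "AE x in lebesgue. F x = H x"
  shows "F \<in> borel_measurable lebesgue"
proof (rule measurableI)
  fix A :: "'b set" assume "A \<in> sets borel"
  then have 1: "H -` A \<in> sets lebesgue" using measurable_sets[OF H, of A] by simp
  have 2: "AE x in lebesgue. x \<in> H -` A \<longleftrightarrow> x \<in> F -` A"
    using ae by eventually_elim simp
  have "F -` A \<in> sets lebesgue"
    by (rule completion.in_sets_AE[OF 2 1]) simp
  then show "F -` A \<inter> space lebesgue \<in> sets lebesgue" by simp
qed simp

lemma AE_lborel_reflect:
  assumes "AE x in lborel. P (x :: real)"
  shows "AE x in lborel. P (t - x)"
proof -
  obtain N where N: "N \<in> null_sets lborel" "{x. \<not> P x} \<subseteq> N"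
    using assms by (auto simp: eventually_ae_filter)
  have [measurable]: "N \<in> sets borel" using N(1) by auto
  have "AE x in lborel. t + (-1) * x \<notin> N"
    by (rule AE_borel_affine) (use N AE_not_in in auto)
  then show ?thesis by eventually_elim (use N in auto)
qed

lemma rl_integral_0: "rl_integral b h 0 = 0"
proof -
  have "(\<lambda>s. indicator {0..0::real} s *\<^sub>R (0 - s) powr (b - 1) *\<^sub>R h s) = (\<lambda>_. 0)"
    by (auto simp: fun_eq_iff indicator_def)
  then show ?thesis
    by (simp only: rl_integral_def set_lebesgue_integral_def Bochner_Integration.integral_zero scaleR_zero_right)
qed

text \<open>Subtraction is a bounded linear map on pairs, so linearity comes from
  \<open>bounded_linear_rl_integral\<close> applied to s -> (h s, k s), with the projections as
  further instances.\<close>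

lemma rl_integral_diff:
  fixes h k :: "real \<Rightarrow> 'b::{banach,second_countable_topology}"
  assumes h: "continuous_on {0..t} h" and k: "continuous_on {0..t} k" and b: "0 < b"
  shows "rl_integral b (\<lambda>s. h s - k s) t = rl_integral b h t - rl_integral b k t"
proof -
  let ?p = "\<lambda>s. (h s, k s)"
  have p: "continuous_on {0..t} ?p" by (intro continuous_intros h k)
  have "bounded_linear (\<lambda>z :: 'b \<times> 'b. fst z - snd z)"
    by (intro bounded_linear_sub bounded_linear_fst bounded_linear_snd)
  from bounded_linear_rl_integral[OF this p b] show ?thesis
    using bounded_linear_rl_integral[OF bounded_linear_fst p b]
      bounded_linear_rl_integral[OF bounded_linear_snd p b] by simp
qed

lemma conv_reflect: "conv k g t = (\<integral>s. k s *\<^sub>R g (t - s) \<partial>lborel)"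
  unfolding conv_def by (subst lborel_integral_real_affine[of "-1" _ t]) auto

text \<open>Cauchy-Schwarz against the constant 1 on [0,T], obtained from the nonnegative integral
  of (|h| - k)^2 with k the mean of |h|.\<close>

lemma square_integral_norm_le:
  fixes h :: "real \<Rightarrow> 'b::{banach,second_countable_topology}"
  assumes T: "0 < T" and h: "integrable lborel h" and h2: "integrable lborel (\<lambda>s. (norm (h s))\<^sup>2)"
    and out: "\<And>s. s \<notin> {0..T} \<Longrightarrow> h s = 0"
  shows "(\<integral>s. norm (h s) \<partial>lborel)\<^sup>2 \<le> T * (\<integral>s. (norm (h s))\<^sup>2 \<partial>lborel)"
proof -
  let ?a = "\<integral>s. norm (h s) \<partial>lborel"
  define k where "k = ?a / T"
  have i: "integrable lborel (indicat_real {0..T})"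
    by (intro integrable_real_indicator) (auto simp: emeasure_lborel_Icc_eq)
  have "0 \<le> (\<integral>s. (norm (h s) - k * indicat_real {0..T} s)\<^sup>2 \<partial>lborel)" by simp
  also have "(\<lambda>s. (norm (h s) - k * indicat_real {0..T} s)\<^sup>2) =
      (\<lambda>s. (norm (h s))\<^sup>2 - 2 * k * norm (h s) + k\<^sup>2 * indicat_real {0..T} s)"
  proof
    fix s show "(norm (h s) - k * indicat_real {0..T} s)\<^sup>2 =
      (norm (h s))\<^sup>2 - 2 * k * norm (h s) + k\<^sup>2 * indicat_real {0..T} s"
      using out[of s] by (cases "s \<in> {0..T}") (auto simp: power2_eq_square algebra_simps)
  qed
  also have "(\<integral>s. (norm (h s))\<^sup>2 - 2 * k * norm (h s) + k\<^sup>2 * indicat_real {0..T} s \<partial>lborel)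
      = (\<integral>s. (norm (h s))\<^sup>2 \<partial>lborel) - 2 * k * ?a + k\<^sup>2 * T"
    using h h2 i T by simp
  finally have "0 \<le> (\<integral>s. (norm (h s))\<^sup>2 \<partial>lborel) - 2 * k * ?a + k\<^sup>2 * T" .
  then have "0 \<le> T * ((\<integral>s. (norm (h s))\<^sup>2 \<partial>lborel) - 2 * k * ?a + k\<^sup>2 * T)"
    using T by (intro mult_nonneg_nonneg) auto
  also have "\<dots> = T * (\<integral>s. (norm (h s))\<^sup>2 \<partial>lborel) - ?a\<^sup>2"
    using T by (simp add: k_def power2_eq_square field_simps)
  finally show ?thesis by simp
qed

section \<open>Coefficients of the forcing term and of arbitrary solutions\<close>

context hilbert_basis
begin

lemma dominated_has_sum_ex:
  assumes le: "\<And>\<xi>. \<xi> \<in> I \<Longrightarrow> norm (c \<xi>) \<le> b \<xi>" and b: "(\<lambda>\<xi>. (b \<xi>)\<^sup>2) summable_on I"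
  shows "\<exists>S. ((\<lambda>\<xi>. sc (c \<xi>) (e \<xi>)) has_sum S) I \<and> (\<forall>\<xi>\<in>I. ip S (e \<xi>) = c \<xi>)"
proof -
  have "(\<lambda>\<xi>. sc (c \<xi>) (e \<xi>)) summable_on I"
    by (rule square_summable_imp_summable, rule summable_on_comparison_test[OF b])
      (auto intro: power_mono le)
  then show ?thesis using has_sum_infsum ip_infsum_basis by blast
qed

text \<open>Replaces f' by Borel functions, one for each coefficient. The primitive comes from the
  fundamental theorem for absolutely continuous functions, the last claim from Cauchy-Schwarz in
  time and Bessel's inequality in space.\<close>

lemma W_1_coefficient_derivatives:
  assumes T: "0 < T" and f: "W_on 1 T f"
  obtains g where "\<And>\<xi>. \<xi> \<in> I \<Longrightarrow> integrable lborel (g \<xi>)"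
    and "\<And>\<xi> s. \<xi> \<in> I \<Longrightarrow> s < 0 \<Longrightarrow> g \<xi> s = 0"
    and "\<And>\<xi> t. \<xi> \<in> I \<Longrightarrow> t \<in> {0..T} \<Longrightarrow>
      (\<integral>s. indicator {0..t} s *\<^sub>R g \<xi> s \<partial>lborel) = ip (f t) (e \<xi>) - ip (f 0) (e \<xi>)"
    and "\<And>\<xi>. \<xi> \<in> I \<Longrightarrow>
      AE x in lborel. 0 < x \<and> x < T \<longrightarrow> vector_derivative (\<lambda>\<tau>. ip (f \<tau>) (e \<xi>)) (at x) = g \<xi> x"
    and "(\<lambda>\<xi>. (\<integral>s. norm (g \<xi> s) \<partial>lborel)\<^sup>2) summable_on I"
proof -
  define F where "F = (\<lambda>t. vector_derivative f (at t))"
  have prim: "caputo_primitive 1 f = f" by (simp add: caputo_primitive_def)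
  have ac: "absolutely_continuous_fun 0 T f"
    and diff: "AE t in lebesgue_on {0..T}. f differentiable (at t)"
    and F: "L2_on T F"
    using f by (auto simp: W_on_def caputo_differentiable_def prim caputo_def[abs_def] F_def)
  let ?F = "\<lambda>t. indicator {0..T} t *\<^sub>R F t"
  have F_meas: "?F \<in> borel_measurable lebesgue"
    using F by (simp add: L2_on_def borel_measurable_restrict_space_iff)
  have F_int: "integrable lebesgue (\<lambda>t. indicator {0..T} t *\<^sub>R (norm (F t))\<^sup>2)"
    using F by (simp add: L2_on_def integrable_restrict_space)
  have diff': "AE t in lebesgue. t \<in> {0..T} \<longrightarrow> f differentiable (at t)"
    using diff by (subst (asm) AE_restrict_space_iff) auto
  have "\<exists>h. h \<in> borel_measurable borel \<and> (AE x in lebesgue. ip (?F x) (e \<xi>) = h x)" for \<xi>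
  proof -
    have "(\<lambda>x. ip (?F x) (e \<xi>)) \<in> borel_measurable lebesgue"
      by (rule borel_measurable_continuous_on[OF bounded_linear.continuous_on[OF bounded_linear_ip continuous_on_id] F_meas])
    then show ?thesis by (rule lebesgue_measurable_ex_borel) blast
  qed
  then obtain h where h: "\<And>\<xi>. h \<xi> \<in> borel_measurable borel" "\<And>\<xi>. AE x in lebesgue. ip (?F x) (e \<xi>) = h \<xi> x"
    by metis
  \<comment> \<open>The cut-off to [0,T] makes the convolutions on the whole line see only the
    forcing on the time interval.\<close>
  define g where "g = (\<lambda>\<xi> x. indicator {0..T} x *\<^sub>R h \<xi> x)"
  have g_meas[measurable]: "g \<xi> \<in> borel_measurable borel" for \<xi>
    using h(1)[of \<xi>] unfolding g_def by measurable
  have g_out: "g \<xi> s = 0" if "s \<notin> {0..T}" for \<xi> s using that by (simp add: g_def)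
  have g_ae: "AE x in lebesgue. g \<xi> x = ip (?F x) (e \<xi>)" for \<xi>
    using h(2)[of \<xi>]
  proof eventually_elim
    case (elim x)
    have "ip 0 (e \<xi>) = 0" by (rule linear_0[OF bounded_linear.linear[OF bounded_linear_ip]])
    with elim show ?case by (cases "x \<in> {0..T}") (simp_all add: g_def)
  qed
  have g_norm: "AE x in lebesgue. norm (g \<xi> x) \<le> indicator {0..T} x *\<^sub>R norm (F x)" if "\<xi> \<in> I" for \<xi>
    using g_ae[of \<xi>]
    by eventually_elim (use norm_ip_basis_le[OF that] in \<open>metis indicator_pos_le norm_scaleR abs_of_nonneg real_scaleR_def\<close>)
  have g2_int: "integrable lborel (\<lambda>x. (norm (g \<xi> x))\<^sup>2)" if "\<xi> \<in> I" for \<xi>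
  proof -
    have "integrable lebesgue (\<lambda>x. (norm (g \<xi> x))\<^sup>2)"
    proof (rule Bochner_Integration.integrable_bound[OF F_int])
      show "(\<lambda>x. (norm (g \<xi> x))\<^sup>2) \<in> borel_measurable lebesgue" by (intro measurable_completion) measurable
      show "AE x in lebesgue. norm ((norm (g \<xi> x))\<^sup>2) \<le> norm (indicator {0..T} x *\<^sub>R (norm (F x))\<^sup>2)"
        using g_norm[OF that]
      proof eventually_elim
        case (elim x)
        then have "(norm (g \<xi> x))\<^sup>2 \<le> (indicator {0..T} x *\<^sub>R norm (F x))\<^sup>2" by (intro power_mono) auto
        then show ?case by (cases "x \<in> {0..T}") auto
      qed
    qed
    then show ?thesis by (simp add: integrable_completion)
  qed
  have g_int: "integrable lborel (g \<xi>)" if "\<xi> \<in> I" for \<xi>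
  proof (rule Bochner_Integration.integrable_bound)
    have "integrable lborel (indicat_real {0..T})"
      by (intro integrable_real_indicator) (auto simp: emeasure_lborel_Icc_eq)
    then show "integrable lborel (\<lambda>x. indicat_real {0..T} x + (norm (g \<xi> x))\<^sup>2)"
      using g2_int[OF that] by simp
    \<comment> \<open>From x <= 1 + x^2: on a bounded interval square integrability implies
      integrability.\<close>
    have "norm (g \<xi> x) \<le> indicat_real {0..T} x + (norm (g \<xi> x))\<^sup>2" for x
    proof (cases "x \<in> {0..T}")
      case True
      have "0 \<le> (norm (g \<xi> x) - 1 / 2)\<^sup>2" by simp
      then have "norm (g \<xi> x) \<le> 1 + (norm (g \<xi> x))\<^sup>2" by (simp add: power2_eq_square algebra_simps)
      then show ?thesis using True by simp
    qed (simp add: g_out)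
    then show "AE x in lborel. norm (g \<xi> x) \<le> norm (indicat_real {0..T} x + (norm (g \<xi> x))\<^sup>2)"
      by (intro AE_I2) (smt (verit) real_norm_def)
  qed measurable
  show thesis
  proof
    show "integrable lborel (g \<xi>)" if "\<xi> \<in> I" for \<xi> using g_int[OF that] .
    show "g \<xi> s = 0" if "s < 0" for \<xi> s using that by (intro g_out) auto
    show "AE x in lborel. 0 < x \<and> x < T \<longrightarrow> vector_derivative (\<lambda>\<tau>. ip (f \<tau>) (e \<xi>)) (at x) = g \<xi> x" for \<xi>
    proof -
      have "AE x in lebesgue. 0 < x \<and> x < T \<longrightarrow> vector_derivative (\<lambda>\<tau>. ip (f \<tau>) (e \<xi>)) (at x) = g \<xi> x"
        using diff' g_ae[of \<xi>]
      proof eventually_elim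
        case (elim x)
        show ?case
        proof
          assume x: "0 < x \<and> x < T"
          then have "(f has_vector_derivative F x) (at x)"
            using elim(1) by (simp add: F_def vector_derivative_works)
          from bounded_linear.has_vector_derivative[OF bounded_linear_ip this]
          show "vector_derivative (\<lambda>\<tau>. ip (f \<tau>) (e \<xi>)) (at x) = g \<xi> x"
            using elim(2) x by (simp add: vector_derivative_at)
        qed
      qed
      then show ?thesis by (simp only: AE_completion_iff)
    qed
    show "(\<integral>s. indicator {0..t} s *\<^sub>R g \<xi> s \<partial>lborel) = ip (f t) (e \<xi>) - ip (f 0) (e \<xi>)"
      if \<xi>: "\<xi> \<in> I" and t: "t \<in> {0..T}" for \<xi> t
    proof -
      have "AE x in lebesgue. x \<in> {0<..<T} \<longrightarrow> f differentiable (at x) \<and> ip (vector_derivative f (at x)) (e \<xi>) = g \<xi> x"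
        using diff' g_ae[of \<xi>] by eventually_elim (auto simp: F_def)
      then have "AE x in lebesgue_on {0<..<T}. f differentiable (at x) \<and> ip (vector_derivative f (at x)) (e \<xi>) = g \<xi> x"
        by (subst AE_restrict_space_iff) auto
      from bounded_linear_has_integral_derivative[OF bounded_linear_ip t ac this]
      have "integral {0..t} (g \<xi>) = ip (f t) (e \<xi>) - ip (f 0) (e \<xi>)" by (rule integral_unique)
      moreover have "set_integrable lborel {0..t} (g \<xi>)"
        unfolding set_integrable_def by (intro integrable_mult_indicator g_int \<xi>) auto
      from set_borel_integral_eq_integral(2)[OF this]
      have "(\<integral>s. indicator {0..t} s *\<^sub>R g \<xi> s \<partial>lborel) = integral {0..t} (g \<xi>)"
        by (simp add: set_lebesgue_integral_def)
      ultimately show ?thesis by simp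
    qed
    show "(\<lambda>\<xi>. (\<integral>s. norm (g \<xi> s) \<partial>lborel)\<^sup>2) summable_on I"
    proof (rule nonneg_bdd_above_summable_on)
      let ?K = "\<integral>t. indicator {0..T} t *\<^sub>R (norm (F t))\<^sup>2 \<partial>lebesgue"
      show "bdd_above (sum (\<lambda>\<xi>. (\<integral>s. norm (g \<xi> s) \<partial>lborel)\<^sup>2) ` {X. X \<subseteq> I \<and> finite X})"
      proof (rule bdd_aboveI2)
        fix X assume "X \<in> {X. X \<subseteq> I \<and> finite X}"
        then have X: "finite X" "X \<subseteq> I" by auto
        \<comment> \<open>Cauchy-Schwarz costs the factor T; afterwards Bessel's inequality is
          applied under the integral, so the bound does not depend on the finite set
          \<open>X\<close>.\<close>
        have "(\<Sum>\<xi>\<in>X. (\<integral>s. norm (g \<xi> s) \<partial>lborel)\<^sup>2) \<le> (\<Sum>\<xi>\<in>X. T * (\<integral>s. (norm (g \<xi> s))\<^sup>2 \<partial>lborel))"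
          using X by (intro sum_mono square_integral_norm_le T g_int g2_int g_out) auto
        also have "\<dots> = T * (\<integral>s. (\<Sum>\<xi>\<in>X. (norm (g \<xi> s))\<^sup>2) \<partial>lborel)"
          using X g2_int by (subst Bochner_Integration.integral_sum) (auto simp: sum_distrib_left)
        also have "(\<integral>s. (\<Sum>\<xi>\<in>X. (norm (g \<xi> s))\<^sup>2) \<partial>lborel) = (\<integral>s. (\<Sum>\<xi>\<in>X. (norm (g \<xi> s))\<^sup>2) \<partial>lebesgue)"
          by (rule integral_completion[symmetric]) measurable
        also have "\<dots> \<le> ?K"
        proof (rule integral_mono_AE[OF _ F_int])
          show "integrable lebesgue (\<lambda>s. \<Sum>\<xi>\<in>X. (norm (g \<xi> s))\<^sup>2)"
            using X g2_int by (intro Bochner_Integration.integrable_sum) (auto simp: integrable_completion)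
          have "AE x in lebesgue. \<forall>\<xi>\<in>X. g \<xi> x = ip (?F x) (e \<xi>)"
            using X g_ae by (intro AE_finite_allI) auto
          then show "AE x in lebesgue. (\<Sum>\<xi>\<in>X. (norm (g \<xi> x))\<^sup>2) \<le> indicator {0..T} x *\<^sub>R (norm (F x))\<^sup>2"
          proof eventually_elim
            case (elim x)
            then have "(\<Sum>\<xi>\<in>X. (norm (g \<xi> x))\<^sup>2) = (\<Sum>\<xi>\<in>X. (norm (ip (?F x) (e \<xi>)))\<^sup>2)" by simp
            also have "\<dots> \<le> (norm (?F x))\<^sup>2" by (rule bessel[OF X])
            also have "\<dots> = indicator {0..T} x *\<^sub>R (norm (F x))\<^sup>2" by (cases "x \<in> {0..T}") auto
            finally show ?case .
          qed
        qed
        finally show "(\<Sum>\<xi>\<in>X. (\<integral>s. norm (g \<xi> s) \<partial>lborel)\<^sup>2) \<le> T * ?K" using T by simp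
      qed
    qed simp
  qed
qed

text \<open>The almost-everywhere equation is tested with a basis vector and integrated by the
  fundamental theorem for absolutely continuous functions. The result is an identity at every time,
  in which no derivative is left.\<close>

lemma generalised_solution_coefficient:
  assumes \<alpha>: "0 < \<alpha>" "\<alpha> < 1"
    and L: "self_adjoint sc ip DL L" "\<And>\<xi>. \<xi> \<in> I \<Longrightarrow> e \<xi> \<in> DL \<and> L (e \<xi>) = sc (of_real (lam \<xi>)) (e \<xi>)"
    and M: "self_adjoint sc ip DM M" "\<And>\<xi>. \<xi> \<in> I \<Longrightarrow> e \<xi> \<in> DM \<and> M (e \<xi>) = sc (of_real (mu \<xi>)) (e \<xi>)"
    and lam: "\<And>\<xi>. \<xi> \<in> I \<Longrightarrow> 0 < lam \<xi>" and mu: "\<And>\<xi>. \<xi> \<in> I \<Longrightarrow> 0 < mu \<xi>"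
    and v: "generalised_solution sc ip I e L lam M mu \<alpha> T \<phi> f v"
    and \<xi>: "\<xi> \<in> I"
  shows "continuous_on {0..T} (\<lambda>t. ip (v t) (e \<xi>))"
    and "\<And>t. t \<in> {0..T} \<Longrightarrow>
      ((\<lambda>s. ip (f s) (e \<xi>) - of_real (mu \<xi>) * ip (v s) (e \<xi>)) has_integral
        (1 + lam \<xi>) *\<^sub>R rl_integral (1 - \<alpha>) (\<lambda>s. ip (v s) (e \<xi>) - ip \<phi> (e \<xi>)) t) {0..t}"
proof -
  define G where "G = (\<lambda>s. v s + L (v s))"
  have v_mu: "AE t in lebesgue_on {0..T}. v t \<in> spectral_space sc ip I e mu 1"
    and v_lam: "\<And>t. t \<in> {0..T} \<Longrightarrow> v t \<in> spectral_space sc ip I e lam 1"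
    and v_cont: "continuous_on {0..T} (\<lambda>t. spectral_power sc ip I e lam 1 (v t))"
    and G: "caputo_differentiable \<alpha> T G"
    and eq: "AE t in lebesgue_on {0<..<T}. caputo \<alpha> G t + M (v t) = f t"
    and v0: "v 0 = \<phi>"
    using v unfolding generalised_solution_def L2_spectral_def W_spectral_def W_on_def caputo_differentiable_def G_def
    by auto
  have P: "ip (spectral_power sc ip I e lam 1 (v t)) (e \<xi>) = of_real (lam \<xi>) * ip (v t) (e \<xi>)" if "t \<in> {0..T}" for t
    by (rule ip_spectral_power[OF lam v_lam[OF that] \<xi>])
  have G_coef: "ip (G t) (e \<xi>) = of_real (1 + lam \<xi>) * ip (v t) (e \<xi>)" if "t \<in> {0..T}" for t
    using P[OF that] self_adjoint_eq_spectral_power[OF L lam v_lam[OF that]]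
    by (simp add: G_def ip_add_left algebra_simps)
  \<comment> \<open>Continuity is known for L v; dividing its coefficient by lam > 0 returns that of
    v.\<close>
  have "continuous_on {0..T} (\<lambda>t. ip (spectral_power sc ip I e lam 1 (v t)) (e \<xi>) / of_real (lam \<xi>))"
    using lam[OF \<xi>] by (intro continuous_intros bounded_linear.continuous_on[OF bounded_linear_ip] v_cont) auto
  then show "continuous_on {0..T} (\<lambda>t. ip (v t) (e \<xi>))"
    by (rule continuous_on_eq) (use P lam[OF \<xi>] in auto)
  fix t assume t: "t \<in> {0..T}"
  have G_cont: "continuous_on {0..T} G" and G_ac: "absolutely_continuous_fun 0 T (caputo_primitive \<alpha> G)"
    and G_diff: "AE t in lebesgue_on {0..T}. caputo_primitive \<alpha> G differentiable (at t)"
    using G by (auto simp: caputo_differentiable_def)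
  have 1: "AE x in lebesgue. x \<in> {0..T} \<longrightarrow> caputo_primitive \<alpha> G differentiable (at x)"
    using G_diff by (subst (asm) AE_restrict_space_iff) auto
  have 2: "AE x in lebesgue. x \<in> {0<..<T} \<longrightarrow> caputo \<alpha> G x + M (v x) = f x"
    using eq by (subst (asm) AE_restrict_space_iff) auto
  have 3: "AE x in lebesgue. x \<in> {0..T} \<longrightarrow> v x \<in> spectral_space sc ip I e mu 1"
    using v_mu by (subst (asm) AE_restrict_space_iff) auto
  have "AE x in lebesgue. x \<in> {0<..<T} \<longrightarrow> caputo_primitive \<alpha> G differentiable (at x) \<and>
      ip (vector_derivative (caputo_primitive \<alpha> G) (at x)) (e \<xi>) = ip (f x) (e \<xi>) - of_real (mu \<xi>) * ip (v x) (e \<xi>)"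
    using 1 2 3
  proof eventually_elim
    case (elim x)
    show ?case
    proof
      assume x: "x \<in> {0<..<T}"
      then have vx: "v x \<in> spectral_space sc ip I e mu 1" using elim(3) by simp
      have "ip (M (v x)) (e \<xi>) = of_real (mu \<xi>) * ip (v x) (e \<xi>)"
        using ip_spectral_power[OF mu vx \<xi>] self_adjoint_eq_spectral_power[OF M mu vx] by simp
      moreover have "ip (caputo \<alpha> G x) (e \<xi>) + ip (M (v x)) (e \<xi>) = ip (f x) (e \<xi>)"
        using elim(2) x by (simp flip: ip_add_left)
      ultimately show "caputo_primitive \<alpha> G differentiable (at x) \<and>
          ip (vector_derivative (caputo_primitive \<alpha> G) (at x)) (e \<xi>) = ip (f x) (e \<xi>) - of_real (mu \<xi>) * ip (v x) (e \<xi>)"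
        using elim(1) x by (simp add: caputo_def eq_diff_eq)
    qed
  qed
  then have "AE x in lebesgue_on {0<..<T}. caputo_primitive \<alpha> G differentiable (at x) \<and>
      ip (vector_derivative (caputo_primitive \<alpha> G) (at x)) (e \<xi>) = ip (f x) (e \<xi>) - of_real (mu \<xi>) * ip (v x) (e \<xi>)"
    by (subst AE_restrict_space_iff) auto
  from bounded_linear_has_integral_derivative[OF bounded_linear_ip t G_ac this]
  have "((\<lambda>s. ip (f s) (e \<xi>) - of_real (mu \<xi>) * ip (v s) (e \<xi>)) has_integral
      (ip (caputo_primitive \<alpha> G t) (e \<xi>) - ip (caputo_primitive \<alpha> G 0) (e \<xi>))) {0..t}" .
  moreover have "ip (caputo_primitive \<alpha> G 0) (e \<xi>) = 0"
    using \<alpha> linear_0[OF bounded_linear.linear[OF bounded_linear_ip], of "e \<xi>"]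
    by (simp add: caputo_primitive_def rl_integral_0)
  moreover have "ip (caputo_primitive \<alpha> G t) (e \<xi>) = (1 + lam \<xi>) *\<^sub>R rl_integral (1 - \<alpha>) (\<lambda>s. ip (v s) (e \<xi>) - ip \<phi> (e \<xi>)) t"
  proof -
    have "ip (caputo_primitive \<alpha> G t) (e \<xi>) = rl_integral (1 - \<alpha>) (\<lambda>s. ip (G s - G 0) (e \<xi>)) t"
      unfolding caputo_primitive_def using \<alpha> t
      by (simp, intro bounded_linear_rl_integral[OF bounded_linear_ip] continuous_intros continuous_on_subset[OF G_cont]) auto
    also have "\<dots> = rl_integral (1 - \<alpha>) (\<lambda>s. (1 + lam \<xi>) *\<^sub>R (ip (v s) (e \<xi>) - ip \<phi> (e \<xi>))) t"
    proof (rule rl_integral_cong)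
      fix s assume "0 \<le> s" "s \<le> t"
      then have "s \<in> {0..T}" "0 \<in> {0..T}" using t by auto
      then show "ip (G s - G 0) (e \<xi>) = (1 + lam \<xi>) *\<^sub>R (ip (v s) (e \<xi>) - ip \<phi> (e \<xi>))"
        using G_coef v0 by (simp only: ip_diff_left scaleR_conv_of_real right_diff_distrib)
    qed
    finally show ?thesis by (simp only: rl_integral_scaleR)
  qed
  ultimately show "((\<lambda>s. ip (f s) (e \<xi>) - of_real (mu \<xi>) * ip (v s) (e \<xi>)) has_integral
        (1 + lam \<xi>) *\<^sub>R rl_integral (1 - \<alpha>) (\<lambda>s. ip (v s) (e \<xi>) - ip \<phi> (e \<xi>)) t) {0..t}"
    by simp
qed

text \<open>In the difference of the integrated coefficient equations f and \<phi> cancel, which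
  leaves the homogeneous problem with rate mu / (1 + lam).\<close>

lemma generalised_solution_unique:
  assumes \<alpha>: "0 < \<alpha>" "\<alpha> < 1" and T: "0 < T"
    and L: "self_adjoint sc ip DL L" "\<And>\<xi>. \<xi> \<in> I \<Longrightarrow> e \<xi> \<in> DL \<and> L (e \<xi>) = sc (of_real (lam \<xi>)) (e \<xi>)"
    and M: "self_adjoint sc ip DM M" "\<And>\<xi>. \<xi> \<in> I \<Longrightarrow> e \<xi> \<in> DM \<and> M (e \<xi>) = sc (of_real (mu \<xi>)) (e \<xi>)"
    and lam: "\<And>\<xi>. \<xi> \<in> I \<Longrightarrow> 0 < lam \<xi>" and mu: "\<And>\<xi>. \<xi> \<in> I \<Longrightarrow> 0 < mu \<xi>"
    and u: "generalised_solution sc ip I e L lam M mu \<alpha> T \<phi> f u"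
    and v: "generalised_solution sc ip I e L lam M mu \<alpha> T \<phi> f v"
    and t: "t \<in> {0..T}"
  shows "v t = u t"
proof (rule eq_if_coefficients_eq)
  fix \<xi> assume \<xi>: "\<xi> \<in> I"
  have cont: "continuous_on {0..T} (\<lambda>t. ip (w t) (e \<xi>))"
    and int: "\<And>t. t \<in> {0..T} \<Longrightarrow>
      ((\<lambda>s. ip (f s) (e \<xi>) - of_real (mu \<xi>) * ip (w s) (e \<xi>)) has_integral
        (1 + lam \<xi>) *\<^sub>R rl_integral (1 - \<alpha>) (\<lambda>s. ip (w s) (e \<xi>) - ip \<phi> (e \<xi>)) t) {0..t}"
    if w: "generalised_solution sc ip I e L lam M mu \<alpha> T \<phi> f w" for w
    by (rule generalised_solution_coefficient[OF \<alpha> L M lam mu w \<xi>]; assumption)+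
  note U = cont[OF u] int[OF u] and V = cont[OF v] int[OF v]
  have "ip (v t) (e \<xi>) - ip (u t) (e \<xi>) = 0"
  proof (rule fractional_homogeneous_unique[OF \<alpha> _ T _ _ t])
    show "0 < mu \<xi> / (1 + lam \<xi>)" using mu[OF \<xi>] lam[OF \<xi>] by simp
    show d: "continuous_on {0..T} (\<lambda>t. ip (v t) (e \<xi>) - ip (u t) (e \<xi>))"
      by (intro continuous_intros U(1) V(1))
    fix t assume t: "t \<in> {0..T}"
    let ?d = "\<lambda>s. ip (v s) (e \<xi>) - ip (u s) (e \<xi>)"
    let ?R = "\<lambda>w. rl_integral (1 - \<alpha>) (\<lambda>s. ip (w s) (e \<xi>) - ip \<phi> (e \<xi>)) t"
    have "((\<lambda>s. (ip (f s) (e \<xi>) - of_real (mu \<xi>) * ip (v s) (e \<xi>)) - (ip (f s) (e \<xi>) - of_real (mu \<xi>) * ip (u s) (e \<xi>)))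
        has_integral ((1 + lam \<xi>) *\<^sub>R ?R v - (1 + lam \<xi>) *\<^sub>R ?R u)) {0..t}"
      by (rule has_integral_diff[OF V(2)[OF t] U(2)[OF t]])
    then have "((\<lambda>s. - mu \<xi> *\<^sub>R ?d s) has_integral (1 + lam \<xi>) *\<^sub>R (?R v - ?R u)) {0..t}"
      by (simp add: scaleR_conv_of_real algebra_simps)
    moreover have "((\<lambda>s. - mu \<xi> *\<^sub>R ?d s) has_integral - mu \<xi> *\<^sub>R integral {0..t} ?d) {0..t}"
      using t by (intro has_integral_cmul integrable_integral integrable_continuous_real continuous_on_subset[OF d]) auto
    ultimately have *: "(1 + lam \<xi>) *\<^sub>R (?R v - ?R u) = - mu \<xi> *\<^sub>R integral {0..t} ?d"
      by (rule has_integral_unique)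
    have "rl_integral (1 - \<alpha>) ?d t = rl_integral (1 - \<alpha>) (\<lambda>s. (ip (v s) (e \<xi>) - ip \<phi> (e \<xi>)) - (ip (u s) (e \<xi>) - ip \<phi> (e \<xi>))) t"
      by simp
    also have "\<dots> = ?R v - ?R u"
      using t \<alpha> by (intro rl_integral_diff continuous_intros continuous_on_subset[OF U(1)] continuous_on_subset[OF V(1)]) auto
    also have "\<dots> = (1 / (1 + lam \<xi>)) *\<^sub>R (1 + lam \<xi>) *\<^sub>R (?R v - ?R u)"
      using lam[OF \<xi>] by simp
    also have "\<dots> = - (mu \<xi> / (1 + lam \<xi>)) *\<^sub>R integral {0..t} ?d"
      unfolding * by simp
    finally show "rl_integral (1 - \<alpha>) ?d t = - (mu \<xi> / (1 + lam \<xi>)) *\<^sub>R integral {0..t} ?d" .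
  qed
  then show "ip (v t) (e \<xi>) = ip (u t) (e \<xi>)" by simp
qed

end

section \<open>The four series of the solution formula\<close>

context pseudo_parabolic
begin

text \<open>The derivative in the formula is identified with \<open>g\<close> only almost
  everywhere; the integrand thus agrees almost everywhere with a Borel one, which is the convolution
  integrand after s -> t - s.\<close>

lemma set_integral_relaxation:
  assumes \<xi>: "\<xi> \<in> I" and t: "t \<in> {0..T}"
    and der: "AE x in lborel. 0 < x \<and> x < T \<longrightarrow> h x = g \<xi> x"
  shows "(LINT s:{0..t}|lebesgue. h (t - s) / of_real (mu \<xi>)
      * of_real (mittag_leffler \<alpha> 1 (- (mu \<xi> / (1 + lam \<xi>)) * s powr \<alpha>)))
    = conv (relaxation \<alpha> (rate \<xi>)) (g \<xi>) t / of_real (mu \<xi>)"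
proof -
  let ?Y = "relaxation \<alpha> (rate \<xi>)"
  let ?H = "\<lambda>s. (?Y s *\<^sub>R g \<xi> (t - s)) / of_real (mu \<xi>)"
  let ?F = "\<lambda>s. indicat_real {0..t} s *\<^sub>R (h (t - s) / of_real (mu \<xi>)
      * of_real (mittag_leffler \<alpha> 1 (- (mu \<xi> / (1 + lam \<xi>)) * s powr \<alpha>)))"
  note [measurable] = relaxation_measurable[OF \<alpha>] relaxation_forcing.g_measurable[OF forcing[OF \<xi>]]
  have H: "?H \<in> borel_measurable borel" by measurable
  have "AE s in lborel. ?F s = ?H s"
    \<comment> \<open>Off s = 0 and s = t the point t - s lies strictly between 0 and T whenever s
      is in [0,t], as the hypothesis on \<open>h\<close> requires.\<close>
    using AE_lborel_reflect[OF der, of t] AE_lborel_singleton[of 0] AE_lborel_singleton[of t]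
  proof eventually_elim
    case (elim s)
    consider "s < 0" | "t < s" | "0 < s" "s < t" using elim by linarith
    then show ?case
    proof cases
      case 1 then show ?thesis by (simp add: relaxation_neg)
    next
      case 2 then show ?thesis using g_neg[OF \<xi>, of "t - s"] by simp
    next
      case 3
      then have "h (t - s) = g \<xi> (t - s)" using elim(1) t by auto
      then show ?thesis using 3 by (simp add: relaxation_def rate_def scaleR_conv_of_real)
    qed
  qed
  then have ae: "AE s in lebesgue. ?F s = ?H s" by (rule AE_completion)
  have HL: "?H \<in> borel_measurable lebesgue" using H by (simp add: measurable_completion)
  have "(\<integral>s. ?F s \<partial>lebesgue) = (\<integral>s. ?H s \<partial>lebesgue)"
    by (rule integral_cong_AE[OF lebesgue_measurable_cong_AE[OF HL ae] HL ae])
  also have "\<dots> = (\<integral>s. ?H s \<partial>lborel)" using H by (simp add: integral_completion)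
  also have "\<dots> = conv ?Y (g \<xi>) t / of_real (mu \<xi>)"
    by (simp add: conv_reflect)
  finally show ?thesis by (simp only: set_lebesgue_integral_def)
qed

text \<open>Each series converges by itself because the Mittag-Leffler factor lies in [0,1] and 1 /
  mu <= 1 / m. The sums are then compared with \<open>sol\<close> on coefficients, by solving W = f
  - mu u for u.\<close>

lemma sol_series:
  assumes t: "t \<in> {0..T}"
    and der: "\<And>\<xi>. \<xi> \<in> I \<Longrightarrow>
      AE x in lborel. 0 < x \<and> x < T \<longrightarrow> vector_derivative (\<lambda>\<tau>. ip (f \<tau>) (e \<xi>)) (at x) = g \<xi> x"
  shows "\<exists>S1 S2 S3 S4.
      ((\<lambda>\<xi>. sc (ip \<phi> (e \<xi>)
          * of_real (mittag_leffler \<alpha> 1 (- (mu \<xi> / (1 + lam \<xi>)) * t powr \<alpha>))) (e \<xi>))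
        has_sum S1) I \<and>
      ((\<lambda>\<xi>. sc (ip (f t) (e \<xi>) / of_real (mu \<xi>)) (e \<xi>)) has_sum S2) I \<and>
      ((\<lambda>\<xi>. sc (ip (f 0) (e \<xi>) / of_real (mu \<xi>)
          * of_real (mittag_leffler \<alpha> 1 (- (mu \<xi> / (1 + lam \<xi>)) * t powr \<alpha>))) (e \<xi>))
        has_sum S3) I \<and>
      ((\<lambda>\<xi>. sc (LINT s:{0..t}|lebesgue.
          vector_derivative (\<lambda>\<tau>. ip (f \<tau>) (e \<xi>)) (at (t - s)) / of_real (mu \<xi>)
          * of_real (mittag_leffler \<alpha> 1 (- (mu \<xi> / (1 + lam \<xi>)) * s powr \<alpha>))) (e \<xi>))
        has_sum S4) I \<and>
      sol t = S1 + S2 - S3 - S4"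
proof -
  let ?E = "\<lambda>\<xi>. mittag_leffler \<alpha> 1 (- (mu \<xi> / (1 + lam \<xi>)) * t powr \<alpha>)"
  let ?Y = "\<lambda>\<xi>. relaxation \<alpha> (rate \<xi>)"
  let ?c4 = "\<lambda>\<xi>. (LINT s:{0..t}|lebesgue.
          vector_derivative (\<lambda>\<tau>. ip (f \<tau>) (e \<xi>)) (at (t - s)) / of_real (mu \<xi>)
          * of_real (mittag_leffler \<alpha> 1 (- (mu \<xi> / (1 + lam \<xi>)) * s powr \<alpha>)))"
  have E: "?E \<xi> = ?Y \<xi> t" for \<xi> using t by (simp add: relaxation_def rate_def)
  have E1: "\<bar>?E \<xi>\<bar> \<le> 1" if "\<xi> \<in> I" for \<xi>
    unfolding E using relaxation_nonneg[OF \<alpha> rate_pos[OF that], of t] relaxation_le_1[OF \<alpha> rate_pos[OF that], of t] by simp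
  have c4: "?c4 \<xi> = conv (?Y \<xi>) (g \<xi>) t / of_real (mu \<xi>)" if "\<xi> \<in> I" for \<xi>
    by (rule set_integral_relaxation[OF that t der[OF that]])
  have inv_mu: "x / mu \<xi> \<le> 1 / m * x" if "\<xi> \<in> I" "0 \<le> x" for \<xi> x
    using mu_ge[OF that(1)] m_pos that(2) by (simp add: frac_le)
  have b1: "norm (ip \<phi> (e \<xi>) * of_real (?E \<xi>)) \<le> norm (ip \<phi> (e \<xi>))" if "\<xi> \<in> I" for \<xi>
    using mult_left_mono[OF E1[OF that], of "norm (ip \<phi> (e \<xi>))"] by (simp only: norm_mult norm_of_real) simp
  have b2: "norm (ip (f t) (e \<xi>) / of_real (mu \<xi>)) \<le> 1 / m * norm (ip (f t) (e \<xi>))" if "\<xi> \<in> I" for \<xi> t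
    using inv_mu[OF that, of "norm (ip (f t) (e \<xi>))"] mu_pos[OF that] by (simp add: norm_divide)
  have b3: "norm (ip (f 0) (e \<xi>) / of_real (mu \<xi>) * of_real (?E \<xi>)) \<le> 1 / m * norm (ip (f 0) (e \<xi>))" if "\<xi> \<in> I" for \<xi>
  proof -
    have "norm (ip (f 0) (e \<xi>) / of_real (mu \<xi>)) * \<bar>?E \<xi>\<bar> \<le> norm (ip (f 0) (e \<xi>) / of_real (mu \<xi>)) * 1"
      by (rule mult_left_mono[OF E1[OF that]]) simp
    then show ?thesis
      unfolding norm_mult norm_of_real using b2[OF that, of 0] by linarith
  qed
  have b4: "norm (?c4 \<xi>) \<le> 1 / m * (\<integral>s. norm (g \<xi> s) \<partial>lborel)" if "\<xi> \<in> I" for \<xi>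
  proof -
    have "norm (conv (?Y \<xi>) (g \<xi>) t) \<le> 1 * (\<integral>s. norm (g \<xi> s) \<partial>lborel)"
      using relaxation_forcing.Y_abs_le[OF forcing[OF that]] relaxation_measurable[OF \<alpha>]
      by (intro relaxation_forcing.norm_conv_le[OF forcing[OF that]]) (auto simp: relaxation_neg)
    then have "norm (?c4 \<xi>) \<le> (\<integral>s. norm (g \<xi> s) \<partial>lborel) / mu \<xi>"
      unfolding c4[OF that] using mu_pos[OF that] by (simp add: norm_divide divide_right_mono)
    also have "\<dots> \<le> 1 / m * (\<integral>s. norm (g \<xi> s) \<partial>lborel)" by (rule inv_mu[OF that]) simp
    finally show ?thesis .
  qed
  have "\<exists>S. ((\<lambda>\<xi>. sc (ip \<phi> (e \<xi>) * of_real (?E \<xi>)) (e \<xi>)) has_sum S) I \<and> (\<forall>\<xi>\<in>I. ip S (e \<xi>) = ip \<phi> (e \<xi>) * of_real (?E \<xi>))"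
    by (rule dominated_has_sum_ex[OF _ summable_ip_basis]) (rule b1)
  then obtain S1 where S1: "((\<lambda>\<xi>. sc (ip \<phi> (e \<xi>) * of_real (?E \<xi>)) (e \<xi>)) has_sum S1) I"
      "\<forall>\<xi>\<in>I. ip S1 (e \<xi>) = ip \<phi> (e \<xi>) * of_real (?E \<xi>)" by blast
  have "\<exists>S. ((\<lambda>\<xi>. sc (ip (f t) (e \<xi>) / of_real (mu \<xi>)) (e \<xi>)) has_sum S) I \<and> (\<forall>\<xi>\<in>I. ip S (e \<xi>) = ip (f t) (e \<xi>) / of_real (mu \<xi>))"
    by (rule dominated_has_sum_ex[OF _ square_summable_cmult[OF summable_ip_basis]]) (rule b2)
  then obtain S2 where S2: "((\<lambda>\<xi>. sc (ip (f t) (e \<xi>) / of_real (mu \<xi>)) (e \<xi>)) has_sum S2) I"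
      "\<forall>\<xi>\<in>I. ip S2 (e \<xi>) = ip (f t) (e \<xi>) / of_real (mu \<xi>)" by blast
  have "\<exists>S. ((\<lambda>\<xi>. sc (ip (f 0) (e \<xi>) / of_real (mu \<xi>) * of_real (?E \<xi>)) (e \<xi>)) has_sum S) I \<and> (\<forall>\<xi>\<in>I. ip S (e \<xi>) = ip (f 0) (e \<xi>) / of_real (mu \<xi>) * of_real (?E \<xi>))"
    by (rule dominated_has_sum_ex[OF _ square_summable_cmult[OF summable_ip_basis]]) (rule b3)
  then obtain S3 where S3: "((\<lambda>\<xi>. sc (ip (f 0) (e \<xi>) / of_real (mu \<xi>) * of_real (?E \<xi>)) (e \<xi>)) has_sum S3) I"
      "\<forall>\<xi>\<in>I. ip S3 (e \<xi>) = ip (f 0) (e \<xi>) / of_real (mu \<xi>) * of_real (?E \<xi>)" by blast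
  have "\<exists>S. ((\<lambda>\<xi>. sc (?c4 \<xi>) (e \<xi>)) has_sum S) I \<and> (\<forall>\<xi>\<in>I. ip S (e \<xi>) = ?c4 \<xi>)"
    by (rule dominated_has_sum_ex[OF _ square_summable_cmult[OF g_sum]]) (rule b4)
  then obtain S4 where S4: "((\<lambda>\<xi>. sc (?c4 \<xi>) (e \<xi>)) has_sum S4) I"
      "\<forall>\<xi>\<in>I. ip S4 (e \<xi>) = ?c4 \<xi>" by blast
  have "sol t = S1 + S2 - S3 - S4"
  proof (rule eq_if_coefficients_eq)
    fix \<xi> assume \<xi>: "\<xi> \<in> I"
    have mu0: "of_real (mu \<xi>) \<noteq> (0::'k)" using mu_pos[OF \<xi>] by simp
    have "of_real (mu \<xi>) * coef \<xi> t = ip (f t) (e \<xi>) - W \<xi> t"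
      using W_eq[OF \<xi> t] by simp
    also have "\<dots> = ip (f t) (e \<xi>) - of_real (?E \<xi>) * (ip (f 0) (e \<xi>) - of_real (mu \<xi>) * ip \<phi> (e \<xi>))
        - of_real (mu \<xi>) * ?c4 \<xi>"
      using mu0 unfolding c4[OF \<xi>] E by (simp add: W_def drive_def scaleR_conv_of_real)
    finally have "coef \<xi> t = (ip (f t) (e \<xi>) - of_real (?E \<xi>) * (ip (f 0) (e \<xi>) - of_real (mu \<xi>) * ip \<phi> (e \<xi>))
        - of_real (mu \<xi>) * ?c4 \<xi>) / of_real (mu \<xi>)"
      using mu0 by (metis nonzero_mult_div_cancel_left)
    also have "\<dots> = ip \<phi> (e \<xi>) * of_real (?E \<xi>) + ip (f t) (e \<xi>) / of_real (mu \<xi>)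
        - ip (f 0) (e \<xi>) / of_real (mu \<xi>) * of_real (?E \<xi>) - ?c4 \<xi>"
    proof -
      have "(p - y * (q - z * x) - z * w) / z = x * y + p / z - q / z * y - w" if "z \<noteq> 0" for p q x y z w :: 'k
        using that by (simp add: field_simps)
      from this[OF mu0] show ?thesis .
    qed
    finally show "ip (sol t) (e \<xi>) = ip (S1 + S2 - S3 - S4) (e \<xi>)"
      using S1(2) S2(2) S3(2) S4(2) \<xi> by (simp only: ip_diff_left ip_add_left ip_sol[OF \<xi> t])
  qed
  with S1(1) S2(1) S3(1) S4(1) show ?thesis by blast
qed

end

theorem theorem2p3:
  fixes sc :: "'k::{real_normed_field,euclidean_space}
      \<Rightarrow> 'a::{real_inner,banach,second_countable_topology} \<Rightarrow> 'a"
    and ip :: "'a \<Rightarrow> 'a \<Rightarrow> 'k"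
    and L M :: "'a \<Rightarrow> 'a" and DL DM :: "'a set"
    and I :: "'i set" and e :: "'i \<Rightarrow> 'a" and lam mu :: "'i \<Rightarrow> real"
    and cL cM \<alpha> T :: real
    and \<phi> :: 'a and f :: "real \<Rightarrow> 'a"
  assumes "0 < \<alpha>" "\<alpha> < 1" "0 < T"
    and "hilbert_over sc ip"
    and "self_adjoint sc ip DL L" "self_adjoint sc ip DM M"
    and "countable I" "orthonormal_basis sc ip I e"
    and "\<And>\<xi>. \<xi> \<in> I \<Longrightarrow> e \<xi> \<in> DL \<and> L (e \<xi>) = sc (of_real (lam \<xi>)) (e \<xi>)"
    and "\<And>\<xi>. \<xi> \<in> I \<Longrightarrow> e \<xi> \<in> DM \<and> M (e \<xi>) = sc (of_real (mu \<xi>)) (e \<xi>)"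
    and "0 < cL" "\<And>\<xi>. \<xi> \<in> I \<Longrightarrow> cL \<le> lam \<xi>"
    and "0 < cM" "\<And>\<xi>. \<xi> \<in> I \<Longrightarrow> cM \<le> mu \<xi>"
    and "\<phi> \<in> spectral_space sc ip I e lam 1 \<inter> spectral_space sc ip I e mu 1"
    and "W_on 1 T f"
  shows "\<exists>u. generalised_solution sc ip I e L lam M mu \<alpha> T \<phi> f u \<and>
    (\<forall>v. generalised_solution sc ip I e L lam M mu \<alpha> T \<phi> f v \<longrightarrow> (\<forall>t\<in>{0..T}. v t = u t)) \<and>
    (\<forall>t\<in>{0..T}. \<exists>S1 S2 S3 S4.
      ((\<lambda>\<xi>. sc (ip \<phi> (e \<xi>)
          * of_real (mittag_leffler \<alpha> 1 (- (mu \<xi> / (1 + lam \<xi>)) * t powr \<alpha>))) (e \<xi>))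
        has_sum S1) I \<and>
      ((\<lambda>\<xi>. sc (ip (f t) (e \<xi>) / of_real (mu \<xi>)) (e \<xi>)) has_sum S2) I \<and>
      ((\<lambda>\<xi>. sc (ip (f 0) (e \<xi>) / of_real (mu \<xi>)
          * of_real (mittag_leffler \<alpha> 1 (- (mu \<xi> / (1 + lam \<xi>)) * t powr \<alpha>))) (e \<xi>))
        has_sum S3) I \<and>
      ((\<lambda>\<xi>. sc (LINT s:{0..t}|lebesgue.
          vector_derivative (\<lambda>\<tau>. ip (f \<tau>) (e \<xi>)) (at (t - s)) / of_real (mu \<xi>)
          * of_real (mittag_leffler \<alpha> 1 (- (mu \<xi> / (1 + lam \<xi>)) * s powr \<alpha>))) (e \<xi>))
        has_sum S4) I \<and>
      u t = S1 + S2 - S3 - S4)"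
proof -
  interpret hilbert_basis sc ip I e
    using assms(4,8) by (simp add: hilbert_basis_def hilbert_basis_axioms_def)
  have lam: "0 < lam \<xi>" if "\<xi> \<in> I" for \<xi> using assms(11) assms(12)[OF that] by simp
  have mu: "0 < mu \<xi>" if "\<xi> \<in> I" for \<xi> using assms(13) assms(14)[OF that] by simp
  obtain g where g: "\<And>\<xi>. \<xi> \<in> I \<Longrightarrow> integrable lborel (g \<xi>)"
      "\<And>\<xi> s. \<xi> \<in> I \<Longrightarrow> s < 0 \<Longrightarrow> g \<xi> s = 0"
      "\<And>\<xi> t. \<xi> \<in> I \<Longrightarrow> t \<in> {0..T} \<Longrightarrow>
        (\<integral>s. indicator {0..t} s *\<^sub>R g \<xi> s \<partial>lborel) = ip (f t) (e \<xi>) - ip (f 0) (e \<xi>)"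
    and der: "\<And>\<xi>. \<xi> \<in> I \<Longrightarrow>
        AE x in lborel. 0 < x \<and> x < T \<longrightarrow> vector_derivative (\<lambda>\<tau>. ip (f \<tau>) (e \<xi>)) (at x) = g \<xi> x"
    and g_sum: "(\<lambda>\<xi>. (\<integral>s. norm (g \<xi> s) \<partial>lborel)\<^sup>2) summable_on I"
    by (rule W_1_coefficient_derivatives[OF assms(3,16)]) (rule that; assumption)
  \<comment> \<open>The constant m of the locale, which bounds 1 / mu in the series, is
    \<open>cM\<close>.\<close>
  interpret pseudo_parabolic sc ip I e lam mu \<alpha> T cM \<phi> f g
  proof
    show "(\<lambda>\<xi>. (lam \<xi> * norm (ip \<phi> (e \<xi>)))\<^sup>2) summable_on I"
      using assms(15) mem_spectral_space_iff[of lam \<phi>, OF lam] by blast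
    show "(\<lambda>\<xi>. (mu \<xi> * norm (ip \<phi> (e \<xi>)))\<^sup>2) summable_on I"
      using assms(15) mem_spectral_space_iff[of mu \<phi>, OF mu] by blast
    show "continuous_on {0..T} f"
      using assms(16) by (simp add: W_on_def caputo_differentiable_def)
  qed (use assms(1-3,13,14) lam g g_sum in auto)
  have sol: "generalised_solution sc ip I e L lam M mu \<alpha> T \<phi> f sol"
    by (rule sol_generalised_solution[OF assms(5,9,6,10)])
  show ?thesis
  proof (intro exI[of _ sol] conjI allI impI ballI sol)
    show "v t = sol t" if "generalised_solution sc ip I e L lam M mu \<alpha> T \<phi> f v" "t \<in> {0..T}" for v t
      by (rule generalised_solution_unique[OF assms(1-3,5,9,6,10) lam mu sol that])
  qed (rule sol_series[OF _ der])
qed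

end
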